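(* Let $\Sigma=(\mathbb{P},\{A_i,B_i,C_i,D_i\}_{i=0}^{n_{\mathrm p}})$ be an LPV-SSA which satisfies the regularity certificate (RC), and let $\Sigma^{\mathrm O}$ be an LPV-SSA returned by the observability reduction procedure (described in the context) applied to $\Sigma$. Then $\Sigma^{\mathrm O}$ satisfies RC, $\Sigma^{\mathrm O}$ is minimal, and $\mathcal{B}(\Sigma^{\mathrm O})=\mathcal{B}(\Sigma)$.
   Context: Time axis: $\mathbb{T}=[0,+\infty)$ in continuous time (CT) and $\mathbb{T}=\mathbb{N}=\{0,1,2,\ldots\}$ in discrete time (DT); everything is considered for each of the two cases. The operator $\xi$ is $(\xi z)(t)=\frac{d}{dt}z(t)$ in CT and $(\xi z)(t)=z(t+1)$ in DT. LPV-SSA: given $\mathbb{P}\subseteq\mathbb{R}^{n_{\mathrm p}}$ and matrices $A_i\in\mathbb{R}^{n_{\mathrm x}\times n_{\mathrm x}}$, $B_i\in\mathbb{R}^{n_{\mathrm x}\times n_{\mathrm u}}$, $C_i\in\mathbb{R}^{n_{\mathrm y}\times n_{\mathrm x}}$, $D_i\in\mathbb{R}^{n_{\mathrm y}\times n_{\mathrm u}}$, $i=0,\ldots,n_{\mathrm p}$, put $A(\mathbf{p})=A_0+\sum_{i=1}^{n_{\mathrm p}}A_i\mathbf{p}_i$ for $\mathbf{p}\in\mathbb{P}$, and similarly $B(\mathbf p),C(\mathbf p),D(\mathbf p)$. The LPV-SSA $\Sigma=(\mathbb{P},\{A_i,B_i,C_i,D_i\}_{i=0}^{n_{\mathrm p}})$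 is the system $$\xi x(t)=A(p(t))x(t)+B(p(t))u(t),\qquad y(t)=C(p(t))x(t)+D(p(t))u(t).$$ Its state dimension is $\dim\Sigma=n_{\mathrm x}$ (state dimension $0$ is allowed for LPV-SSAs; the procedure below is applied to $\Sigma$ with $n_{\mathrm x}\ge 1$). Signal spaces: in DT, $\mathcal{X},\mathcal{Y},\mathcal{U},\mathcal{P}$ are the sets of all functions from $\mathbb{N}$ to $\mathbb{R}^{n_{\mathrm x}},\mathbb{R}^{n_{\mathrm y}},\mathbb{R}^{n_{\mathrm u}},\mathbb{P}$. In CT, $\mathcal{X}$ is the set of absolutely continuous functions $[0,\infty)\to\mathbb{R}^{n_{\mathrm x}}$, and $\mathcal{Y},\mathcal{U},\mathcal{P}$ are the sets of piecewise-continuous functions from $[0,\infty)$ to $\mathbb{R}^{n_{\mathrm y}},\mathbb{R}^{n_{\mathrm u}},\mathbb{P}$; in CT, output functions that agree almost everywhere are identified. A solution of $\Sigma$ is a tuple $(x,y,u,p)\in\mathcal{X}\times\mathcal{Y}\times\mathcal{U}\times\mathcal{P}$ satisfying the equations for almost all $t\in\mathbb{T}$ (CT), respectively all $t\in\mathbb{T}$ (DT). Manifest behavior: $\mathcal{B}(\Sigma)=\{(y,u,p)\in\mathcal{Y}\times\mathcal{U}\times\mathcal{P}\mid \exists x\in\mathcal{X}: (x,y,u,p)\text{ is a solution of }\Sigma\}$. $\Sigma$ is minimal if $\dim\Sigma\le\dim\Sigma'$ for every LPV-SSA $\Sigma'$ with $\mathcal{B}(\Sigma')=\mathcal{B}(\Sigma)$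 ($\Sigma'$ not required to satisfy RC). Regularity certificate (RC): $\Sigma$ satisfies RC if (1) $\mathbb{P}$ is convex with non-empty interior, and (2) in the DT case, $A(\mathbf{p})$ is invertible for all $\mathbf{p}\in\mathbb{P}$. Extended observability matrices of $\Sigma$: $\mathcal{O}_0=[C_0^\top\ \cdots\ C_{n_{\mathrm p}}^\top]^\top$ and $\mathcal{O}_{n+1}=[\mathcal{O}_n^\top\ \ A_0^\top\mathcal{O}_n^\top\ \cdots\ A_{n_{\mathrm p}}^\top\mathcal{O}_n^\top]^\top$, $n\in\mathbb{N}$. Observability reduction procedure: choose a basis $b_1,\ldots,b_{n_{\mathrm x}}$ of $\mathbb{R}^{n_{\mathrm x}}$ such that $\mathrm{Span}\{b_{o+1},\ldots,b_{n_{\mathrm x}}\}=\ker\mathcal{O}_{n_{\mathrm x}-1}$ (so $o=\mathrm{rank}\,\mathcal{O}_{n_{\mathrm x}-1}$) and set $T=[b_1\ b_2\ \cdots\ b_{n_{\mathrm x}}]^{-1}$. Then for $i=0,\ldots,n_{\mathrm p}$ $$TA_iT^{-1}=\begin{bmatrix} A_i^{\mathrm O} & 0 \\ A_i' & A_i'' \end{bmatrix},\quad TB_i=\begin{bmatrix} B_i^{\mathrm O} \\ B_i' \end{bmatrix},\quad C_iT^{-1}=\begin{bmatrix} C_i^{\mathrm O} & 0 \end{bmatrix},$$ with $A_i^{\mathrm O}\in\mathbb{R}^{o\times o}$, $B_i^{\mathrm O}\in\mathbb{R}^{o\times n_{\mathrm u}}$, $C_i^{\mathrm O}\in\mathbb{R}^{n_{\mathrm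 y}\times o}$. The procedure returns $\Sigma^{\mathrm O}=(\mathbb{P},\{A_i^{\mathrm O},B_i^{\mathrm O},C_i^{\mathrm O},D_i\}_{i=0}^{n_{\mathrm p}})$. *)

theory Defs
  imports "HOL-Analysis.Analysis" "Jordan_Normal_Form.Matrix_Kernel"
begin

unbundle no vec_syntax
unbundle no inner_syntax

text \<open>
  Dimensions have to vary, since minimality compares representations of different state
  dimension, so vectors and matrices are the dimension-carrying ones of
  \<^theory>\<open>Jordan_Normal_Form.Matrix\<close>. Only the coefficient matrices with index at most
  \<open>np\<close> are meaningful. Every dimension may be 0.
\<close>

record lpv =
  np :: nat
  nx :: nat
  nu :: nat
  ny :: nat
  par :: "real vec set"
  matA :: "nat \<Rightarrow> real mat"
  matB :: "nat \<Rightarrow> real mat"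
  matC :: "nat \<Rightarrow> real mat"
  matD :: "nat \<Rightarrow> real mat"

definition lpv_ssa :: "lpv \<Rightarrow> bool" where
  "lpv_ssa S \<longleftrightarrow> par S \<subseteq> carrier_vec (np S) \<and>
     (\<forall>i\<le>np S. matA S i \<in> carrier_mat (nx S) (nx S) \<and> matB S i \<in> carrier_mat (nx S) (nu S) \<and>
              matC S i \<in> carrier_mat (ny S) (nx S) \<and> matD S i \<in> carrier_mat (ny S) (nu S))"

text \<open>
  \<open>M 0 + M 1 * p\<^sub>1 + \<dots> + M n * p\<^sub>n\<close>, written entrywise. Vector components are
  counted from 0, so the component paired with \<open>M i\<close> is \<open>p $ (i - 1)\<close>.
\<close>

definition affine_mat :: "nat \<Rightarrow> nat \<Rightarrow> nat \<Rightarrow> (nat \<Rightarrow> real mat) \<Rightarrow> real vec \<Rightarrow> real mat" where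
  "affine_mat n nr nc M p =
     mat nr nc (\<lambda>(r, c). M 0 $$ (r, c) + (\<Sum>i = 1..n. M i $$ (r, c) * p $ (i - 1)))"

definition A_at :: "lpv \<Rightarrow> real vec \<Rightarrow> real mat" where
  "A_at S = affine_mat (np S) (nx S) (nx S) (matA S)"

definition B_at :: "lpv \<Rightarrow> real vec \<Rightarrow> real mat" where
  "B_at S = affine_mat (np S) (nx S) (nu S) (matB S)"

definition C_at :: "lpv \<Rightarrow> real vec \<Rightarrow> real mat" where
  "C_at S = affine_mat (np S) (ny S) (nx S) (matC S)"

definition D_at :: "lpv \<Rightarrow> real vec \<Rightarrow> real mat" where
  "D_at S = affine_mat (np S) (ny S) (nu S) (matD S)"

definition state_rhs :: "lpv \<Rightarrow> real vec \<Rightarrow> real vec \<Rightarrow> real vec \<Rightarrow> real vec" where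
  "state_rhs S p x u = A_at S p *\<^sub>v x + B_at S p *\<^sub>v u"

definition output_rhs :: "lpv \<Rightarrow> real vec \<Rightarrow> real vec \<Rightarrow> real vec \<Rightarrow> real vec" where
  "output_rhs S p x u = C_at S p *\<^sub>v x + D_at S p *\<^sub>v u"

definition dt_solution ::
  "lpv \<Rightarrow> (nat \<Rightarrow> real vec) \<Rightarrow> (nat \<Rightarrow> real vec) \<Rightarrow> (nat \<Rightarrow> real vec) \<Rightarrow> (nat \<Rightarrow> real vec) \<Rightarrow> bool" where
  "dt_solution S x y u p \<longleftrightarrow>
     x \<in> UNIV \<rightarrow> carrier_vec (nx S) \<and> y \<in> UNIV \<rightarrow> carrier_vec (ny S) \<and>
     u \<in> UNIV \<rightarrow> carrier_vec (nu S) \<and> p \<in> UNIV \<rightarrow> par S \<and>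
     (\<forall>t. x (t + 1) = state_rhs S (p t) (x t) (u t) \<and> y t = output_rhs S (p t) (x t) (u t))"

definition dt_behavior ::
  "lpv \<Rightarrow> ((nat \<Rightarrow> real vec) \<times> (nat \<Rightarrow> real vec) \<times> (nat \<Rightarrow> real vec)) set" where
  "dt_behavior S = {(y, u, p). \<exists>x. dt_solution S x y u p}"

text \<open>
  Functions on \<open>[0, \<infinity>)\<close> are total functions that are \<open>undefined\<close> at negative times
  (\<open>PiE\<close>), so that equality of signals is equality on \<open>[0, \<infinity>)\<close>. Regularity of
  vector-valued signals is componentwise.
\<close>

text \<open>
  Finitely many discontinuities in each bounded interval, with finite one-sided limits
  everywhere.
\<close>

definition piecewise_continuous :: "(real \<Rightarrow> real) \<Rightarrow> bool" where
  "piecewise_continuous f \<longleftrightarrow>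
     (\<forall>b. finite {t \<in> {0..b}. \<not> continuous (at t within {0..}) f}) \<and>
     (\<forall>t\<ge>0. \<exists>l. (f \<longlongrightarrow> l) (at_right t)) \<and>
     (\<forall>t>0. \<exists>l. (f \<longlongrightarrow> l) (at_left t))"

definition pc_signals :: "nat \<Rightarrow> real vec set \<Rightarrow> (real \<Rightarrow> real vec) set" where
  "pc_signals n V = {f \<in> {0..} \<rightarrow>\<^sub>E V. \<forall>i<n. piecewise_continuous (\<lambda>t. f t $ i)}"

definition abs_continuous_on_interval :: "real \<Rightarrow> real \<Rightarrow> (real \<Rightarrow> real) \<Rightarrow> bool" where
  "abs_continuous_on_interval a b f \<longleftrightarrow>
     (\<forall>\<epsilon>>0. \<exists>\<delta>>0. \<forall>I. finite I \<and> (\<forall>(s, t)\<in>I. a \<le> s \<and> s \<le> t \<and> t \<le> b) \<and>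
        disjoint_family_on (\<lambda>(s, t). {s<..<t}) I \<and> (\<Sum>(s, t)\<in>I. t - s) < \<delta>
        \<longrightarrow> (\<Sum>(s, t)\<in>I. \<bar>f t - f s\<bar>) < \<epsilon>)"

text \<open>
  As usual for trajectories, absolute continuity on the unbounded interval \<open>[0, \<infinity>)\<close>
  means absolute continuity on each of its compact subintervals; the uniform version would
  exclude exponentials.
\<close>

definition ac_signals :: "nat \<Rightarrow> (real \<Rightarrow> real vec) set" where
  "ac_signals n = {f \<in> {0..} \<rightarrow>\<^sub>E carrier_vec n.
     \<forall>i<n. \<forall>b\<ge>0. abs_continuous_on_interval 0 b (\<lambda>t. f t $ i)}"

definition ct_solution ::
  "lpv \<Rightarrow> (real \<Rightarrow> real vec) \<Rightarrow> (real \<Rightarrow> real vec) \<Rightarrow> (real \<Rightarrow> real vec) \<Rightarrow> (real \<Rightarrow> real vec) \<Rightarrow> bool" where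
  "ct_solution S x y u p \<longleftrightarrow>
     x \<in> ac_signals (nx S) \<and> y \<in> pc_signals (ny S) (carrier_vec (ny S)) \<and>
     u \<in> pc_signals (nu S) (carrier_vec (nu S)) \<and> p \<in> pc_signals (np S) (par S) \<and>
     (AE t in lborel. 0 \<le> t \<longrightarrow>
        (\<forall>i<nx S. ((\<lambda>s. x s $ i) has_real_derivative state_rhs S (p t) (x t) (u t) $ i)
           (at t within {0..})) \<and>
        y t = output_rhs S (p t) (x t) (u t))"

text \<open>The output signals that are identified with \<open>y\<close>.\<close>

definition output_class :: "nat \<Rightarrow> (real \<Rightarrow> real vec) \<Rightarrow> (real \<Rightarrow> real vec) set" where
  "output_class n y =
     {y' \<in> pc_signals n (carrier_vec n). AE t in lborel. 0 \<le> t \<longrightarrow> y' t = y t}"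

definition ct_behavior ::
  "lpv \<Rightarrow> ((real \<Rightarrow> real vec) set \<times> (real \<Rightarrow> real vec) \<times> (real \<Rightarrow> real vec)) set" where
  "ct_behavior S = {(output_class (ny S) y, u, p) | y u p. \<exists>x. ct_solution S x y u p}"

definition ct_minimal :: "lpv \<Rightarrow> bool" where
  "ct_minimal S \<longleftrightarrow> lpv_ssa S \<and>
     (\<forall>S'. lpv_ssa S' \<and> ct_behavior S' = ct_behavior S \<longrightarrow> nx S \<le> nx S')"

definition dt_minimal :: "lpv \<Rightarrow> bool" where
  "dt_minimal S \<longleftrightarrow> lpv_ssa S \<and>
     (\<forall>S'. lpv_ssa S' \<and> dt_behavior S' = dt_behavior S \<longrightarrow> nx S \<le> nx S')"

definition convex_vec_set :: "real vec set \<Rightarrow> bool" where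
  "convex_vec_set P \<longleftrightarrow>
     (\<forall>p\<in>P. \<forall>q\<in>P. \<forall>s\<in>{0..1}. (1 - s) \<cdot>\<^sub>v p + s \<cdot>\<^sub>v q \<in> P)"

definition vec_interior :: "nat \<Rightarrow> real vec set \<Rightarrow> real vec set" where
  "vec_interior n P = {c \<in> carrier_vec n.
     \<exists>r>0. \<forall>q\<in>carrier_vec n. L2_set (\<lambda>i. q $ i - c $ i) {..<n} < r \<longrightarrow> q \<in> P}"

definition ct_regular :: "lpv \<Rightarrow> bool" where
  "ct_regular S \<longleftrightarrow> convex_vec_set (par S) \<and> vec_interior (np S) (par S) \<noteq> {}"

definition dt_regular :: "lpv \<Rightarrow> bool" where
  "dt_regular S \<longleftrightarrow> convex_vec_set (par S) \<and> vec_interior (np S) (par S) \<noteq> {} \<and>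
     (\<forall>p\<in>par S. invertible_mat (A_at S p))"

definition vstack :: "nat \<Rightarrow> real mat list \<Rightarrow> real mat" where
  "vstack nc Ms = mat_of_rows nc (concat (map rows Ms))"

text \<open>The blocks \<open>A\<^sub>i\<^sup>T O\<^sup>T\<close> of the transposed matrix are the blocks \<open>O A\<^sub>i\<close> here.\<close>

fun obs_mat :: "lpv \<Rightarrow> nat \<Rightarrow> real mat" where
  "obs_mat S 0 = vstack (nx S) (map (matC S) [0..<np S + 1])"
| "obs_mat S (Suc n) =
     vstack (nx S) (obs_mat S n # map (\<lambda>i. obs_mat S n * matA S i) [0..<np S + 1])"

text \<open>
  \<open>bs\<close> is the chosen basis, \<open>Ti\<close> the matrix with these columns and \<open>T\<close> its inverse;
  \<open>R\<close> is a possible result, with \<open>nx R\<close> in the role of \<open>o\<close>. The four-block matrix for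
  \<open>C\<close> has an empty lower half.
\<close>

definition obs_reduction :: "lpv \<Rightarrow> lpv \<Rightarrow> bool" where
  "obs_reduction S R \<longleftrightarrow>
     np R = np S \<and> nu R = nu S \<and> ny R = ny S \<and> par R = par S \<and> nx R \<le> nx S \<and>
     (\<exists>bs T Ti.
        length bs = nx S \<and> distinct bs \<and>
        vectorspace.basis class_ring (module_vec TYPE(real) (nx S)) (set bs) \<and>
        LinearCombinations.module.span class_ring (module_vec TYPE(real) (nx S))
          (set (drop (nx R) bs)) = mat_kernel (obs_mat S (nx S - 1)) \<and>
        Ti = mat_of_cols (nx S) bs \<and>
        T \<in> carrier_mat (nx S) (nx S) \<and> inverts_mat T Ti \<and> inverts_mat Ti T \<and>
        (\<forall>i\<le>np S. \<exists>A' A'' B'.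
           matA R i \<in> carrier_mat (nx R) (nx R) \<and>
           A' \<in> carrier_mat (nx S - nx R) (nx R) \<and>
           A'' \<in> carrier_mat (nx S - nx R) (nx S - nx R) \<and>
           T * matA S i * Ti = four_block_mat (matA R i) (0\<^sub>m (nx R) (nx S - nx R)) A' A'' \<and>
           matB R i \<in> carrier_mat (nx R) (nu S) \<and>
           B' \<in> carrier_mat (nx S - nx R) (nu S) \<and>
           T * matB S i = matB R i @\<^sub>r B' \<and>
           matC R i \<in> carrier_mat (ny S) (nx R) \<and>
           matC S i * Ti =
             four_block_mat (matC R i) (0\<^sub>m (ny S) (nx S - nx R))
               (0\<^sub>m 0 (nx R)) (0\<^sub>m 0 (nx S - nx R)) \<and>
           matD R i = matD S i))"

end

theory Submission
  imports Defs
begin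

text \<open>
  The first rows \<open>L\<close> of \<open>T\<close> map solutions of the given system to solutions of the reduced one
  with the same output. Conversely a solution of the reduced system lifts: run the given system
  from a preimage of the initial state; by uniqueness its image under \<open>L\<close> is the given state
  trajectory. So the behaviors agree.

  The reduced system is observable: the preimage under \<open>L\<close> of a subspace that is invariant under all
  \<open>A\<^sub>i\<close> and annihilated by all \<open>C\<^sub>i\<close> lies in the kernel of the observability matrix, which \<open>L\<close> maps
  to 0. As the scheduling set has interior points, one may replace the \<open>A\<^sub>i, C\<^sub>i\<close> by the values
  \<open>A(p), C(p)\<close> here, so every nonzero state is seen by some scheduling signal with zero input.
  Because the state transition is injective (in discrete time by the invertibility of \<open>A(p)\<close>),
  such signals can be concatenated until a single one separates all states from 0. Along this
  signal the zero-input outputs form a space whose dimension is the state dimension; a system with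
  the same behavior and fewer states cannot produce all of them.
\<close>

section \<open>Piecewise continuous functions\<close>

text \<open>Initial states are free in a behavior, so all zero-input trajectories belong to it; this
  is why observability alone decides minimality. A competing system answers each output with some
  state trajectory of its own, and nothing relates its answers for different scheduling signals.
  Along one common signal the choice does not matter: the zero-input trajectories of the competitor
  form a linear space of at most its state dimension, and the comparison becomes a dimension count.
  The competitor shares only the behavior with the reduced system; its input and output dimensions
  are read off from the signals. In continuous time two almost-everywhere clauses shape the proof.
  The state equation is replaced by an integral equation, which rests on the fact that an absolutely
  continuous function with derivative 0 almost everywhere is constant. Outputs are known only up to
  null sets, so the separating signal is kept right continuous. Injectivity of the state transition
  comes from uniqueness of solutions backward in time.\<close>

lemma piecewise_continuous_op:
  assumes f: "piecewise_continuous f" and g: "piecewise_continuous g"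
    and F: "\<And>(G::real filter) l m. (f \<longlongrightarrow> l) G \<Longrightarrow> (g \<longlongrightarrow> m) G \<Longrightarrow> ((\<lambda>t. F (f t) (g t)) \<longlongrightarrow> F l m) G"
  shows "piecewise_continuous (\<lambda>t. F (f t) (g t))"
  unfolding piecewise_continuous_def
proof (intro conjI allI impI)
  fix b
  have "{t \<in> {0..b}. \<not> continuous (at t within {0..}) (\<lambda>t. F (f t) (g t))}
     \<subseteq> {t \<in> {0..b}. \<not> continuous (at t within {0..}) f} \<union> {t \<in> {0..b}. \<not> continuous (at t within {0..}) g}"
    unfolding continuous_within using F by blast
  then show "finite {t \<in> {0..b}. \<not> continuous (at t within {0..}) (\<lambda>t. F (f t) (g t))}"
    using f g unfolding piecewise_continuous_def by (meson finite_UnI finite_subset)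
next
  fix t :: real assume "0 \<le> t"
  then obtain l m where "(f \<longlongrightarrow> l) (at_right t)" "(g \<longlongrightarrow> m) (at_right t)"
    using f g unfolding piecewise_continuous_def by blast
  then show "\<exists>l. ((\<lambda>t. F (f t) (g t)) \<longlongrightarrow> l) (at_right t)" using F by blast
next
  fix t :: real assume "0 < t"
  then obtain l m where "(f \<longlongrightarrow> l) (at_left t)" "(g \<longlongrightarrow> m) (at_left t)"
    using f g unfolding piecewise_continuous_def by blast
  then show "\<exists>l. ((\<lambda>t. F (f t) (g t)) \<longlongrightarrow> l) (at_left t)" using F by blast
qed

lemma piecewise_continuous_add:
  "piecewise_continuous f \<Longrightarrow> piecewise_continuous g \<Longrightarrow> piecewise_continuous (\<lambda>t. f t + g t)"
  by (rule piecewise_continuous_op) (auto intro: tendsto_add)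

lemma piecewise_continuous_mult:
  "piecewise_continuous f \<Longrightarrow> piecewise_continuous g \<Longrightarrow> piecewise_continuous (\<lambda>t. f t * g t)"
  by (rule piecewise_continuous_op) (auto intro: tendsto_mult)

lemma piecewise_continuous_const: "piecewise_continuous (\<lambda>t. c)"
  unfolding piecewise_continuous_def by (auto intro: tendsto_const)

lemma piecewise_continuous_sum:
  "finite I \<Longrightarrow> (\<And>i. i \<in> I \<Longrightarrow> piecewise_continuous (f i)) \<Longrightarrow> piecewise_continuous (\<lambda>t. \<Sum>i\<in>I. f i t)"
  by (induction I rule: finite_induct) (auto intro: piecewise_continuous_const piecewise_continuous_add)

text \<open>Signals are \<open>undefined\<close> at negative times, and entries of products are
  known only for vectors of the right dimension, so equality at nonnegative times has to suffice. It
  does, because the filters occurring in \<open>piecewise_continuous\<close> eventually stay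
  there.\<close>

lemma piecewise_continuous_cong:
  assumes "piecewise_continuous f" and eq: "\<And>t. 0 \<le> t \<Longrightarrow> g t = f t"
  shows "piecewise_continuous g"
proof -
  have "continuous (at t within {0..}) g \<longleftrightarrow> continuous (at t within {0..}) f" if "0 \<le> t" for t
    unfolding continuous_within eq[OF that]
    by (rule filterlim_cong) (auto simp: eventually_at_filter eq)
  moreover have "(g \<longlongrightarrow> l) (at_right t) \<longleftrightarrow> (f \<longlongrightarrow> l) (at_right t)" if "0 \<le> t" for t l
    by (rule filterlim_cong) (use that in \<open>auto simp: eventually_at_filter eq\<close>)
  moreover have "(g \<longlongrightarrow> l) (at_left t) \<longleftrightarrow> (f \<longlongrightarrow> l) (at_left t)" if "0 < t" for t l
    by (rule filterlim_cong)
      (use that eventually_at_left_real[OF that] in \<open>auto elim!: eventually_mono simp: eq\<close>)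
  ultimately show ?thesis
    using assms(1) unfolding piecewise_continuous_def
    by (auto cong: conj_cong)
qed

lemma continuous_imp_piecewise_continuous:
  assumes "continuous_on {0..} f"
  shows "piecewise_continuous f"
proof -
  have c: "continuous (at t within {0..}) f" if "0 \<le> t" for t
    using assms that by (simp add: continuous_on_eq_continuous_within)
  then have t: "(f \<longlongrightarrow> f t) (at t within {0..})" if "0 \<le> t" for t
    using that by (simp add: continuous_within)
  have "(f \<longlongrightarrow> f t) (at_right t)" if "0 \<le> t" for t
    by (rule tendsto_within_subset[OF t]) (use that in auto)
  moreover have "(f \<longlongrightarrow> f t) (at_left t)" if "0 < t" for t
  proof -
    have "at t within {0..} = at t"
      by (rule at_within_nhd[of t "{0<..}"]) (use that in auto)
    then have "(f \<longlongrightarrow> f t) (at t)"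
      using t[of t] that by (metis less_imp_le)
    then show ?thesis
      by (rule tendsto_within_subset) simp
  qed
  moreover have "{t \<in> {0..b}. \<not> continuous (at t within {0..}) f} = {}" for b
    using c by auto
  ultimately show ?thesis
    unfolding piecewise_continuous_def by (metis finite.emptyI)
qed

text \<open>The one-sided limits bound \<open>f\<close> on a punctured neighbourhood of every point,
  the value at the point is one more number, and bisection turns the local bounds into a global
  one.\<close>

lemma piecewise_continuous_bounded:
  assumes "piecewise_continuous f"
  shows "\<exists>K. \<forall>t\<in>{0..b}. \<bar>f t\<bar> \<le> K"
proof (cases "0 \<le> b")
  case True
  \<comment> \<open>Bisection also examines intervals around 0 that start below 0, where nothing is
    known about \<open>f\<close>; hence the intersection with \<open>{0..}\<close>.\<close>
  have "bounded (f ` ({0..b} \<inter> {0..}))"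
    using True
  proof (induction rule: Bolzano[where P = "\<lambda>u v. bounded (f ` ({u..v} \<inter> {0..}))"])
    case (trans u v w)
    have eq: "{u..w} \<inter> {0..} = ({u..v} \<inter> {0..}) \<union> ({v..w} \<inter> {0..})"
      using trans by auto
    show ?case unfolding eq image_Un by (rule bounded_Un[THEN iffD2, OF conjI]) (fact trans)+
  next
    case (local t)
    then have "0 \<le> t" by simp
    have right: "\<exists>d>0. \<exists>K. \<forall>s. t < s \<and> s < t + d \<longrightarrow> \<bar>f s\<bar> \<le> K"
    proof -
      obtain l where "(f \<longlongrightarrow> l) (at_right t)"
        using assms \<open>0 \<le> t\<close> unfolding piecewise_continuous_def by blast
      then have "\<forall>\<^sub>F s in at_right t. dist (f s) l < 1" by (rule tendstoD) simp
      then obtain c where c: "c > t" "\<forall>s>t. s < c \<longrightarrow> dist (f s) l < 1"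
        unfolding eventually_at_right_field by blast
      then have "\<forall>s. t < s \<and> s < t + (c - t) \<longrightarrow> \<bar>f s\<bar> \<le> \<bar>l\<bar> + 1"
        by (auto simp: dist_real_def)
      then show ?thesis using c(1) by (metis diff_gt_0_iff_gt)
    qed
    have left: "\<exists>d>0. \<exists>K. \<forall>s. 0 \<le> s \<and> s < t \<and> t - d < s \<longrightarrow> \<bar>f s\<bar> \<le> K"
    proof (cases "t = 0")
      case True
      then show ?thesis by (intro exI[of _ 1]) auto
    next
      case False
      then obtain l where "(f \<longlongrightarrow> l) (at_left t)"
        using assms \<open>0 \<le> t\<close> unfolding piecewise_continuous_def by fastforce
      then have "\<forall>\<^sub>F s in at_left t. dist (f s) l < 1" by (rule tendstoD) simp
      then obtain c where c: "c < t" "\<forall>s>c. s < t \<longrightarrow> dist (f s) l < 1"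
        unfolding eventually_at_left_field by blast
      then have "\<forall>s. 0 \<le> s \<and> s < t \<and> t - (t - c) < s \<longrightarrow> \<bar>f s\<bar> \<le> \<bar>l\<bar> + 1"
        by (auto simp: dist_real_def)
      then show ?thesis using c(1) by (metis diff_gt_0_iff_gt)
    qed
    obtain d1 K1 where 1: "d1 > 0" "\<forall>s. t < s \<and> s < t + d1 \<longrightarrow> \<bar>f s\<bar> \<le> K1"
      using right by blast
    obtain d2 K2 where 2: "d2 > 0" "\<forall>s. 0 \<le> s \<and> s < t \<and> t - d2 < s \<longrightarrow> \<bar>f s\<bar> \<le> K2"
      using left by blast
    have "bounded (f ` ({u..v} \<inter> {0..}))" if "u \<le> t" "t \<le> v" "v - u < min d1 d2" for u v
    proof (rule boundedI)
      fix y assume "y \<in> f ` ({u..v} \<inter> {0..})"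
      then obtain s where s: "y = f s" "u \<le> s" "s \<le> v" "0 \<le> s" by auto
      show "norm y \<le> max \<bar>f t\<bar> (max K1 K2)"
        using s that 1(2)[rule_format, of s] 2(2)[rule_format, of s]
        by (cases "s = t"; cases "s < t") auto
    qed
    then show ?case using 1(1) 2(1) by (intro exI[of _ "min d1 d2"]) auto
  qed
  then obtain K where "\<forall>x\<in>f ` ({0..b} \<inter> {0..}). norm x \<le> K" unfolding bounded_iff by blast
  then show ?thesis by auto
qed auto

text \<open>Off a finite set \<open>f\<close> is continuous, hence measurable, and it is bounded;
  the finite set is negligible for the integral.\<close>

lemma piecewise_continuous_integrable:
  assumes "piecewise_continuous f" "0 \<le> a"
  shows "f integrable_on {a..b}"
proof -
  define D where "D = {t \<in> {0..b}. \<not> continuous (at t within {0..}) f}"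
  have D: "finite D"
    using assms(1) unfolding D_def piecewise_continuous_def by blast
  obtain K where K: "\<forall>t\<in>{0..b}. \<bar>f t\<bar> \<le> K"
    using piecewise_continuous_bounded[OF assms(1)] by blast
  have "continuous_on ({a..b} - D) f"
    unfolding continuous_on_eq_continuous_within
  proof
    fix t assume t: "t \<in> {a..b} - D"
    then have "continuous (at t within {0..}) f" using assms(2) unfolding D_def by auto
    then show "continuous (at t within {a..b} - D) f"
      by (rule continuous_within_subset) (use assms(2) in auto)
  qed
  then have m: "f \<in> borel_measurable (lebesgue_on ({a..b} - D))"
    by (rule continuous_imp_measurable_on_sets_lebesgue)
      (simp add: D finite_imp_closed borel_closed)
  have "f integrable_on ({a..b} - D)"
  proof (rule measurable_bounded_by_integrable_imp_integrable[OF m, of "\<lambda>_. K"])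
    show "(\<lambda>_. K) integrable_on ({a..b} - D)"
      by (rule integrable_spike_set[OF integrable_const_ivl])
        (auto intro!: negligible_subset[OF negligible_finite[OF D]])
  qed (use K assms(2) D in \<open>auto simp: finite_imp_closed borel_closed\<close>)
  then show ?thesis
    by (rule integrable_spike_set)
      (auto intro!: negligible_subset[OF negligible_finite[OF D]])
qed

text \<open>Finitely many discontinuities in each \<open>[0, k]\<close> are countably many in
  all.\<close>

lemma piecewise_continuous_AE:
  assumes "piecewise_continuous f"
  shows "AE t in lborel. 0 \<le> t \<longrightarrow> continuous (at t within {0..}) f"
proof -
  define D where "D = (\<Union>k::nat. {t \<in> {0..real k}. \<not> continuous (at t within {0..}) f})"
  have "countable D"
    unfolding D_def using assms unfolding piecewise_continuous_def
    by (intro countable_UN) (auto intro: countable_finite)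
  then have "D \<in> null_sets lborel" by (rule countable_imp_null_set_lborel)
  moreover have "{t. \<not> (0 \<le> t \<longrightarrow> continuous (at t within {0..}) f)} \<subseteq> D"
    unfolding D_def using real_arch_simple by fastforce
  ultimately show ?thesis by (auto intro: AE_I')
qed

section \<open>Absolutely continuous functions\<close>

lemma lipschitz_imp_abs_continuous:
  assumes L: "\<And>s t. a \<le> s \<Longrightarrow> s \<le> t \<Longrightarrow> t \<le> b \<Longrightarrow> \<bar>f t - f s\<bar> \<le> L * (t - s)"
  shows "abs_continuous_on_interval a b f"
  unfolding abs_continuous_on_interval_def
proof (intro allI impI)
  fix e :: real assume e: "0 < e"
  \<comment> \<open>A positive replacement for \<open>L\<close>, which may be zero or negative, so
    that \<open>e / M\<close> is defined and positive.\<close>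
  define M where "M = \<bar>L\<bar> + 1"
  have M: "0 < M" "L \<le> M" unfolding M_def by auto
  show "\<exists>d>0. \<forall>I. finite I \<and> (\<forall>(s, t)\<in>I. a \<le> s \<and> s \<le> t \<and> t \<le> b) \<and>
        disjoint_family_on (\<lambda>(s, t). {s<..<t}) I \<and> (\<Sum>(s, t)\<in>I. t - s) < d
        \<longrightarrow> (\<Sum>(s, t)\<in>I. \<bar>f t - f s\<bar>) < e"
  proof (intro exI[of _ "e / M"] conjI allI impI)
    show "0 < e / M" using e M by simp
  next
    fix I assume I: "finite I \<and> (\<forall>(s, t)\<in>I. a \<le> s \<and> s \<le> t \<and> t \<le> b) \<and>
        disjoint_family_on (\<lambda>(s, t). {s<..<t}) I \<and> (\<Sum>(s, t)\<in>I. t - s) < e / M"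
    have "(\<Sum>(s, t)\<in>I. \<bar>f t - f s\<bar>) \<le> (\<Sum>(s, t)\<in>I. M * (t - s))"
    proof (rule sum_mono, clarify)
      fix s t assume "(s, t) \<in> I"
      then have st: "a \<le> s" "s \<le> t" "t \<le> b" using I by auto
      have "\<bar>f t - f s\<bar> \<le> L * (t - s)" by (rule L[OF st])
      also have "\<dots> \<le> M * (t - s)" by (rule mult_right_mono) (use M st in auto)
      finally show "\<bar>f t - f s\<bar> \<le> M * (t - s)" .
    qed
    also have "\<dots> = M * (\<Sum>(s, t)\<in>I. t - s)"
      by (simp add: sum_distrib_left case_prod_unfold)
    also have "\<dots> < M * (e / M)" using I M(1) by (intro mult_strict_left_mono) auto
    finally show "(\<Sum>(s, t)\<in>I. \<bar>f t - f s\<bar>) < e" using M(1) by simp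
  qed
qed

lemma abs_continuous_diff:
  assumes f: "abs_continuous_on_interval a b f" and g: "abs_continuous_on_interval a b g"
  shows "abs_continuous_on_interval a b (\<lambda>t. f t - g t)"
  unfolding abs_continuous_on_interval_def
proof (intro allI impI)
  fix e :: real assume "0 < e"
  then have "0 < e / 2" by simp
  obtain d1 where d1: "d1 > 0" and 1: "\<And>I. finite I \<and> (\<forall>(s, t)\<in>I. a \<le> s \<and> s \<le> t \<and> t \<le> b) \<and>
        disjoint_family_on (\<lambda>(s, t). {s<..<t}) I \<and> (\<Sum>(s, t)\<in>I. t - s) < d1
        \<Longrightarrow> (\<Sum>(s, t)\<in>I. \<bar>f t - f s\<bar>) < e / 2"
    using f[unfolded abs_continuous_on_interval_def, rule_format, OF \<open>0 < e / 2\<close>] by blast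
  obtain d2 where d2: "d2 > 0" and 2: "\<And>I. finite I \<and> (\<forall>(s, t)\<in>I. a \<le> s \<and> s \<le> t \<and> t \<le> b) \<and>
        disjoint_family_on (\<lambda>(s, t). {s<..<t}) I \<and> (\<Sum>(s, t)\<in>I. t - s) < d2
        \<Longrightarrow> (\<Sum>(s, t)\<in>I. \<bar>g t - g s\<bar>) < e / 2"
    using g[unfolded abs_continuous_on_interval_def, rule_format, OF \<open>0 < e / 2\<close>] by blast
  show "\<exists>d>0. \<forall>I. finite I \<and> (\<forall>(s, t)\<in>I. a \<le> s \<and> s \<le> t \<and> t \<le> b) \<and>
        disjoint_family_on (\<lambda>(s, t). {s<..<t}) I \<and> (\<Sum>(s, t)\<in>I. t - s) < d
        \<longrightarrow> (\<Sum>(s, t)\<in>I. \<bar>(f t - g t) - (f s - g s)\<bar>) < e"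
  proof (intro exI[of _ "min d1 d2"] conjI allI impI)
    show "0 < min d1 d2" using d1 d2 by simp
  next
    fix I assume I: "finite I \<and> (\<forall>(s, t)\<in>I. a \<le> s \<and> s \<le> t \<and> t \<le> b) \<and>
        disjoint_family_on (\<lambda>(s, t). {s<..<t}) I \<and> (\<Sum>(s, t)\<in>I. t - s) < min d1 d2"
    have "(\<Sum>(s, t)\<in>I. \<bar>(f t - g t) - (f s - g s)\<bar>)
        \<le> (\<Sum>(s, t)\<in>I. \<bar>f t - f s\<bar>) + (\<Sum>(s, t)\<in>I. \<bar>g t - g s\<bar>)"
      unfolding sum.distrib[symmetric] by (rule sum_mono) auto
    also have "\<dots> < e / 2 + e / 2"
      using I by (intro add_strict_mono 1 2) auto
    finally show "(\<Sum>(s, t)\<in>I. \<bar>(f t - g t) - (f s - g s)\<bar>) < e" by simp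
  qed
qed

text \<open>A family consisting of a single interval turns absolute continuity into the usual
  epsilon-delta condition.\<close>

lemma abs_continuous_imp_continuous_on:
  assumes f: "abs_continuous_on_interval a b f"
  shows "continuous_on {a..b} f"
  unfolding continuous_on_iff
proof (intro ballI allI impI)
  fix t e :: real assume t: "t \<in> {a..b}" and e: "0 < e"
  obtain d where d: "d > 0" and D: "\<And>I. finite I \<and> (\<forall>(s, t)\<in>I. a \<le> s \<and> s \<le> t \<and> t \<le> b) \<and>
        disjoint_family_on (\<lambda>(s, t). {s<..<t}) I \<and> (\<Sum>(s, t)\<in>I. t - s) < d
        \<Longrightarrow> (\<Sum>(s, t)\<in>I. \<bar>f t - f s\<bar>) < e"
    using f[unfolded abs_continuous_on_interval_def, rule_format, OF e] by blast
  show "\<exists>d>0. \<forall>s\<in>{a..b}. dist s t < d \<longrightarrow> dist (f s) (f t) < e"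
  proof (intro exI[of _ d] conjI ballI impI)
    fix s assume s: "s \<in> {a..b}" "dist s t < d"
    show "dist (f s) (f t) < e"
      using D[of "{(min s t, max s t)}"] s t
      by (cases "s \<le> t") (auto simp: dist_real_def disjoint_family_on_def abs_minus_commute)
  qed (rule d)
qed

text \<open>
  A fine tagged division splits the increment into intervals with a tag of zero derivative, on
  which it is small relative to the length, and intervals with an exceptional tag, whose total
  length is small.
\<close>

lemma abs_continuous_zero_derivative:
  assumes f: "abs_continuous_on_interval a b f" and "a \<le> b" and N: "negligible N"
    and der: "\<And>t. t \<in> {a..b} - N \<Longrightarrow> (f has_real_derivative 0) (at t within {a..b})"
  shows "f b = f a"
proof -
  have "\<bar>f b - f a\<bar> \<le> e * (1 + (b - a))" if e: "0 < e" for e :: real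
  proof -
    obtain d where d: "d > 0" and D: "\<And>I. finite I \<and> (\<forall>(s, t)\<in>I. a \<le> s \<and> s \<le> t \<and> t \<le> b) \<and>
        disjoint_family_on (\<lambda>(s, t). {s<..<t}) I \<and> (\<Sum>(s, t)\<in>I. t - s) < d
        \<Longrightarrow> (\<Sum>(s, t)\<in>I. \<bar>f t - f s\<bar>) < e"
      using f[unfolded abs_continuous_on_interval_def, rule_format, OF e] by blast
    have Nl: "N \<in> sets lebesgue" using N by (simp add: negligible_imp_sets)
    \<comment> \<open>Intervals with an exceptional tag will be confined to \<open>U\<close>, so
      that their total length stays below \<open>d\<close>, the threshold that absolute continuity
      assigns to \<open>e\<close>.\<close>
    obtain U where U: "open U" "N \<subseteq> U" "U - N \<in> lmeasurable" "emeasure lebesgue (U - N) < ennreal d"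
      by (rule sets_lebesgue_outer_open[OF Nl d])
    have Un: "U = N \<union> (U - N)" using U(2) by auto
    have Ul: "U \<in> lmeasurable"
      by (subst Un) (intro fmeasurable.Un negligible_imp_measurable N U(3))
    have "measure lebesgue U \<le> measure lebesgue N + measure lebesgue (U - N)"
      by (subst Un) (rule measure_Un_le[OF Nl fmeasurableD[OF U(3)]])
    moreover have "measure lebesgue (U - N) < d"
      using U(3,4) d by (simp add: emeasure_eq_measure2 ennreal_less_iff)
    ultimately have Um: "measure lebesgue U < d"
      using N by (simp add: negligible_imp_measure0)
    have "\<exists>r>0. t \<in> {a..b} - N \<longrightarrow>
        (\<forall>s\<in>{a..b}. \<bar>s - t\<bar> < r \<longrightarrow> \<bar>f s - f t\<bar> \<le> e * \<bar>s - t\<bar>)" for t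
    proof (cases "t \<in> {a..b} - N")
      case True
      have "(f has_derivative (\<lambda>_. 0)) (at t within {a..b})"
        using der[OF True] unfolding has_field_derivative_def
            by (rule has_derivative_eq_rhs) (simp add: fun_eq_iff)
      then show ?thesis using e unfolding has_derivative_within_alt by auto
    qed (auto intro: exI[of _ 1])
    then obtain r where r: "\<And>t. r t > 0" and rd: "\<And>t s. t \<in> {a..b} - N \<Longrightarrow> s \<in> {a..b} \<Longrightarrow>
        \<bar>s - t\<bar> < r t \<Longrightarrow> \<bar>f s - f t\<bar> \<le> e * \<bar>s - t\<bar>"
      by metis
    \<comment> \<open>An interval with an exceptional tag must stay in \<open>U\<close>; with any
      other tag it must stay where increments from the tag are at most \<open>e\<close> times the
      distance.\<close>
    define g where "g t = (if t \<in> N then U else ball t (r t))" for t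
    have "gauge g"
      using U(1,2) r unfolding gauge_def g_def by auto
    then obtain p where p: "p tagged_division_of {a..b}" and fine: "g fine p"
      using fine_division_exists_real by blast
    note pD = tagged_division_ofD[OF p]
    have K: "\<exists>u v. K = {u..v} \<and> u \<le> x \<and> x \<le> v \<and> a \<le> u \<and> v \<le> b \<and> Inf K = u \<and> Sup K = v \<and>
        K \<subseteq> g x" if xK: "(x, K) \<in> p" for x K
    proof -
      obtain u v where uv: "K = {u..v}" using pD(4)[OF xK] by auto
      have "x \<in> K" "K \<subseteq> {a..b}" using pD(2,3) xK by auto
      then show ?thesis using uv fine xK by (auto simp: fine_def)
    qed
    define q where "q = {(x, K) \<in> p. x \<in> N}"
    have "finite p" by (rule pD(1))
    have qp: "q \<subseteq> p" unfolding q_def by auto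
    then have "finite q" using \<open>finite p\<close> finite_subset by blast
    define h where "h = (\<lambda>(x :: real, K :: real set). (Inf K, Sup K))"
    \<comment> \<open>Two tags can share an interval only if its interior is empty; it is then a
      single point, and both tags are that point.\<close>
    have inj: "inj_on h q"
    proof (rule inj_onI, clarify)
      fix x K y L assume xK: "(x, K) \<in> q" and yL: "(y, L) \<in> q" and eq: "h (x, K) = h (y, L)"
      obtain u v where uv: "K = {u..v}" "u \<le> x" "x \<le> v" "Inf K = u" "Sup K = v"
        using K qp xK by blast
      obtain u' v' where uv': "L = {u'..v'}" "u' \<le> y" "y \<le> v'" "Inf L = u'" "Sup L = v'"
        using K qp yL by blast
      have KL: "K = L" using eq uv uv' by (simp add: h_def)
      show "x = y \<and> K = L"
      proof (rule ccontr)
        assume ne: "\<not> (x = y \<and> K = L)"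
        then have "interior K \<inter> interior L = {}" using pD(5) xK yL qp KL by blast
        then have "{u<..<v} = {}" using uv(1) KL by simp
        then show False using uv uv' KL ne by auto
      qed
    qed
    define I where "I = h ` q"
    have dis: "disjoint_family_on (\<lambda>(s, t). {s<..<t}) I"
      unfolding disjoint_family_on_def I_def
    proof (intro ballI impI)
      fix i j assume ij: "i \<in> h ` q" "j \<in> h ` q" "i \<noteq> j"
      obtain x M where 1: "(x, M) \<in> q" "i = h (x, M)" using ij(1) by auto
      obtain y L where 2: "(y, L) \<in> q" "j = h (y, L)" using ij(2) by auto
      have *: "(x, M) \<in> p" "(y, L) \<in> p" "i = h (x, M)" "j = h (y, L)"
        "(x, M) \<noteq> (y, L)" using 1 2 ij(3) qp by blast+
      have int: "interior M \<inter> interior L = {}" using pD(5)[OF *(1,2,5)] .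
      obtain u v where uv: "M = {u..v}" "Inf M = u" "Sup M = v" using K *(1) by blast
      obtain u' v' where uv': "L = {u'..v'}" "Inf L = u'" "Sup L = v'" using K *(2) by blast
      show "(case i of (s, t) \<Rightarrow> {s<..<t}) \<inter> (case j of (s, t) \<Rightarrow> {s<..<t}) = {}"
        using int unfolding * h_def prod.case uv(2,3) uv'(2,3) unfolding uv(1) uv'(1) by simp
    qed
    have Iab: "\<forall>(s, t)\<in>I. a \<le> s \<and> s \<le> t \<and> t \<le> b"
      unfolding I_def h_def using K qp by fastforce
    have "finite I" unfolding I_def using \<open>finite q\<close> by simp
    have "(\<Sum>(s, t)\<in>I. t - s) = (\<Sum>i\<in>I. measure lebesgue (case i of (s, t) \<Rightarrow> {s<..<t}))"
      by (rule sum.cong) (use Iab in auto)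
    also have "\<dots> = measure lebesgue (\<Union>i\<in>I. case i of (s, t) \<Rightarrow> {s<..<t})"
      by (rule measure_finite_Union[symmetric]) (use \<open>finite I\<close> dis Iab in auto)
    also have "\<dots> \<le> measure lebesgue U"
    proof (rule measure_mono_fmeasurable[OF _ _ Ul])
      show "(\<Union>i\<in>I. case i of (s, t) \<Rightarrow> {s<..<t}) \<subseteq> U"
      proof clarify
        fix z s t assume "(s, t) \<in> I" and z: "z \<in> {s<..<t}"
        then obtain x L where xL: "(x, L) \<in> p" "x \<in> N" "s = Inf L" "t = Sup L"
          unfolding I_def h_def q_def by auto
        obtain u v where uv: "L = {u..v}" "Inf L = u" "Sup L = v" "L \<subseteq> g x"
          using K[OF xL(1)] by blast
        have "z \<in> L" using z xL(3,4) uv(2,3) unfolding uv(1) by simp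
        then show "z \<in> U" using uv(4) xL(2) unfolding g_def by auto
      qed
      show "(\<Union>i\<in>I. case i of (s, t) \<Rightarrow> {s<..<t}) \<in> sets lebesgue"
        using \<open>finite I\<close> by (intro sets.finite_UN) (auto split: prod.split)
    qed
    also note Um
    finally have "(\<Sum>(s, t)\<in>I. \<bar>f t - f s\<bar>) < e"
      using D dis Iab \<open>finite I\<close> by blast
    then have q: "(\<Sum>(x, K)\<in>q. \<bar>f (Sup K) - f (Inf K)\<bar>) < e"
      unfolding I_def sum.reindex[OF inj] by (simp add: h_def case_prod_unfold)
    have "(\<Sum>(x, K)\<in>p - q. \<bar>f (Sup K) - f (Inf K)\<bar>) \<le> (\<Sum>(x, K)\<in>p - q. e * (Sup K - Inf K))"
    proof (rule sum_mono, clarify)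
      fix x L assume xL: "(x, L) \<in> p" "(x, L) \<notin> q"
      then have "x \<notin> N" unfolding q_def by auto
      obtain u v where uv: "L = {u..v}" "u \<le> x" "x \<le> v" "a \<le> u" "v \<le> b" "Inf L = u" "Sup L = v"
        "L \<subseteq> g x" using K[OF xL(1)] by blast
      have "u \<in> L" "v \<in> L" using uv(1-3) by auto
      moreover have "L \<subseteq> ball x (r x)" using uv(8) \<open>x \<notin> N\<close> unfolding g_def by simp
      ultimately have "u \<in> ball x (r x)" "v \<in> ball x (r x)" by blast+
      then have "\<bar>f u - f x\<bar> \<le> e * \<bar>u - x\<bar>" "\<bar>f v - f x\<bar> \<le> e * \<bar>v - x\<bar>"
        using rd[of x u] rd[of x v] uv(1-5) \<open>x \<notin> N\<close> by (auto simp: dist_real_def)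
      then show "\<bar>f (Sup L) - f (Inf L)\<bar> \<le> e * (Sup L - Inf L)"
        unfolding uv(6,7) using uv(2,3) by (simp add: algebra_simps)
    qed
    \<comment> \<open>Putting the exceptional intervals back only increases the bound, and the
      lengths of the full division add up to \<open>b - a\<close>.\<close>
    also have "\<dots> \<le> (\<Sum>(x, K)\<in>p. e * (Sup K - Inf K))"
    proof (rule sum_mono2[OF \<open>finite p\<close>])
      fix z assume "z \<in> p - (p - q)"
      then obtain x L where "z = (x, L)" "(x, L) \<in> p" by (cases z) auto
      then show "0 \<le> (case z of (x, K) \<Rightarrow> e * (Sup K - Inf K))"
        using K[of x L] e by auto
    qed auto
    also have "\<dots> = e * (b - a)"
      using additive_tagged_division_1[OF \<open>a \<le> b\<close> p, of "\<lambda>x. x"]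
      by (simp add: sum_distrib_left[symmetric] case_prod_unfold)
    finally have pq: "(\<Sum>(x, K)\<in>p - q. \<bar>f (Sup K) - f (Inf K)\<bar>) \<le> e * (b - a)" .
    have "\<bar>f b - f a\<bar> = \<bar>\<Sum>(x, K)\<in>p. f (Sup K) - f (Inf K)\<bar>"
      using additive_tagged_division_1[OF \<open>a \<le> b\<close> p, of f] by simp
    also have "\<dots> \<le> (\<Sum>(x, K)\<in>p. \<bar>f (Sup K) - f (Inf K)\<bar>)"
      using sum_abs[of "\<lambda>(x, K). f (Sup K) - f (Inf K)" p] by (simp add: case_prod_unfold)
    also have "\<dots> = (\<Sum>(x, K)\<in>p - q. \<bar>f (Sup K) - f (Inf K)\<bar>) + (\<Sum>(x, K)\<in>q. \<bar>f (Sup K) - f (Inf K)\<bar>)"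
      by (rule sum.subset_diff[OF qp \<open>finite p\<close>])
    finally show ?thesis using q pq by (simp add: algebra_simps)
  qed
  moreover define c where "c = 1 + (b - a)"
  ultimately have *: "\<bar>f b - f a\<bar> \<le> e * c" if "0 < e" for e
    using that by simp
  have c: "0 < c" using \<open>a \<le> b\<close> unfolding c_def by simp
  have "\<bar>f b - f a\<bar> \<le> e" if "0 < e" for e
    using *[of "e / c"] c that by simp
  then show ?thesis using field_le_epsilon[of "\<bar>f b - f a\<bar>" 0] by simp
qed

section \<open>Linear differential equations\<close>

text \<open>The equation \<open>f' = g\<close> on \<open>[0, b]\<close> in integral form. It is
  vacuous for negative \<open>b\<close>, so solutions on the whole half-line can be described by
  quantifying over all \<open>b\<close>.\<close>

definition is_primitive :: "real \<Rightarrow> (real \<Rightarrow> real) \<Rightarrow> (real \<Rightarrow> real) \<Rightarrow> bool" where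
  "is_primitive b g f \<longleftrightarrow> (\<forall>t\<in>{0..b}. (g has_integral f t - f 0) {0..t})"

lemma is_primitive_interval:
  assumes "is_primitive b g f" "0 \<le> s" "s \<le> t" "t \<le> b"
  shows "(g has_integral f t - f s) {s..t}"
proof -
  have t: "(g has_integral f t - f 0) {0..t}" and s: "(g has_integral f s - f 0) {0..s}"
    using assms unfolding is_primitive_def by auto
  have "g integrable_on {s..t}"
    by (rule integrable_on_subinterval[OF has_integral_integrable[OF t]]) (use assms in auto)
  then obtain I where I: "(g has_integral I) {s..t}" by blast
  have "(g has_integral (f s - f 0) + I) {0..t}"
    by (rule has_integral_combine[OF _ _ s I]) (use assms in auto)
  then have "(f s - f 0) + I = f t - f 0" by (rule has_integral_unique[OF _ t])
  then have "I = f t - f s" by simp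
  then show ?thesis using I by simp
qed

lemma is_primitive_lipschitz:
  assumes "is_primitive b g f" and K: "\<And>t. t \<in> {0..b} \<Longrightarrow> \<bar>g t\<bar> \<le> K"
    and st: "0 \<le> s" "s \<le> t" "t \<le> b"
  shows "\<bar>f t - f s\<bar> \<le> K * (t - s)"
proof -
  have "0 \<le> K" using K[of s] st by auto
  then show ?thesis
    using has_integral_bound_real[OF _ finite.emptyI is_primitive_interval[OF assms(1) st], of K] K st by auto
qed

lemma is_primitive_imp_abs_continuous:
  assumes g: "piecewise_continuous g" and f: "is_primitive b g f"
  shows "abs_continuous_on_interval 0 b f"
proof -
  obtain K where "\<forall>t\<in>{0..b}. \<bar>g t\<bar> \<le> K"
    using piecewise_continuous_bounded[OF g] by blast
  then show ?thesis
    by (intro lipschitz_imp_abs_continuous[of 0 b f K] is_primitive_lipschitz[OF f]) auto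
qed

lemma at_within_atLeast_eq:
  assumes "0 \<le> t" "t < b"
  shows "at t within {0..b} = at t within {0::real..}"
  by (rule at_within_nhd[of t "{..<b}"]) (use assms in auto)

lemma continuous_on_atLeastI:
  assumes "\<And>b. 0 \<le> b \<Longrightarrow> continuous_on {0..b} f"
  shows "continuous_on {0::real..} f"
  unfolding continuous_on_eq_continuous_within
proof
  fix t :: real assume "t \<in> {0..}"
  then have t: "0 \<le> t" by simp
  then have "continuous (at t within {0..t + 1}) f"
    using assms[of "t + 1"] unfolding continuous_on_eq_continuous_within by auto
  then show "continuous (at t within {0..}) f"
    using at_within_atLeast_eq[of t "t + 1"] t by simp
qed

lemma is_primitive_continuous:
  assumes f: "is_primitive b g f"
  shows "continuous_on {0..b} f"
proof (cases "0 \<le> b")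
  case True
  have "g integrable_on {0..b}" using f True unfolding is_primitive_def by auto
  then have "continuous_on {0..b} (\<lambda>t. integral {0..t} g + f 0)"
    by (intro continuous_intros indefinite_integral_continuous_1)
  moreover have "integral {0..t} g + f 0 = f t" if "t \<in> {0..b}" for t
    using f that integral_unique[of g "f t - f 0" "{0..t}"] unfolding is_primitive_def by auto
  ultimately show ?thesis by (rule continuous_on_eq)
qed simp

lemma is_primitive_integral:
  assumes "piecewise_continuous g"
  shows "is_primitive b g (\<lambda>t. integral {0..t} g)"
  unfolding is_primitive_def using piecewise_continuous_integrable[OF assms, of 0]
  by (auto intro: integrable_integral)

text \<open>The horizon \<open>t + 1\<close> leaves room to the right of \<open>t\<close>, so that
  the derivative within \<open>[0, t + 1]\<close> is the derivative within the half-line.\<close>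

lemma is_primitive_derivative:
  assumes g: "piecewise_continuous g" and f: "is_primitive (t + 1) g f"
    and t: "0 \<le> t" and c: "continuous (at t within {0..}) g"
  shows "(f has_real_derivative g t) (at t within {0..})"
proof -
  have eq: "at t within {0..t + 1} = at t within {0..}"
    by (rule at_within_atLeast_eq) (use t in auto)
  have "((\<lambda>t. integral {0..t} g) has_vector_derivative g t) (at t within {0..t + 1} - {})"
    by (rule integral_has_vector_derivative_continuous_at)
      (use piecewise_continuous_integrable[OF g] t c eq in auto)
  then have "((\<lambda>t. integral {0..t} g + f 0) has_real_derivative g t) (at t within {0..t + 1})"
    unfolding has_real_derivative_iff_has_vector_derivative
    by (auto intro!: derivative_eq_intros)
  then have "(f has_real_derivative g t) (at t within {0..t + 1})"
  proof (rule has_field_derivative_transform_within[of _ _ _ _ 1])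
    fix s assume "s \<in> {0..t + 1}"
    then have "(g has_integral f s - f 0) {0..s}" using f unfolding is_primitive_def by auto
    then show "integral {0..s} g + f 0 = f s" by (simp add: integral_unique)
  qed (use t in auto)
  then show ?thesis using eq by simp
qed

lemma is_primitive_imp_AE_derivative:
  assumes g: "piecewise_continuous g" and f: "\<And>b. is_primitive b g f"
  shows "AE t in lborel. 0 \<le> t \<longrightarrow> (f has_real_derivative g t) (at t within {0..})"
  using piecewise_continuous_AE[OF g]
  by eventually_elim (auto intro: is_primitive_derivative[OF g f])

text \<open>Subtracting the indefinite integral of \<open>g\<close> leaves an absolutely continuous
  function whose derivative is 0 almost everywhere, hence a constant.\<close>

lemma AE_derivative_imp_is_primitive:
  assumes g: "piecewise_continuous g" and ac: "\<And>b. 0 \<le> b \<Longrightarrow> abs_continuous_on_interval 0 b f"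
    and der: "AE t in lborel. 0 \<le> t \<longrightarrow> (f has_real_derivative g t) (at t within {0..})"
  shows "is_primitive b g f"
  unfolding is_primitive_def
proof
  fix t assume "t \<in> {0..b}"
  then have t: "0 \<le> t" by simp
  define G where "G t = integral {0..t} g" for t
  have G: "is_primitive b g G" for b
    using is_primitive_integral[OF g] unfolding G_def .
  have "AE t in lborel. 0 \<le> t \<longrightarrow> ((\<lambda>t. f t - G t) has_real_derivative 0) (at t within {0..})"
    using der is_primitive_imp_AE_derivative[OF g G]
  proof eventually_elim
    case (elim t)
    show ?case
    proof
      assume "0 \<le> t"
      then show "((\<lambda>t. f t - G t) has_real_derivative 0) (at t within {0..})"
        using DERIV_diff[of f "g t" t "{0..}" G "g t"] elim by simp
    qed
  qed
  then obtain N where sub: "{t \<in> space lborel. \<not> (0 \<le> t \<longrightarrow>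
      ((\<lambda>t. f t - G t) has_real_derivative 0) (at t within {0..}))} \<subseteq> N"
    and "emeasure lborel N = 0" "N \<in> sets lborel"
    by (rule AE_E)
  then have N: "N \<in> null_sets lborel" by auto
  have D: "((\<lambda>t. f t - G t) has_real_derivative 0) (at t within {0..})"
    if "t \<notin> N" "0 \<le> t" for t
    using sub that by auto
  have "f t - G t = f 0 - G 0"
  proof (rule abs_continuous_zero_derivative[where f = "\<lambda>t. f t - G t" and N = N])
    show "abs_continuous_on_interval 0 t (\<lambda>t. f t - G t)"
      by (intro abs_continuous_diff ac t is_primitive_imp_abs_continuous[OF g G])
    show "negligible N"
      using N by (simp add: negligible_iff_null_sets null_sets_completionI)
    fix s assume "s \<in> {0..t} - N"
    then show "((\<lambda>t. f t - G t) has_real_derivative 0) (at s within {0..t})"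
      by (intro has_field_derivative_subset[OF D]) auto
  qed (rule t)
  then have "f t - f 0 = G t - G 0" by simp
  then show "(g has_integral f t - f 0) {0..t}"
    using G[of t] t unfolding is_primitive_def by auto
qed

text \<open>Coordinates are plain functions of a natural number, which keeps the analysis apart from
  dimension-carrying vectors; only indices below \<open>n\<close> matter.\<close>

definition lin_ode :: "real \<Rightarrow> nat \<Rightarrow> (real \<Rightarrow> nat \<Rightarrow> nat \<Rightarrow> real) \<Rightarrow> (real \<Rightarrow> nat \<Rightarrow> real)
    \<Rightarrow> (real \<Rightarrow> nat \<Rightarrow> real) \<Rightarrow> bool" where
  "lin_ode b n M f x \<longleftrightarrow>
     (\<forall>i<n. is_primitive b (\<lambda>t. (\<Sum>j<n. M t i j * x t j) + f t i) (\<lambda>t. x t i))"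

lemma bounded_coefficients:
  fixes M :: "real \<Rightarrow> nat \<Rightarrow> nat \<Rightarrow> real"
  assumes "\<And>i j. i < n \<Longrightarrow> j < n \<Longrightarrow> piecewise_continuous (\<lambda>t. M t i j)"
  shows "\<exists>K>0. \<forall>t\<in>{0..b}. \<forall>i<n. \<forall>j<n. \<bar>M t i j\<bar> \<le> K"
proof -
  have "\<exists>K. \<forall>t\<in>{0..b}. \<bar>M t i j\<bar> \<le> K" if "i < n" "j < n" for i j
    using piecewise_continuous_bounded assms that by blast
  then obtain K where K: "\<And>i j t. i < n \<Longrightarrow> j < n \<Longrightarrow> t \<in> {0..b} \<Longrightarrow> \<bar>M t i j\<bar> \<le> K i j"
    by metis
  define L where "L = (\<Sum>i<n. \<Sum>j<n. \<bar>K i j\<bar>) + 1"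
  have "\<bar>M t i j\<bar> \<le> L" if "i < n" "j < n" "t \<in> {0..b}" for t i j
  proof -
    have "\<bar>K i j\<bar> \<le> (\<Sum>j<n. \<bar>K i j\<bar>)"
      using that by (intro member_le_sum) auto
    also have "\<dots> \<le> (\<Sum>i<n. \<Sum>j<n. \<bar>K i j\<bar>)"
      using that
      by (intro member_le_sum[of i "{..<n}" "\<lambda>i. \<Sum>j<n. \<bar>K i j\<bar>"]) (simp_all add: sum_nonneg)
    finally show ?thesis using K[OF that] unfolding L_def by simp
  qed
  moreover have "L > 0" unfolding L_def by (intro add_nonneg_pos sum_nonneg) auto
  ultimately show ?thesis by blast
qed

lemma sum_coefficients_bound:
  fixes m y :: "nat \<Rightarrow> real"
  assumes "\<And>j. j < n \<Longrightarrow> \<bar>m j\<bar> \<le> K"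
  shows "\<bar>\<Sum>j<n. m j * y j\<bar> \<le> K * (\<Sum>j<n. \<bar>y j\<bar>)"
proof -
  have "\<bar>\<Sum>j<n. m j * y j\<bar> \<le> (\<Sum>j<n. \<bar>m j * y j\<bar>)" by (rule sum_abs)
  also have "\<dots> \<le> (\<Sum>j<n. K * \<bar>y j\<bar>)"
    by (rule sum_mono) (auto simp: abs_mult intro!: mult_right_mono assms)
  finally show ?thesis by (simp add: sum_distrib_left)
qed

text \<open>Let \<open>m s\<close> be the maximum of the 1-norm over the window of radius
  \<open>d\<close> around \<open>a\<close>. Integrating from \<open>a\<close> to \<open>s\<close>
  gives \<open>m s <= n K d m s <= m s / 2\<close>, hence \<open>m s = 0\<close>. The window extends
  to both sides of \<open>a\<close>, so uniqueness also runs backward in time.\<close>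

lemma lin_ode_zero_step:
  assumes x: "lin_ode b n M (\<lambda>_ _. 0) x" and K: "0 < K"
    "\<And>t i j. t \<in> {0..b} \<Longrightarrow> i < n \<Longrightarrow> j < n \<Longrightarrow> \<bar>M t i j\<bar> \<le> K"
    and d: "0 < d" "real n * K * d \<le> 1 / 2"
    and a: "a \<in> {0..b}" "\<And>i. i < n \<Longrightarrow> x a i = 0"
    and t: "t \<in> {0..b}" "\<bar>t - a\<bar> \<le> d" and i: "i < n"
  shows "x t i = 0"
proof -
  define I where "I = {max 0 (a - d)..min b (a + d)}"
  define m where "m t = (\<Sum>i<n. \<bar>x t i\<bar>)" for t
  have aI: "a \<in> I" and tI: "t \<in> I" and Ib: "I \<subseteq> {0..b}"
    using a t d(1) unfolding I_def by auto
  have "continuous_on I m"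
    unfolding m_def
    by (intro continuous_intros continuous_on_subset[OF _ Ib])
      (use x in \<open>auto simp: lin_ode_def intro: is_primitive_continuous\<close>)
  then obtain s where s: "s \<in> I" "\<And>r. r \<in> I \<Longrightarrow> m r \<le> m s"
    using continuous_attains_sup[of I m] aI unfolding I_def by auto
  have m0: "0 \<le> m r" for r unfolding m_def by (simp add: sum_nonneg)
  have le: "\<bar>x s k\<bar> \<le> K * m s * d" if k: "k < n" for k
  proof -
    define u v where "u = min a s" and "v = max a s"
    have uv: "0 \<le> u" "u \<le> v" "v \<le> b" "v - u \<le> d" "{u..v} \<subseteq> I"
      using aI s(1) Ib unfolding u_def v_def I_def by auto
    have int: "((\<lambda>t. (\<Sum>j<n. M t k j * x t j) + 0) has_integral x v k - x u k) {u..v}"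
      using x k uv(1-3) unfolding lin_ode_def
      by (intro is_primitive_interval[of b]) auto
    have bd: "norm ((\<Sum>j<n. M r k j * x r j) + 0) \<le> K * m s" if "r \<in> {u..v}" for r
    proof -
      have "r \<in> I" using that uv(5) by blast
      have "\<bar>\<Sum>j<n. M r k j * x r j\<bar> \<le> K * m r"
        unfolding m_def using K(2)[OF _ k] \<open>r \<in> I\<close> Ib by (intro sum_coefficients_bound) auto
      also have "\<dots> \<le> K * m s" using s(2)[OF \<open>r \<in> I\<close>] K(1) by simp
      finally show ?thesis by simp
    qed
    have "norm (x v k - x u k) \<le> K * m s * Henstock_Kurzweil_Integration.content {u..v}"
      by (rule has_integral_bound_real[OF _ finite.emptyI int bd]) (use K(1) m0 in auto)
    then have "\<bar>x v k - x u k\<bar> \<le> K * m s * (v - u)" using uv(2) by simp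
    also have "\<dots> \<le> K * m s * d"
      using uv(4) K(1) m0 by (intro mult_left_mono) auto
    finally show ?thesis using a(2)[OF k] unfolding u_def v_def by (cases "a \<le> s") auto
  qed
  have "m s \<le> (\<Sum>k<n. K * m s * d)"
    unfolding m_def[of s] using le by (intro sum_mono) (simp add: m_def)
  also have "\<dots> = real n * K * d * m s" by simp
  also have "\<dots> \<le> 1 / 2 * m s" by (rule mult_right_mono[OF d(2) m0])
  finally have "m s \<le> 0" by simp
  then have "m t \<le> 0" using s(2)[OF tI] by simp
  moreover have "\<bar>x t i\<bar> \<le> m t" unfolding m_def using i by (intro member_le_sum) auto
  ultimately show ?thesis by simp
qed

text \<open>The windows have a common radius \<open>d\<close>, so induction on \<open>k\<close>
  spreads the zero over all times within \<open>k d\<close> of \<open>a\<close>.\<close>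

lemma lin_ode_zero_unique:
  assumes M: "\<And>i j. i < n \<Longrightarrow> j < n \<Longrightarrow> piecewise_continuous (\<lambda>t. M t i j)"
    and x: "lin_ode b n M (\<lambda>_ _. 0) x"
    and a: "a \<in> {0..b}" "\<And>i. i < n \<Longrightarrow> x a i = 0"
    and t: "t \<in> {0..b}" and i: "i < n"
  shows "x t i = 0"
proof -
  obtain K where K: "K > 0" "\<forall>t\<in>{0..b}. \<forall>i<n. \<forall>j<n. \<bar>M t i j\<bar> \<le> K"
    using bounded_coefficients[of n M b] M by blast
  \<comment> \<open>With \<open>n + 1\<close> in place of \<open>n\<close> the radius is defined for
    \<open>n = 0\<close> too, and \<open>n K d <= 1 / 2\<close> still holds.\<close>
  define d where "d = 1 / (2 * (real n + 1) * K)"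
  have d: "d > 0" using K(1) unfolding d_def by simp
  have nK: "real n * K * d \<le> 1 / 2"
    using K(1) unfolding d_def by (simp add: divide_simps)
  have "\<forall>t\<in>{0..b}. \<bar>t - a\<bar> \<le> real k * d \<longrightarrow> (\<forall>i<n. x t i = 0)" for k
  proof (induction k)
    case 0
    then show ?case using a by auto
  next
    case (Suc k)
    show ?case
    proof (intro ballI impI allI)
      fix t i assume t: "t \<in> {0..b}" "\<bar>t - a\<bar> \<le> real (Suc k) * d" and i: "i < n"
      define r where "r = real k * d"
      have r: "0 \<le> r" "\<bar>t - a\<bar> \<le> r + d" using d t(2) unfolding r_def by (auto simp: algebra_simps)
      \<comment> \<open>The time \<open>t\<close> clamped to \<open>[a - r, a + r]\<close>: the
        state is already known to vanish at \<open>c\<close>, and one more window reaches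
        \<open>t\<close>.\<close>
      define c where "c = max (a - r) (min (a + r) t)"
      have c: "c \<in> {0..b}" "\<bar>c - a\<bar> \<le> real k * d" "\<bar>t - c\<bar> \<le> d"
        using t(1) a(1) r d unfolding c_def r_def[symmetric] by (auto simp: min_def max_def)
      then have "\<And>i. i < n \<Longrightarrow> x c i = 0" using Suc by blast
      then show "x t i = 0"
        using lin_ode_zero_step[OF x K(1) _ d nK c(1) _ t(1) c(3) i] K(2) by blast
    qed
  qed
  moreover obtain k where "\<bar>t - a\<bar> / d < real k" using reals_Archimedean2 by blast
  then have "\<bar>t - a\<bar> \<le> real k * d" using d by (simp add: field_simps)
  ultimately show ?thesis using t i by blast
qed

text \<open>Integrating \<open>L\<close> times one term of the series of \<open>C exp (L t)\<close>
  gives the next term; this carries the majorants of the Picard iteration from one step to the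
  next.\<close>

lemma has_integral_exp_term:
  fixes L C t :: real
  assumes "0 \<le> t"
  shows "((\<lambda>s. L * (C * (L * s) ^ k / fact k)) has_integral C * (L * t) ^ Suc k / fact (Suc k)) {0..t}"
proof -
  have "((\<lambda>s. L * (C * (L * s) ^ k / fact k)) has_integral
      C * (L * t) ^ Suc k / fact (Suc k) - C * (L * 0) ^ Suc k / fact (Suc k)) {0..t}"
  proof (rule fundamental_theorem_of_calculus[OF assms])
    fix s :: real
    have "((\<lambda>s. L * s) has_real_derivative L) (at s within {0..t})"
      by (auto intro!: derivative_eq_intros)
    then have "((\<lambda>s. C * (L * s) ^ Suc k / fact (Suc k)) has_real_derivative
        C * ((1 + real k) * (L * (L * s) ^ k)) / fact (Suc k)) (at s within {0..t})"
      by (intro DERIV_cdivide DERIV_cmult DERIV_power_Suc)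
    moreover have "C * ((1 + real k) * (L * (L * s) ^ k)) / fact (Suc k) = L * (C * (L * s) ^ k / fact k)"
      by (simp add: divide_simps)
    ultimately show "((\<lambda>s. C * (L * s) ^ Suc k / fact (Suc k)) has_vector_derivative
        L * (C * (L * s) ^ k / fact k)) (at s within {0..t})"
      by (simp only: has_real_derivative_iff_has_vector_derivative)
  qed
  then show ?thesis by simp
qed

text \<open>
  Picard iteration: the solution is the series of the iterated integrals, whose \<open>k\<close>-th term
  is bounded on \<open>[0, b]\<close> by \<open>C (n K t)\<^sup>k / k!\<close> if \<open>C\<close> bounds the first term and \<open>K\<close> the coefficients.
\<close>

lemma lin_ode_exists:
  fixes M :: "real \<Rightarrow> nat \<Rightarrow> nat \<Rightarrow> real"
  assumes M: "\<And>i j. i < n \<Longrightarrow> j < n \<Longrightarrow> piecewise_continuous (\<lambda>t. M t i j)"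
    and f: "\<And>i. i < n \<Longrightarrow> piecewise_continuous (\<lambda>t. f t i)"
  shows "\<exists>x. (\<forall>b. lin_ode b n M f x) \<and> (\<forall>i<n. x 0 i = x0 i)"
proof -
  \<comment> \<open>The \<open>\<phi> k\<close> are the increments between successive Picard
    approximations; the approximations themselves are the partial sums \<open>P\<close>
    below.\<close>
  define \<phi> where "\<phi> = rec_nat (\<lambda>t i. x0 i + integral {0..t} (\<lambda>s. f s i))
    (\<lambda>_ y t i. integral {0..t} (\<lambda>s. \<Sum>j<n. M s i j * y s j))"
  have \<phi>0: "\<phi> 0 t i = x0 i + integral {0..t} (\<lambda>s. f s i)" for t i
    unfolding \<phi>_def by simp
  have \<phi>S: "\<phi> (Suc k) t i = integral {0..t} (\<lambda>s. \<Sum>j<n. M s i j * \<phi> k s j)" for k t i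
    unfolding \<phi>_def by simp
  have pcM: "piecewise_continuous (\<lambda>s. \<Sum>j<n. M s i j * y s j)"
    if "i < n" and "\<And>j. j < n \<Longrightarrow> continuous_on {0..} (\<lambda>s. y s j)" for i y
    using that
    by (intro piecewise_continuous_sum piecewise_continuous_mult M
        continuous_imp_piecewise_continuous) auto
  have cont_int: "continuous_on {0..} (\<lambda>t. integral {0..t} g)" if "piecewise_continuous g" for g
    by (intro continuous_on_atLeastI is_primitive_continuous[OF is_primitive_integral[OF that]])
  have cont: "\<forall>i<n. continuous_on {0..} (\<lambda>t. \<phi> k t i)" for k
  proof (induction k)
    case 0
    show ?case unfolding \<phi>0 by (auto intro!: continuous_intros cont_int f)
  next
    case (Suc k)
    then show ?case unfolding \<phi>S by (auto intro!: cont_int pcM)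
  qed
  \<comment> \<open>The series is defined without a horizon, while the bounds are taken on each
    \<open>[0, b]\<close> separately; so a single function solves the equation for all
    \<open>b\<close>.\<close>
  define x where "x t i = (\<Sum>k. \<phi> k t i)" for t i
  define P where "P m t i = (\<Sum>k<m. \<phi> k t i)" for m t i
  have main: "continuous_on {0..b} (\<lambda>t. x t i) \<and> (\<forall>t\<in>{0..b}. (\<lambda>m. P m t i) \<longlonglongrightarrow> x t i) \<and>
      (\<exists>B. \<forall>m. \<forall>t\<in>{0..b}. \<bar>P m t i\<bar> \<le> B)" if i: "i < n" for b i
  proof -
    obtain K where K: "K > 0" "\<forall>t\<in>{0..b}. \<forall>i<n. \<forall>j<n. \<bar>M t i j\<bar> \<le> K"
      using bounded_coefficients[of n M b] M by blast
    have "\<exists>C. \<forall>t\<in>{0..b}. \<bar>\<phi> 0 t j\<bar> \<le> C" if "j < n" for j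
      using cont[of 0] that
      by (intro piecewise_continuous_bounded continuous_imp_piecewise_continuous) auto
    then obtain c where c: "\<And>j t. j < n \<Longrightarrow> t \<in> {0..b} \<Longrightarrow> \<bar>\<phi> 0 t j\<bar> \<le> c j"
      by metis
    define C where "C = (\<Sum>j<n. \<bar>c j\<bar>)"
    have C0: "\<bar>\<phi> 0 t j\<bar> \<le> C" if "j < n" "t \<in> {0..b}" for j t
    proof -
      have "\<bar>c j\<bar> \<le> C" unfolding C_def using that by (intro member_le_sum) auto
      then show ?thesis using c[OF that] by simp
    qed
    have Cpos: "0 \<le> C" unfolding C_def by (simp add: sum_nonneg)
    define L where "L = real n * K"
    have Lpos: "0 \<le> L" unfolding L_def using K by simp
    have bound: "\<forall>j<n. \<forall>t\<in>{0..b}. \<bar>\<phi> k t j\<bar> \<le> C * (L * t) ^ k / fact k" for k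
    proof (induction k)
      case 0
      then show ?case using C0 by simp
    next
      case (Suc k)
      show ?case
      proof (intro allI impI ballI)
        fix j t assume j: "j < n" and t: "t \<in> {0..b}"
        have "norm (integral {0..t} (\<lambda>s. \<Sum>l<n. M s j l * \<phi> k s l))
            \<le> integral {0..t} (\<lambda>s. L * (C * (L * s) ^ k / fact k))"
        proof (rule integral_norm_bound_integral)
          show "(\<lambda>s. \<Sum>l<n. M s j l * \<phi> k s l) integrable_on {0..t}"
            using cont[of k] by (intro piecewise_continuous_integrable pcM j) auto
          show "(\<lambda>s. L * (C * (L * s) ^ k / fact k)) integrable_on {0..t}"
            using t by (intro has_integral_integrable[OF has_integral_exp_term]) auto
        next
          fix s assume s: "s \<in> {0..t}"
          have "\<bar>\<Sum>l<n. M s j l * \<phi> k s l\<bar> \<le> K * (\<Sum>l<n. \<bar>\<phi> k s l\<bar>)"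
            using K(2) s t j by (intro sum_coefficients_bound) auto
          also have "\<dots> \<le> K * (\<Sum>l<n. C * (L * s) ^ k / fact k)"
            using Suc K(1) s t by (intro mult_left_mono sum_mono) auto
          also have "\<dots> = L * (C * (L * s) ^ k / fact k)"
            unfolding L_def by (simp add: mult_ac)
          finally show "norm (\<Sum>l<n. M s j l * \<phi> k s l) \<le> L * (C * (L * s) ^ k / fact k)" by simp
        qed
        also have "\<dots> = C * (L * t) ^ Suc k / fact (Suc k)"
          using t by (intro integral_unique has_integral_exp_term) auto
        finally show "\<bar>\<phi> (Suc k) t j\<bar> \<le> C * (L * t) ^ Suc k / fact (Suc k)"
          unfolding \<phi>S by simp
      qed
    qed
    \<comment> \<open>The majorant at the right end point no longer depends on \<open>t\<close> and
      is summable as an exponential series, which is what the Weierstrass test asks for.\<close>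
    define B where "B k = C * (inverse (fact k) * (L * b) ^ k)" for k
    have bound': "norm (\<phi> k t i) \<le> B k" if t: "t \<in> {0..b}" for k t
    proof -
      have "\<bar>\<phi> k t i\<bar> \<le> C * (L * t) ^ k / fact k" using bound i t by blast
      also have "\<dots> \<le> C * (L * b) ^ k / fact k"
        using t Cpos Lpos by (intro divide_right_mono mult_left_mono power_mono) auto
      finally show ?thesis unfolding B_def by (simp add: field_simps)
    qed
    have sB: "summable B" unfolding B_def by (intro summable_mult summable_exp)
    have lim: "uniform_limit {0..b} (\<lambda>m t. P m t i) (\<lambda>t. x t i) sequentially"
      unfolding P_def x_def by (rule Weierstrass_m_test[OF bound' sB])
    have "continuous_on {0..b} (\<lambda>t. x t i)"
    proof (rule uniform_limit_theorem[OF _ lim])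
      show "\<forall>\<^sub>F m in sequentially. continuous_on {0..b} (\<lambda>t. P m t i)"
        unfolding P_def using cont i
        by (intro always_eventually allI continuous_on_sum)
          (auto intro: continuous_on_subset[of "{0..}"])
    qed simp
    moreover have "(\<lambda>m. P m t i) \<longlonglongrightarrow> x t i" if "t \<in> {0..b}" for t
      using lim that by (rule tendsto_uniform_limitI)
    moreover have "\<bar>P m t i\<bar> \<le> suminf B" if t: "t \<in> {0..b}" for m t
    proof -
      have "\<bar>P m t i\<bar> \<le> (\<Sum>k<m. \<bar>\<phi> k t i\<bar>)" unfolding P_def by (rule sum_abs)
      also have "\<dots> \<le> (\<Sum>k<m. B k)" using bound'[OF t] by (intro sum_mono) simp
      also have "\<dots> \<le> suminf B"
        by (intro sum_le_suminf sB order_trans[OF norm_ge_zero bound'[OF t]]) auto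
      finally show ?thesis .
    qed
    ultimately show ?thesis by blast
  qed
  have xc: "continuous_on {0..} (\<lambda>t. x t i)" if "i < n" for i
    using main[OF that] by (intro continuous_on_atLeastI) blast
  have eq: "x t i = x0 i + integral {0..t} (\<lambda>s. f s i) + integral {0..t} (\<lambda>s. \<Sum>j<n. M s i j * x s j)"
    if t: "0 \<le> t" and i: "i < n" for t i
  proof -
    \<comment> \<open>The Picard recursion for the partial sums; its limit is the integral equation
      for \<open>x\<close>. The limit passes under the integral by dominated convergence, since the
      partial sums are uniformly bounded on \<open>[0, t]\<close>.\<close>
    have PS: "P (Suc m) t i = \<phi> 0 t i + integral {0..t} (\<lambda>s. \<Sum>j<n. M s i j * P m s j)" for m
    proof -
      have "(\<Sum>k<m. \<phi> (Suc k) t i) = integral {0..t} (\<lambda>s. \<Sum>k<m. \<Sum>j<n. M s i j * \<phi> k s j)"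
        unfolding \<phi>S using cont
        by (intro integral_sum[symmetric] piecewise_continuous_integrable pcM i) auto
      also have "(\<lambda>s. \<Sum>k<m. \<Sum>j<n. M s i j * \<phi> k s j) = (\<lambda>s. \<Sum>j<n. M s i j * P m s j)"
        unfolding P_def sum_distrib_left by (subst sum.swap) simp
      finally show ?thesis unfolding P_def sum.lessThan_Suc_shift by simp
    qed
    have "\<exists>B. \<forall>m. \<forall>s\<in>{0..t}. \<bar>P m s j\<bar> \<le> B" if "j < n" for j
      using main[OF that] by blast
    then obtain B where B: "\<And>j m s. j < n \<Longrightarrow> s \<in> {0..t} \<Longrightarrow> \<bar>P m s j\<bar> \<le> B j"
      by metis
    obtain K where K: "K > 0" "\<forall>t\<in>{0..t}. \<forall>i<n. \<forall>j<n. \<bar>M t i j\<bar> \<le> K"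
      using bounded_coefficients[of n M t] M by blast
    have conv: "(\<lambda>m. integral {0..t} (\<lambda>s. \<Sum>j<n. M s i j * P m s j))
        \<longlonglongrightarrow> integral {0..t} (\<lambda>s. \<Sum>j<n. M s i j * x s j)"
    proof (rule dominated_convergence(2)[where h = "\<lambda>_. K * (\<Sum>j<n. B j)"])
      show "(\<lambda>s. \<Sum>j<n. M s i j * P m s j) integrable_on {0..t}" for m
        unfolding P_def using cont
        by (intro piecewise_continuous_integrable pcM i continuous_on_sum) auto
    next
      fix m s assume s: "s \<in> {0..t}"
      have "\<bar>\<Sum>j<n. M s i j * P m s j\<bar> \<le> K * (\<Sum>j<n. \<bar>P m s j\<bar>)"
        using K(2) s i by (intro sum_coefficients_bound) auto
      also have "\<dots> \<le> K * (\<Sum>j<n. B j)"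
        using K(1) B s by (intro mult_left_mono sum_mono) auto
      finally show "norm (\<Sum>j<n. M s i j * P m s j) \<le> K * (\<Sum>j<n. B j)" by simp
    next
      fix s assume s: "s \<in> {0..t}"
      show "(\<lambda>m. \<Sum>j<n. M s i j * P m s j) \<longlonglongrightarrow> (\<Sum>j<n. M s i j * x s j)"
        using main s by (intro tendsto_sum tendsto_mult tendsto_const) auto
    qed (rule integrable_const_ivl)
    have "(\<lambda>m. P (Suc m) t i) \<longlonglongrightarrow> x t i"
      using main[OF i, of t] t by (intro LIMSEQ_Suc) auto
    moreover have "(\<lambda>m. P (Suc m) t i) \<longlonglongrightarrow> \<phi> 0 t i + integral {0..t} (\<lambda>s. \<Sum>j<n. M s i j * x s j)"
      unfolding PS by (intro tendsto_add tendsto_const conv)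
    ultimately have "x t i = \<phi> 0 t i + integral {0..t} (\<lambda>s. \<Sum>j<n. M s i j * x s j)"
      by (rule LIMSEQ_unique)
    then show ?thesis unfolding \<phi>0 by simp
  qed
  have x0: "x 0 i = x0 i" if "i < n" for i
    using eq[of 0 i] that by simp
  have "lin_ode b n M f x" for b
    unfolding lin_ode_def
  proof (intro allI impI)
    fix i assume i: "i < n"
    show "is_primitive b (\<lambda>t. (\<Sum>j<n. M t i j * x t j) + f t i) (\<lambda>t. x t i)"
      unfolding is_primitive_def
    proof
      fix t assume "t \<in> {0..b}"
      then have t: "0 \<le> t" by simp
      have "((\<lambda>t. (\<Sum>j<n. M t i j * x t j) + f t i) has_integral
          integral {0..t} (\<lambda>s. \<Sum>j<n. M s i j * x s j) + integral {0..t} (\<lambda>s. f s i)) {0..t}"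
        by (intro has_integral_add integrable_integral piecewise_continuous_integrable pcM i f xc) auto
      then show "((\<lambda>t. (\<Sum>j<n. M t i j * x t j) + f t i) has_integral x t i - x 0 i) {0..t}"
        using eq[OF t i] x0[OF i] by (simp add: algebra_simps)
    qed
  qed
  then show ?thesis using x0 by blast
qed

section \<open>Separating experiments\<close>

lemma mult_mat_vec_index:
  assumes "A \<in> carrier_mat nr nc" "v \<in> carrier_vec nc" "i < nr"
  shows "(A *\<^sub>v v) $ i = (\<Sum>j<nc. A $$ (i, j) * v $ j)"
  using assms by (auto simp: scalar_prod_def atLeast0LessThan intro!: sum.cong)

text \<open>Padding with zero rows gives a square matrix \<open>B\<close> whose row \<open>m\<close>
  is 0. Its transpose kills the unit vector \<open>m\<close>, so the determinant is 0 and
  \<open>B\<close> has a kernel vector, which \<open>A\<close> kills as well.\<close>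

lemma wide_mat_kernel:
  fixes A :: "real mat"
  assumes A: "A \<in> carrier_mat m n" and "m < n"
  shows "\<exists>v. v \<in> carrier_vec n \<and> v \<noteq> 0\<^sub>v n \<and> A *\<^sub>v v = 0\<^sub>v m"
proof -
  define B where "B = mat n n (\<lambda>(i, j). if i < m then A $$ (i, j) else 0)"
  have B: "B \<in> carrier_mat n n" unfolding B_def by simp
  have "transpose_mat B *\<^sub>v unit_vec n m = 0\<^sub>v n"
  proof (rule eq_vecI)
    fix i assume "i < dim_vec (0\<^sub>v n :: real vec)"
    then have i: "i < n" by simp
    have "(transpose_mat B *\<^sub>v unit_vec n m) $ i = (\<Sum>j<n. transpose_mat B $$ (i, j) * unit_vec n m $ j)"
      using B i by (intro mult_mat_vec_index) auto
    also have "\<dots> = 0"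
      using i \<open>m < n\<close> by (intro sum.neutral) (auto simp: B_def unit_vec_def)
    finally show "(transpose_mat B *\<^sub>v unit_vec n m) $ i = 0\<^sub>v n $ i" using i by simp
  qed (use B in simp)
  moreover have "unit_vec n m \<noteq> (0\<^sub>v n :: real vec)"
    using \<open>m < n\<close> by (metis index_unit_vec(1) index_zero_vec(1) zero_neq_one)
  ultimately have "\<exists>v. v \<in> carrier_vec n \<and> v \<noteq> 0\<^sub>v n \<and> transpose_mat B *\<^sub>v v = 0\<^sub>v n"
    using unit_vec_carrier by blast
  then have "Determinant.det (transpose_mat B) = 0"
    using det_0_iff_vec_prod_zero_field[of "transpose_mat B" n] B by simp
  then have "Determinant.det B = 0" using det_transpose[OF B] by simp
  then obtain v where v: "v \<in> carrier_vec n" "v \<noteq> 0\<^sub>v n" "B *\<^sub>v v = 0\<^sub>v n"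
    using det_0_iff_vec_prod_zero_field[OF B] by auto
  have "A *\<^sub>v v = 0\<^sub>v m"
  proof (rule eq_vecI)
    fix i assume "i < dim_vec (0\<^sub>v m :: real vec)"
    then have i: "i < m" by simp
    have "(A *\<^sub>v v) $ i = (B *\<^sub>v v) $ i"
      using i \<open>m < n\<close> mult_mat_vec_index[OF A v(1) i] mult_mat_vec_index[OF B v(1), of i]
      by (simp add: B_def)
    then show "(A *\<^sub>v v) $ i = 0\<^sub>v m $ i" using v(3) i \<open>m < n\<close> by simp
  qed (use A in simp)
  then show ?thesis using v by blast
qed

definition vec_subspace :: "nat \<Rightarrow> real vec set \<Rightarrow> bool" where
  "vec_subspace n V \<longleftrightarrow> V \<subseteq> carrier_vec n \<and> 0\<^sub>v n \<in> V \<and>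
     (\<forall>v\<in>V. \<forall>w\<in>V. v + w \<in> V) \<and> (\<forall>c. \<forall>v\<in>V. c \<cdot>\<^sub>v v \<in> V)"

lemma vec_subspace_lincomb:
  assumes V: "vec_subspace n V" and "finite J" and "\<And>j. j \<in> J \<Longrightarrow> f j \<in> V"
  shows "vec n (\<lambda>i. \<Sum>j\<in>J. c j * f j $ i) \<in> V"
  using assms(2,3)
proof (induction J rule: finite_induct)
  case empty
  have "vec n (\<lambda>i. \<Sum>j\<in>{}. c j * f j $ i) = 0\<^sub>v n" by auto
  then show ?case using V unfolding vec_subspace_def by simp
next
  case (insert a J)
  have "f a \<in> carrier_vec n" using V insert.prems unfolding vec_subspace_def by blast
  then have eq: "vec n (\<lambda>i. \<Sum>j\<in>insert a J. c j * f j $ i)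
      = c a \<cdot>\<^sub>v f a + vec n (\<lambda>i. \<Sum>j\<in>J. c j * f j $ i)"
    using insert.hyps by auto
  have "c a \<cdot>\<^sub>v f a \<in> V" "vec n (\<lambda>i. \<Sum>j\<in>J. c j * f j $ i) \<in> V"
    using V insert unfolding vec_subspace_def by blast+
  then show ?case using V unfolding eq vec_subspace_def by blast
qed

text \<open>Choose \<open>w k\<close> in \<open>N k\<close> but not in \<open>N (Suc k)\<close>. The
  first \<open>n + 1\<close> of them are linearly dependent, and the one with the least index among
  the nonzero coefficients is a combination of later ones; these all lie in
  \<open>N (Suc k)\<close>, a contradiction.\<close>

lemma strict_subspace_chain_bound:
  assumes N: "\<And>k. vec_subspace n (N k)"
  shows "\<not> (\<forall>k::nat. N (Suc k) \<subset> N k)"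
proof
  assume "\<forall>k. N (Suc k) \<subset> N k"
  then have strict: "\<And>k. N (Suc k) \<subset> N k" by blast
  then have "\<forall>k. \<exists>w. w \<in> N k - N (Suc k)" by blast
  then obtain w where w: "\<And>k. w k \<in> N k" "\<And>k. w k \<notin> N (Suc k)" by (metis Diff_iff)
  have wc: "w k \<in> carrier_vec n" for k using w(1) N unfolding vec_subspace_def by blast
  have anti: "N k \<subseteq> N l" if "l \<le> k" for k l
    using that by (induction rule: dec_induct) (use strict in blast)+
  \<comment> \<open>A kernel vector of the matrix with columns \<open>w 0\<close> to
    \<open>w n\<close> is a linear dependence among them.\<close>
  define W where "W = mat n (Suc n) (\<lambda>(i, j). w j $ i)"
  have W: "W \<in> carrier_mat n (Suc n)" unfolding W_def by simp
  obtain v where v: "v \<in> carrier_vec (Suc n)" "v \<noteq> 0\<^sub>v (Suc n)" "W *\<^sub>v v = 0\<^sub>v n"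
    using wide_mat_kernel[OF W] by auto
  have "\<exists>k. k < Suc n \<and> v $ k \<noteq> 0"
  proof (rule ccontr)
    assume "\<not> ?thesis"
    then have "v = 0\<^sub>v (Suc n)" using v(1) by (intro eq_vecI) auto
    then show False using v(2) by simp
  qed
  define k where "k = (LEAST k. k < Suc n \<and> v $ k \<noteq> 0)"
  have k: "k < Suc n" "v $ k \<noteq> 0"
    using LeastI_ex[OF \<open>\<exists>k. k < Suc n \<and> v $ k \<noteq> 0\<close>] unfolding k_def by auto
  have below: "v $ j = 0" if "j < k" for j
    using not_less_Least[of j "\<lambda>k. k < Suc n \<and> v $ k \<noteq> 0"] that k(1) unfolding k_def[symmetric] by auto
  have "w k = vec n (\<lambda>i. \<Sum>j\<in>{Suc k..<Suc n}. - (v $ j / v $ k) * w j $ i)"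
  proof (rule eq_vecI)
    fix i assume "i < dim_vec (vec n (\<lambda>i. \<Sum>j\<in>{Suc k..<Suc n}. - (v $ j / v $ k) * w j $ i))"
    then have i: "i < n" by simp
    have "0 = (W *\<^sub>v v) $ i" using v(3) i by simp
    also have "\<dots> = (\<Sum>j<Suc n. W $$ (i, j) * v $ j)" by (rule mult_mat_vec_index[OF W v(1) i])
    also have "\<dots> = (\<Sum>j<Suc n. w j $ i * v $ j)"
      using i by (intro sum.cong) (auto simp: W_def)
    also have "\<dots> = (\<Sum>j\<in>{k..<Suc n}. w j $ i * v $ j)"
      using below k(1) by (intro sum.mono_neutral_right) auto
    also have "\<dots> = w k $ i * v $ k + (\<Sum>j\<in>{Suc k..<Suc n}. w j $ i * v $ j)"
      by (rule sum.atLeast_Suc_lessThan[OF k(1)])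
    finally have "w k $ i * v $ k = - (\<Sum>j\<in>{Suc k..<Suc n}. w j $ i * v $ j)" by simp
    then have "w k $ i = - (\<Sum>j\<in>{Suc k..<Suc n}. w j $ i * v $ j) / v $ k"
      using k(2) by (simp add: field_simps)
    also have "\<dots> = (\<Sum>j\<in>{Suc k..<Suc n}. - (v $ j / v $ k) * w j $ i)"
      by (simp add: sum_negf sum_divide_distrib mult.commute del: sum.op_ivl_Suc)
    finally show "w k $ i = vec n (\<lambda>i. \<Sum>j\<in>{Suc k..<Suc n}. - (v $ j / v $ k) * w j $ i) $ i"
      using i by simp
  qed (use wc in simp)
  also have "\<dots> \<in> N (Suc k)"
  proof (rule vec_subspace_lincomb[OF N])
    fix j assume "j \<in> {Suc k..<Suc n}"
    then show "w j \<in> N (Suc k)" using anti[of "Suc k" j] w(1) by auto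
  qed simp
  finally show False using w(2) by blast
qed

text \<open>
  \<open>N e\<close> are the initial states that the experiment \<open>e\<close> cannot tell from 0, and \<open>F e\<close> is the
  state transition during \<open>e\<close>. A state left undetected by \<open>e\<close> is moved to a nonzero state,
  which a further experiment detects; continuing \<open>e\<close> with it makes \<open>N e\<close> strictly smaller.
\<close>

lemma separating_experiment:
  assumes "e0 \<in> E" and N: "\<And>e. e \<in> E \<Longrightarrow> vec_subspace n (N e)"
    and concat: "\<And>e e'. e \<in> E \<Longrightarrow> e' \<in> E \<Longrightarrow> \<exists>d\<in>E. N d = {w \<in> N e. F e w \<in> N e'}"
    and F: "\<And>e w. e \<in> E \<Longrightarrow> w \<in> carrier_vec n \<Longrightarrow> F e w \<in> carrier_vec n"
    and inj: "\<And>e w. e \<in> E \<Longrightarrow> w \<in> carrier_vec n \<Longrightarrow> F e w = 0\<^sub>v n \<Longrightarrow> w = 0\<^sub>v n"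
    and inter: "\<And>w. w \<in> carrier_vec n \<Longrightarrow> (\<And>e. e \<in> E \<Longrightarrow> w \<in> N e) \<Longrightarrow> w = 0\<^sub>v n"
  shows "\<exists>e\<in>E. N e \<subseteq> {0\<^sub>v n}"
proof (rule ccontr)
  assume no: "\<not> ?thesis"
  have step: "\<exists>d. d \<in> E \<and> N d \<subset> N e" if e: "e \<in> E" for e
  proof -
    obtain w where w: "w \<in> N e" "w \<noteq> 0\<^sub>v n" using no e by blast
    then have wc: "w \<in> carrier_vec n" using N[OF e] unfolding vec_subspace_def by blast
    have "F e w \<noteq> 0\<^sub>v n" using inj[OF e wc] w(2) by blast
    then obtain e' where e': "e' \<in> E" "F e w \<notin> N e'" using inter F[OF e wc] by blast
    obtain d where d: "d \<in> E" "N d = {w \<in> N e. F e w \<in> N e'}" using concat[OF e e'(1)] by blast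
    then have "N d \<subset> N e" using w(1) e'(2) by blast
    then show ?thesis using d(1) by blast
  qed
  obtain e where e: "\<And>k. e k \<in> E" "\<And>k. N (e (Suc k)) \<subset> N (e k)"
    using dependent_nat_choice[of "\<lambda>_ d. d \<in> E" "\<lambda>_ c d. N d \<subset> N c"] \<open>e0 \<in> E\<close> step by metis
  show False
    using strict_subspace_chain_bound[of n "\<lambda>k. N (e k)"] N e by blast
qed

section \<open>Affine matrix families and observability\<close>

lemma affine_mat_carrier [simp]: "affine_mat n nr nc M p \<in> carrier_mat nr nc"
  unfolding affine_mat_def by simp

lemma affine_mat_index:
  "r < nr \<Longrightarrow> c < nc \<Longrightarrow>
    affine_mat n nr nc M p $$ (r, c) = M 0 $$ (r, c) + (\<Sum>i = 1..n. M i $$ (r, c) * p $ (i - 1))"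
  unfolding affine_mat_def by simp

lemma affine_mat_mult_vec_index:
  assumes M: "\<And>i. i \<le> n \<Longrightarrow> M i \<in> carrier_mat nr nc" and v: "v \<in> carrier_vec nc" and r: "r < nr"
  shows "(affine_mat n nr nc M p *\<^sub>v v) $ r = (M 0 *\<^sub>v v) $ r + (\<Sum>i = 1..n. p $ (i - 1) * (M i *\<^sub>v v) $ r)"
proof -
  have "(affine_mat n nr nc M p *\<^sub>v v) $ r
      = (\<Sum>c<nc. (M 0 $$ (r, c) + (\<Sum>i = 1..n. M i $$ (r, c) * p $ (i - 1))) * v $ c)"
    using mult_mat_vec_index[OF affine_mat_carrier v r] r by (simp add: affine_mat_index)
  also have "\<dots> = (\<Sum>c<nc. M 0 $$ (r, c) * v $ c)
      + (\<Sum>c<nc. \<Sum>i = 1..n. p $ (i - 1) * (M i $$ (r, c) * v $ c))"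
    by (simp add: algebra_simps sum.distrib sum_distrib_left)
  also have "(\<Sum>c<nc. \<Sum>i = 1..n. p $ (i - 1) * (M i $$ (r, c) * v $ c))
      = (\<Sum>i = 1..n. p $ (i - 1) * (\<Sum>c<nc. M i $$ (r, c) * v $ c))"
    unfolding sum_distrib_left by (rule sum.swap)
  finally show ?thesis
    using mult_mat_vec_index[OF M v r] by simp
qed

text \<open>The vector \<open>M(p) v\<close> depends affinely on \<open>p\<close>. Its difference
  quotients at an interior point in the coordinate directions are the \<open>M i v\<close> with
  positive \<open>i\<close>, and subtracting these contributions from one value leaves
  \<open>M 0 v\<close>; all these operations stay inside \<open>W\<close>.\<close>

lemma affine_mat_coefficients:
  assumes M: "\<And>i. i \<le> n \<Longrightarrow> M i \<in> carrier_mat nr nc" and v: "v \<in> carrier_vec nc"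
    and P: "vec_interior n P \<noteq> {}" and W: "vec_subspace nr W"
    and Pv: "\<And>p. p \<in> P \<Longrightarrow> affine_mat n nr nc M p *\<^sub>v v \<in> W" and i: "i \<le> n"
  shows "M i *\<^sub>v v \<in> W"
proof -
  obtain c r where c: "c \<in> carrier_vec n" and r: "r > 0"
    and ball: "\<And>q. q \<in> carrier_vec n \<Longrightarrow> L2_set (\<lambda>i. q $ i - c $ i) {..<n} < r \<Longrightarrow> q \<in> P"
    using P unfolding vec_interior_def by blast
  have Wc: "W \<subseteq> carrier_vec nr" and Wadd: "\<And>v w. v \<in> W \<Longrightarrow> w \<in> W \<Longrightarrow> v + w \<in> W"
    and Wsmult: "\<And>a v. v \<in> W \<Longrightarrow> a \<cdot>\<^sub>v v \<in> W"
    using W unfolding vec_subspace_def by auto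
  define A where "A p = affine_mat n nr nc M p *\<^sub>v v" for p
  have Ac: "A p \<in> carrier_vec nr" for p
    unfolding A_def by (rule mult_mat_vec_carrier[OF affine_mat_carrier v])
  have Ai: "A p $ k = (M 0 *\<^sub>v v) $ k + (\<Sum>i = 1..n. p $ (i - 1) * (M i *\<^sub>v v) $ k)" if "k < nr" for p k
    unfolding A_def by (rule affine_mat_mult_vec_index[OF M v that])
  have Mc: "M i *\<^sub>v v \<in> carrier_vec nr" if "i \<le> n" for i
    using M[OF that] v by simp
  have cP: "A c \<in> W"
    using ball[OF c] r unfolding A_def by (intro Pv) (simp add: L2_set_def)
  have pos: "M i *\<^sub>v v \<in> W" if i: "i \<in> {1..n}" for i
  proof -
    \<comment> \<open>A step of \<open>r / 2\<close> stays strictly inside the ball. Components are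
      counted from 0, so \<open>M i\<close> belongs to direction \<open>i - 1\<close>.\<close>
    define q where "q = c + (r / 2) \<cdot>\<^sub>v unit_vec n (i - 1)"
    have q: "q \<in> carrier_vec n" unfolding q_def using c by simp
    have qi: "q $ k - c $ k = (if k = i - 1 then r / 2 else 0)" if "k < n" for k
      unfolding q_def using c that i by (auto simp: unit_vec_def)
    have "L2_set (\<lambda>k. q $ k - c $ k) {..<n} = L2_set (\<lambda>k. if k = i - 1 then r / 2 else 0) {..<n}"
      by (rule L2_set_cong) (auto simp: qi)
    also have "\<dots> \<le> (\<Sum>k<n. \<bar>if k = i - 1 then r / 2 else 0\<bar>)" by (rule L2_set_le_sum_abs)
    also have "\<dots> = r / 2" using i r by (auto simp: if_distrib cong: if_cong)
    finally have "L2_set (\<lambda>k. q $ k - c $ k) {..<n} < r" using r by simp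
    then have qW: "A q \<in> W" unfolding A_def by (intro Pv ball q)
    have "M i *\<^sub>v v = (2 / r) \<cdot>\<^sub>v (A q + (- 1) \<cdot>\<^sub>v A c)"
    proof (rule eq_vecI)
      fix k assume "k < dim_vec ((2 / r) \<cdot>\<^sub>v (A q + (- 1) \<cdot>\<^sub>v A c))"
      then have k: "k < nr" using carrier_vecD[OF Ac] by simp
      have "A q $ k - A c $ k = (\<Sum>l = 1..n. (q $ (l - 1) - c $ (l - 1)) * (M l *\<^sub>v v) $ k)"
        using Ai[OF k] by (simp add: sum_subtractf[symmetric] left_diff_distrib)
      also have "\<dots> = (\<Sum>l = 1..n. if l = i then r / 2 * (M l *\<^sub>v v) $ k else 0)"
      proof (rule sum.cong)
        fix l assume l: "l \<in> {1..n}"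
        then have "l - 1 < n" "l - 1 = i - 1 \<longleftrightarrow> l = i" using i by auto
        then have "q $ (l - 1) - c $ (l - 1) = (if l = i then r / 2 else 0)"
          using qi[of "l - 1"] by simp
        then show "(q $ (l - 1) - c $ (l - 1)) * (M l *\<^sub>v v) $ k
            = (if l = i then r / 2 * (M l *\<^sub>v v) $ k else 0)" by simp
      qed simp
      also have "\<dots> = r / 2 * (M i *\<^sub>v v) $ k" using i by simp
      finally show "(M i *\<^sub>v v) $ k = ((2 / r) \<cdot>\<^sub>v (A q + (- 1) \<cdot>\<^sub>v A c)) $ k"
        using Ac[of q] Ac[of c] k r by (simp add: field_simps)
    qed (use carrier_vecD[OF Ac] carrier_vecD[OF Mc[of i]] i in auto)
    then show ?thesis using Wadd Wsmult qW cP by simp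
  qed
  show ?thesis
  proof (cases "i = 0")
    case True
    have "M 0 *\<^sub>v v = A c + (- 1) \<cdot>\<^sub>v vec nr (\<lambda>k. \<Sum>l\<in>{1..n}. c $ (l - 1) * (M l *\<^sub>v v) $ k)"
    proof (rule eq_vecI)
      fix k assume "k < dim_vec (A c + (- 1) \<cdot>\<^sub>v vec nr (\<lambda>k. \<Sum>l\<in>{1..n}. c $ (l - 1) * (M l *\<^sub>v v) $ k))"
      then have k: "k < nr" by simp
      then show "(M 0 *\<^sub>v v) $ k
          = (A c + (- 1) \<cdot>\<^sub>v vec nr (\<lambda>k. \<Sum>l\<in>{1..n}. c $ (l - 1) * (M l *\<^sub>v v) $ k)) $ k"
        using Ai[OF k, of c] Ac[of c] by simp
    qed (use carrier_vecD[OF Ac] carrier_vecD[OF Mc[of 0]] in auto)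
    moreover have "vec nr (\<lambda>k. \<Sum>l\<in>{1..n}. c $ (l - 1) * (M l *\<^sub>v v) $ k) \<in> W"
      by (rule vec_subspace_lincomb[OF W]) (use pos in auto)
    ultimately show ?thesis using True Wadd Wsmult cP by simp
  next
    case False
    then show ?thesis using i pos by simp
  qed
qed

text \<open>The basis-free form of observability: the largest subspace that is invariant under all
  \<open>matA\<close> and annihilated by all \<open>matC\<close> is zero.\<close>

definition observable_lpv :: "lpv \<Rightarrow> bool" where
  "observable_lpv S \<longleftrightarrow> (\<forall>V. vec_subspace (nx S) V \<and>
     (\<forall>i\<le>np S. \<forall>v\<in>V. matA S i *\<^sub>v v \<in> V \<and> matC S i *\<^sub>v v = 0\<^sub>v (ny S)) \<longrightarrow> V \<subseteq> {0\<^sub>v (nx S)})"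

lemma vec_subspace_zero: "vec_subspace n {0\<^sub>v n}"
  unfolding vec_subspace_def by auto

text \<open>Both conditions put a vector depending affinely on \<open>p\<close> into a subspace,
  \<open>V\<close> for \<open>A\<close> and the zero space for \<open>C\<close>, so they pass from
  the values to the coefficients.\<close>

lemma observable_lpv_par:
  assumes S: "lpv_ssa S" "observable_lpv S" and P: "vec_interior (np S) (par S) \<noteq> {}"
    and V: "vec_subspace (nx S) V"
    and inv: "\<And>p v. p \<in> par S \<Longrightarrow> v \<in> V \<Longrightarrow> A_at S p *\<^sub>v v \<in> V"
    and ker: "\<And>p v. p \<in> par S \<Longrightarrow> v \<in> V \<Longrightarrow> C_at S p *\<^sub>v v = 0\<^sub>v (ny S)"
  shows "V \<subseteq> {0\<^sub>v (nx S)}"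
proof -
  have Vc: "v \<in> carrier_vec (nx S)" if "v \<in> V" for v
    using V that unfolding vec_subspace_def by blast
  have "matA S i *\<^sub>v v \<in> V" if "i \<le> np S" "v \<in> V" for i v
    by (rule affine_mat_coefficients[OF _ Vc[OF that(2)] P V _ that(1)])
      (use S(1) inv that(2) in \<open>auto simp: lpv_ssa_def A_at_def\<close>)
  moreover have "matC S i *\<^sub>v v \<in> {0\<^sub>v (ny S)}" if "i \<le> np S" "v \<in> V" for i v
    by (rule affine_mat_coefficients[OF _ Vc[OF that(2)] P vec_subspace_zero _ that(1)])
      (use S(1) ker that(2) in \<open>auto simp: lpv_ssa_def C_at_def\<close>)
  ultimately show ?thesis
    using V by (intro S(2)[unfolded observable_lpv_def, THEN spec, THEN mp] conjI) auto
qed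

lemma vstack_mult_zero:
  assumes M: "\<And>M. M \<in> set Ms \<Longrightarrow> dim_col M = nc \<and> M *\<^sub>v x = 0\<^sub>v (dim_row M)"
  shows "vstack nc Ms *\<^sub>v x = 0\<^sub>v (dim_row (vstack nc Ms))"
proof (rule eq_vecI)
  fix k assume "k < dim_vec (0\<^sub>v (dim_row (vstack nc Ms)) :: real vec)"
  then have k: "k < length (concat (map rows Ms))" by (simp add: vstack_def)
  then have "concat (map rows Ms) ! k \<in> set (concat (map rows Ms))" by (rule nth_mem)
  then obtain M r where Mr: "M \<in> set Ms" "r < dim_row M" "concat (map rows Ms) ! k = row M r"
    by (auto simp: rows_def)
  have "row (vstack nc Ms) k = row M r"
    unfolding vstack_def using k Mr M[OF Mr(1)] by (subst mat_of_rows_row) auto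
  then have "(vstack nc Ms *\<^sub>v x) $ k = (M *\<^sub>v x) $ r"
    using k Mr(2) by (simp add: vstack_def)
  then show "(vstack nc Ms *\<^sub>v x) $ k = 0\<^sub>v (dim_row (vstack nc Ms)) $ k"
    using M[OF Mr(1)] Mr(2) k by (simp add: vstack_def)
qed simp

lemma obs_mat_dim_col [simp]: "dim_col (obs_mat S k) = nx S"
  by (cases k) (simp_all add: vstack_def)

text \<open>In the step a new block acts as \<open>O_k (A_i x)\<close>, and \<open>A_i x\<close> is
  again in \<open>W\<close>, where \<open>O_k\<close> vanishes by induction; hence the inclusion
  holds at every depth \<open>k\<close>.\<close>

lemma invariant_in_obs_kernel:
  assumes S: "lpv_ssa S" and W: "W \<subseteq> carrier_vec (nx S)"
    and A: "\<And>i x. i \<le> np S \<Longrightarrow> x \<in> W \<Longrightarrow> matA S i *\<^sub>v x \<in> W"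
    and C: "\<And>i x. i \<le> np S \<Longrightarrow> x \<in> W \<Longrightarrow> matC S i *\<^sub>v x = 0\<^sub>v (ny S)"
  shows "W \<subseteq> mat_kernel (obs_mat S k)"
proof
  have dims: "matA S i \<in> carrier_mat (nx S) (nx S)" "matC S i \<in> carrier_mat (ny S) (nx S)" if "i \<le> np S" for i
    using S that unfolding lpv_ssa_def by auto
  have "\<forall>x\<in>W. obs_mat S k *\<^sub>v x = 0\<^sub>v (dim_row (obs_mat S k))"
  proof (induction k)
    case 0
    show ?case
      unfolding obs_mat.simps
    proof (intro ballI vstack_mult_zero)
      fix x M assume x: "x \<in> W" and "M \<in> set (map (matC S) [0..<np S + 1])"
      then obtain i where "i \<in> set [0..<np S + 1]" "M = matC S i" unfolding set_map by blast
      then have "i \<le> np S" "M = matC S i" by auto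
      then show "dim_col M = nx S \<and> M *\<^sub>v x = 0\<^sub>v (dim_row M)"
        using dims(2)[of i] C[OF _ x, of i] by simp
    qed
  next
    case (Suc k)
    show ?case
      unfolding obs_mat.simps
    proof (intro ballI vstack_mult_zero)
      fix x M assume x: "x \<in> W" and M: "M \<in> set (obs_mat S k # map (\<lambda>i. obs_mat S k * matA S i) [0..<np S +
          1])"
      show "dim_col M = nx S \<and> M *\<^sub>v x = 0\<^sub>v (dim_row M)"
      proof (cases "M = obs_mat S k")
        case True
        then show ?thesis using Suc x by simp
      next
        case False
        then obtain i where "i \<in> set [0..<np S + 1]" "M = obs_mat S k * matA S i"
          using M unfolding list.set set_map by blast
        then have i: "i \<le> np S" "M = obs_mat S k * matA S i" by auto
        have "M *\<^sub>v x = obs_mat S k *\<^sub>v (matA S i *\<^sub>v x)"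
          unfolding i(2) using dims(1)[OF i(1)] W x
          by (intro assoc_mult_mat_vec[of _ "dim_row (obs_mat S k)" "nx S"]) (auto intro: carrier_matI)
        then show ?thesis using Suc A[OF i(1) x] i dims(1)[OF i(1)] by simp
      qed
    qed
  qed
  then show "x \<in> mat_kernel (obs_mat S k)" if "x \<in> W" for x
    using that W unfolding mat_kernel_def by auto
qed

section \<open>The reduced system as a projection\<close>

lemma affine_mat_cong:
  assumes "\<And>i. i \<le> n \<Longrightarrow> M i = M' i"
  shows "affine_mat n nr nc M p = affine_mat n nr nc M' p"
  unfolding affine_mat_def using assms by (intro eq_matI) auto

lemma affine_mat_mult_left:
  assumes L: "L \<in> carrier_mat m nr" and M: "\<And>i. i \<le> n \<Longrightarrow> M i \<in> carrier_mat nr nc"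
    and v: "v \<in> carrier_vec nc"
  shows "L *\<^sub>v (affine_mat n nr nc M p *\<^sub>v v) = affine_mat n m nc (\<lambda>i. L * M i) p *\<^sub>v v"
proof (rule eq_vecI)
  fix r assume "r < dim_vec (affine_mat n m nc (\<lambda>i. L * M i) p *\<^sub>v v)"
  then have r: "r < m" by (simp add: affine_mat_def)
  have Lr: "(L *\<^sub>v w) $ r = (\<Sum>k<nr. L $$ (r, k) * w $ k)" if "w \<in> carrier_vec nr" for w
    by (rule mult_mat_vec_index[OF L that r])
  have Mv: "((L * M i) *\<^sub>v v) $ r = (\<Sum>k<nr. L $$ (r, k) * (M i *\<^sub>v v) $ k)" if "i \<le> n" for i
    using assoc_mult_mat_vec[OF L M[OF that] v] M[OF that] v by (simp add: Lr)
  have "(L *\<^sub>v (affine_mat n nr nc M p *\<^sub>v v)) $ r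
      = (\<Sum>k<nr. L $$ (r, k) * (affine_mat n nr nc M p *\<^sub>v v) $ k)"
    by (rule Lr[OF mult_mat_vec_carrier[OF affine_mat_carrier v]])
  also have "\<dots> = (\<Sum>k<nr. L $$ (r, k) * ((M 0 *\<^sub>v v) $ k + (\<Sum>i = 1..n. p $ (i - 1) * (M i *\<^sub>v v) $ k)))"
    by (rule sum.cong) (auto simp del: index_mult_mat_vec simp: affine_mat_mult_vec_index[where M
        = M, OF M v])
  also have "\<dots> = (\<Sum>k<nr. L $$ (r, k) * (M 0 *\<^sub>v v) $ k)
      + (\<Sum>k<nr. \<Sum>i = 1..n. p $ (i - 1) * (L $$ (r, k) * (M i *\<^sub>v v) $ k))"
    by (simp only: distrib_left sum.distrib sum_distrib_left mult.left_commute)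
  also have "(\<Sum>k<nr. \<Sum>i = 1..n. p $ (i - 1) * (L $$ (r, k) * (M i *\<^sub>v v) $ k))
      = (\<Sum>i = 1..n. p $ (i - 1) * (\<Sum>k<nr. L $$ (r, k) * (M i *\<^sub>v v) $ k))"
    unfolding sum_distrib_left by (rule sum.swap)
  also have "(\<Sum>k<nr. L $$ (r, k) * (M 0 *\<^sub>v v) $ k) + (\<Sum>i
      = 1..n. p $ (i - 1) * (\<Sum>k<nr. L $$ (r, k) * (M i *\<^sub>v v) $ k))
      = ((L * M 0) *\<^sub>v v) $ r + (\<Sum>i = 1..n. p $ (i - 1) * ((L * M i) *\<^sub>v v) $ r)"
    using Mv by (intro arg_cong2[of _ _ _ _ "(+)"] sum.cong) simp_all
  also have "\<dots> = (affine_mat n m nc (\<lambda>i. L * M i) p *\<^sub>v v) $ r"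
    by (rule affine_mat_mult_vec_index[symmetric, where M = "\<lambda>i. L * M i", OF mult_carrier_mat[OF L M] v r])
  finally show "(L *\<^sub>v (affine_mat n nr nc M p *\<^sub>v v)) $ r
      = (affine_mat n m nc (\<lambda>i. L * M i) p *\<^sub>v v) $ r" .
qed (use L in \<open>simp add: affine_mat_def\<close>)

lemma affine_mat_mult_right:
  assumes L: "L \<in> carrier_mat nc m" and M: "\<And>i. i \<le> n \<Longrightarrow> M i \<in> carrier_mat nr nc"
    and v: "v \<in> carrier_vec m"
  shows "affine_mat n nr nc M p *\<^sub>v (L *\<^sub>v v) = affine_mat n nr m (\<lambda>i. M i * L) p *\<^sub>v v"
proof (rule eq_vecI)
  fix r assume "r < dim_vec (affine_mat n nr m (\<lambda>i. M i * L) p *\<^sub>v v)"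
  then have r: "r < nr" by (simp add: affine_mat_def)
  have Lv: "L *\<^sub>v v \<in> carrier_vec nc" by (rule mult_mat_vec_carrier[OF L v])
  have Mv: "M i *\<^sub>v (L *\<^sub>v v) = (M i * L) *\<^sub>v v" if "i \<le> n" for i
    by (rule assoc_mult_mat_vec[OF M[OF that] L v, symmetric])
  show "(affine_mat n nr nc M p *\<^sub>v (L *\<^sub>v v)) $ r = (affine_mat n nr m (\<lambda>i. M i * L) p *\<^sub>v v) $ r"
    using affine_mat_mult_vec_index[where M = M, OF M Lv r, of n p]
      affine_mat_mult_vec_index[where M = "\<lambda>i. M i * L", OF mult_carrier_mat[OF M L] v r, of n p] Mv
    by (simp del: index_mult_mat_vec)
qed (simp add: affine_mat_def)

text \<open>\<open>R\<close> is the quotient of \<open>S\<close> by the kernel of \<open>L\<close>: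
  \<open>L\<close> intertwines the coefficient matrices. The right inverse \<open>L'\<close> makes
  \<open>L\<close> surjective and supplies a preimage for each reduced state.\<close>

definition state_projection :: "lpv \<Rightarrow> lpv \<Rightarrow> real mat \<Rightarrow> real mat \<Rightarrow> bool" where
  "state_projection S R L L' \<longleftrightarrow>
     np R = np S \<and> nu R = nu S \<and> ny R = ny S \<and> par R = par S \<and>
     L \<in> carrier_mat (nx R) (nx S) \<and> L' \<in> carrier_mat (nx S) (nx R) \<and> L * L' = 1\<^sub>m (nx R) \<and>
     (\<forall>i\<le>np S. L * matA S i = matA R i * L \<and> L * matB S i = matB R i \<and>
        matC S i = matC R i * L \<and> matD S i = matD R i)"

text \<open>The block matrix \<open>[I 0]\<close> for \<open>m <= n\<close>: as a left factor it
  selects the first \<open>m\<close> rows, as a right factor it appends zero columns.\<close>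

definition leading_rows :: "nat \<Rightarrow> nat \<Rightarrow> real mat" where
  "leading_rows m n = mat m n (\<lambda>(i, j). if i = j then 1 else 0)"

lemma leading_rows_carrier [simp]: "leading_rows m n \<in> carrier_mat m n"
  unfolding leading_rows_def by simp

lemma mult_mat_index:
  assumes "A \<in> carrier_mat nr n" "B \<in> carrier_mat n nc" "i < nr" "j < nc"
  shows "(A * B) $$ (i, j) = (\<Sum>k<n. A $$ (i, k) * B $$ (k, j))"
  using assms by (auto simp: scalar_prod_def atLeast0LessThan intro!: sum.cong)

lemma leading_rows_mult_index:
  assumes X: "X \<in> carrier_mat n nc" and "m \<le> n" "i < m" "j < nc"
  shows "(leading_rows m n * X) $$ (i, j) = X $$ (i, j)"
proof -
  have "(leading_rows m n * X) $$ (i, j) = (\<Sum>k<n. leading_rows m n $$ (i, k) * X $$ (k, j))"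
    using assms by (intro mult_mat_index) auto
  also have "\<dots> = (\<Sum>k<n. if k = i then X $$ (k, j) else 0)"
    using assms by (intro sum.cong) (auto simp: leading_rows_def)
  finally show ?thesis using assms by simp
qed

lemma mult_leading_rows_index:
  assumes Y: "Y \<in> carrier_mat nr m" and "m \<le> n" "i < nr" "j < n"
  shows "(Y * leading_rows m n) $$ (i, j) = (if j < m then Y $$ (i, j) else 0)"
proof -
  have "(Y * leading_rows m n) $$ (i, j) = (\<Sum>k<m. Y $$ (i, k) * leading_rows m n $$ (k, j))"
    using assms by (intro mult_mat_index) auto
  also have "\<dots> = (\<Sum>k<m. if k = j then Y $$ (i, k) else 0)"
    using assms by (intro sum.cong) (auto simp: leading_rows_def)
  finally show ?thesis using assms by simp
qed

text \<open>With \<open>E = [I 0]\<close> the projection is \<open>L = E T\<close> and its section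
  is \<open>L' = Ti E^T\<close>. The zero blocks of the transformed matrices are exactly the
  intertwining relations.\<close>

lemma obs_reduction_projection:
  assumes S: "lpv_ssa S" and red: "obs_reduction S R"
  shows "lpv_ssa R \<and> (\<exists>L L'. state_projection S R L L' \<and>
    mat_kernel (obs_mat S (nx S - 1)) \<subseteq> mat_kernel L)"
proof -
  define n m where "n = nx S" and "m = nx R"
  note red' = red[unfolded obs_reduction_def, folded n_def m_def]
  have same: "np R = np S" "nu R = nu S" "ny R = ny S" "par R = par S" and mn: "m \<le> n"
    using red' by auto
  obtain bs T Ti where len: "length bs = n"
    and basis: "vectorspace.basis class_ring (module_vec TYPE(real) n) (set bs)"
    and span: "LinearCombinations.module.span class_ring (module_vec TYPE(real) n)
          (set (drop m bs)) = mat_kernel (obs_mat S (n - 1))"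
    and Ti: "Ti = mat_of_cols n bs" and T: "T \<in> carrier_mat n n"
    and inv: "inverts_mat T Ti" "inverts_mat Ti T"
    and blocks: "\<forall>i\<le>np S. \<exists>A' A'' B'.
           matA R i \<in> carrier_mat m m \<and>
           A' \<in> carrier_mat (n - m) m \<and>
           A'' \<in> carrier_mat (n - m) (n - m) \<and>
           T * matA S i * Ti = four_block_mat (matA R i) (0\<^sub>m m (n - m)) A' A'' \<and>
           matB R i \<in> carrier_mat m (nu S) \<and>
           B' \<in> carrier_mat (n - m) (nu S) \<and>
           T * matB S i = matB R i @\<^sub>r B' \<and>
           matC R i \<in> carrier_mat (ny S) m \<and>
           matC S i * Ti =
             four_block_mat (matC R i) (0\<^sub>m (ny S) (n - m)) (0\<^sub>m 0 m) (0\<^sub>m 0 (n - m)) \<and>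
           matD R i = matD S i"
    using red' by (elim conjE exE) (rule that; assumption)
  have Tic: "Ti \<in> carrier_mat n n" unfolding Ti using len by (intro carrier_matI) auto
  have TTi: "T * Ti = 1\<^sub>m n" and TiT: "Ti * T = 1\<^sub>m n"
    using inv T Tic unfolding inverts_mat_def by auto
  define E where "E = leading_rows m n"
  have E: "E \<in> carrier_mat m n" unfolding E_def by simp
  define L L' where "L = E * T" and "L' = Ti * transpose_mat E"
  have L: "L \<in> carrier_mat m n" and L': "L' \<in> carrier_mat n m"
    unfolding L_def L'_def using E T Tic by auto
  have Sd: "matA S i \<in> carrier_mat n n" "matB S i \<in> carrier_mat n (nu S)"
    "matC S i \<in> carrier_mat (ny S) n" "matD S i \<in> carrier_mat (ny S) (nu S)" if "i \<le> np S" for i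
    using S that unfolding lpv_ssa_def n_def by auto
  have "E * transpose_mat E = 1\<^sub>m m"
  proof (rule eq_matI)
    fix i j assume "i < dim_row (1\<^sub>m m :: real mat)" "j < dim_col (1\<^sub>m m :: real mat)"
    then have ij: "i < m" "j < m" by auto
    then have "(E * transpose_mat E) $$ (i, j) = transpose_mat E $$ (i, j)"
      unfolding E_def using mn by (intro leading_rows_mult_index) auto
    then show "(E * transpose_mat E) $$ (i, j) = 1\<^sub>m m $$ (i, j)"
      using ij mn by (auto simp: E_def leading_rows_def)
  qed (use E in auto)
  moreover have "L * L' = E * (T * (Ti * transpose_mat E))"
    unfolding L_def L'_def using E T Tic by (intro assoc_mult_mat[of _ m n _ n _ m]) auto
  moreover have "T * (Ti * transpose_mat E) = T * Ti * transpose_mat E"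
    using E T Tic by (intro assoc_mult_mat[symmetric, of _ n n _ n _ m]) auto
  ultimately have LL': "L * L' = 1\<^sub>m m" using E by (simp add: TTi)
  have main: "matA R i \<in> carrier_mat m m \<and> matB R i \<in> carrier_mat m (nu S) \<and>
      matC R i \<in> carrier_mat (ny S) m \<and> L * matA S i = matA R i * L \<and> L * matB S i = matB R i \<and>
      matC S i = matC R i * L \<and> matD S i = matD R i" if i: "i \<le> np S" for i
  proof -
    obtain A' A'' B' where AR: "matA R i \<in> carrier_mat m m" and A': "A' \<in> carrier_mat (n - m) m"
      and A'': "A'' \<in> carrier_mat (n - m) (n - m)"
      and A: "T * matA S i * Ti = four_block_mat (matA R i) (0\<^sub>m m (n - m)) A' A''"
      and BR: "matB R i \<in> carrier_mat m (nu S)" and B': "B' \<in> carrier_mat (n - m) (nu S)"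
      and B: "T * matB S i = matB R i @\<^sub>r B'" and CR: "matC R i \<in> carrier_mat (ny S) m"
      and C: "matC S i * Ti =
             four_block_mat (matC R i) (0\<^sub>m (ny S) (n - m)) (0\<^sub>m 0 m) (0\<^sub>m 0 (n - m))"
      and D: "matD R i = matD S i"
      using blocks i by blast
    \<comment> \<open>The left side is the upper block row, whose right part is zero. Multiplying by
      \<open>T\<close> on the right then cancels \<open>Ti\<close> and gives the relation for
      \<open>L\<close>.\<close>
    have "E * (T * matA S i * Ti) = matA R i * E"
    proof (rule eq_matI)
      fix k j assume "k < dim_row (matA R i * E)" "j < dim_col (matA R i * E)"
      then have kj: "k < m" "j < n" using AR E by auto
      have "(E * (T * matA S i * Ti)) $$ (k, j) = (T * matA S i * Ti) $$ (k, j)"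
        unfolding E_def using T Tic Sd(1)[OF i] kj mn by (intro leading_rows_mult_index) auto
      also have "\<dots> = (matA R i * E) $$ (k, j)"
        unfolding A E_def using AR A' A'' kj mn
        by (subst mult_leading_rows_index[OF AR mn kj]) (auto simp: carrier_matD)
      finally show "(E * (T * matA S i * Ti)) $$ (k, j) = (matA R i * E) $$ (k, j)" .
    qed (use E AR T Tic in auto)
    then have "E * (T * matA S i * Ti) * T = matA R i * E * T" by simp
    moreover have "E * (T * matA S i * Ti) * T = E * (T * matA S i * Ti * T)"
      using E T Tic Sd(1)[OF i] by (intro assoc_mult_mat[of _ m n _ n _ n]) auto
    moreover have "T * matA S i * Ti * T = T * matA S i * (Ti * T)"
      using T Tic Sd(1)[OF i] by (intro assoc_mult_mat[of _ n n _ n _ n]) auto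
    moreover have "T * matA S i * (Ti * T) = T * matA S i"
      unfolding TiT using T Sd(1)[OF i] by (intro right_mult_one_mat[of _ n n]) auto
    moreover have "matA R i * E * T = matA R i * L"
      unfolding L_def by (rule assoc_mult_mat[OF AR E T])
    moreover have "L * matA S i = E * (T * matA S i)"
      unfolding L_def by (rule assoc_mult_mat[OF E T Sd(1)[OF i]])
    ultimately have LA: "L * matA S i = matA R i * L" by simp
    have "L * matB S i = E * (T * matB S i)"
      unfolding L_def by (rule assoc_mult_mat[OF E T Sd(2)[OF i]])
    also have "\<dots> = matB R i"
    proof (rule eq_matI)
      fix k j assume "k < dim_row (matB R i)" "j < dim_col (matB R i)"
      then have kj: "k < m" "j < nu S" using BR by auto
      have "(E * (T * matB S i)) $$ (k, j) = (T * matB S i) $$ (k, j)"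
        unfolding E_def using T Sd(2)[OF i] kj mn by (intro leading_rows_mult_index) auto
      also have "\<dots> = matB R i $$ (k, j)"
        unfolding B append_rows_def using BR B' kj by (auto simp: carrier_matD)
      finally show "(E * (T * matB S i)) $$ (k, j) = matB R i $$ (k, j)" .
    qed (use E BR Sd(2)[OF i] in auto)
    finally have LB: "L * matB S i = matB R i" .
    have "matC S i * Ti = matC R i * E"
    proof (rule eq_matI)
      fix k j assume "k < dim_row (matC R i * E)" "j < dim_col (matC R i * E)"
      then have kj: "k < ny S" "j < n" using CR E by auto
      show "(matC S i * Ti) $$ (k, j) = (matC R i * E) $$ (k, j)"
        unfolding C E_def using CR kj mn
        by (subst mult_leading_rows_index[OF CR mn kj]) (auto simp: carrier_matD)
    qed (use E CR Sd(3)[OF i] Tic in auto)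
    then have "matC S i * Ti * T = matC R i * E * T" by simp
    moreover have "matC S i * Ti * T = matC S i * (Ti * T)"
      by (rule assoc_mult_mat[OF Sd(3)[OF i] Tic T])
    moreover have "matC R i * E * T = matC R i * L"
      unfolding L_def by (rule assoc_mult_mat[OF CR E T])
    ultimately have "matC S i = matC R i * L"
      unfolding TiT using Sd(3)[OF i] by simp
    then show ?thesis using AR BR CR LA LB D by simp
  qed
  have ssa: "lpv_ssa R"
    using S main Sd(4) unfolding lpv_ssa_def same m_def by auto
  have proj: "state_projection S R L L'"
    using main L L' LL' same unfolding state_projection_def m_def n_def by auto
  \<comment> \<open>The kernel is spanned by the basis vectors from position \<open>m\<close> on,
    counted from 0. \<open>T\<close> sends the vector at position \<open>j\<close> to the unit
    vector \<open>j\<close>, which \<open>E\<close> kills for \<open>j >= m\<close>.\<close>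
  have "mat_kernel (obs_mat S (n - 1)) \<subseteq> mat_kernel L"
  proof -
    interpret V: vec_space "TYPE(real)" n .
    have bsc: "set bs \<subseteq> carrier_vec n" using basis unfolding V.basis_def by simp
    have "set (drop m bs) \<subseteq> mat_kernel L"
    proof
      fix b assume "b \<in> set (drop m bs)"
      then obtain j where j: "m \<le> j" "j < n" "b = bs ! j"
        using len by (auto simp: in_set_conv_nth) (metis add.commute le_add2 less_diff_conv nth_drop)
      have b: "b \<in> carrier_vec n" using j bsc len by auto
      have "b = col Ti j" unfolding Ti using j len b by simp
      then have "T *\<^sub>v b = col (T * Ti) j" using col_mult2[OF T Tic j(2)] by simp
      then have "L *\<^sub>v b = E *\<^sub>v col (T * Ti) j"
        unfolding L_def using assoc_mult_mat_vec[OF E T b] by simp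
      also have "\<dots> = E *\<^sub>v unit_vec n j" using j by (simp add: TTi)
      also have "\<dots> = 0\<^sub>v m"
      proof (rule eq_vecI)
        fix i assume "i < dim_vec (0\<^sub>v m :: real vec)"
        then have i: "i < m" by simp
        have "(E *\<^sub>v unit_vec n j) $ i = (\<Sum>k<n. E $$ (i, k) * unit_vec n j $ k)"
          using E i by (intro mult_mat_vec_index) auto
        also have "\<dots> = 0"
          using i j mn by (intro sum.neutral) (auto simp: E_def leading_rows_def unit_vec_def)
        finally show "(E *\<^sub>v unit_vec n j) $ i = 0\<^sub>v m $ i" using i by simp
      qed (use E in simp)
      finally show "b \<in> mat_kernel L" by (rule mat_kernelI[OF L b])
    qed
    \<comment> \<open>A submodule containing the spanning vectors contains their span, so it remains
      to see that the kernel of \<open>L\<close> is one.\<close>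
    moreover have "LinearCombinations.submodule class_ring (mat_kernel L) V.V"
    proof (unfold_locales)
      show "mat_kernel L \<subseteq> carrier V.V" using mat_kernel_carrier[OF L] by simp
      show "v \<oplus>\<^bsub>V.V\<^esub> w \<in> mat_kernel L" if "v \<in> mat_kernel L" "w \<in> mat_kernel L" for v w
        using mat_kernelD[OF L that(1)] mat_kernelD[OF L that(2)]
        by (intro mat_kernelI[OF L]) (auto simp: mult_add_distrib_mat_vec[OF L])
      show "\<zero>\<^bsub>V.V\<^esub> \<in> mat_kernel L"
        using L by (intro mat_kernelI[OF L]) auto
      show "c \<odot>\<^bsub>V.V\<^esub> v \<in> mat_kernel L" if "c \<in> carrier class_ring" "v \<in> mat_kernel L" for c v
        using mat_kernel_smult[OF L that(2)] by simp
    qed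
    ultimately show ?thesis
      unfolding span[symmetric] by (rule V.span_is_subset)
  qed
  then show ?thesis using ssa proj unfolding n_def by blast
qed

section \<open>Linear combinations, right-hand sides and the projection\<close>

definition vlincomb :: "nat \<Rightarrow> nat \<Rightarrow> real vec \<Rightarrow> (nat \<Rightarrow> real vec) \<Rightarrow> real vec" where
  "vlincomb n m c x = vec n (\<lambda>i. \<Sum>j<m. c $ j * x j $ i)"

lemma vlincomb_carrier [simp]: "vlincomb n m c x \<in> carrier_vec n"
  unfolding vlincomb_def by simp

lemma vlincomb_index: "i < n \<Longrightarrow> vlincomb n m c x $ i = (\<Sum>j<m. c $ j * x j $ i)"
  unfolding vlincomb_def by simp

lemma mult_mat_vlincomb:
  assumes A: "A \<in> carrier_mat k n" and x: "\<And>j. j < m \<Longrightarrow> x j \<in> carrier_vec n"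
  shows "A *\<^sub>v vlincomb n m c x = vlincomb k m c (\<lambda>j. A *\<^sub>v x j)"
proof (rule eq_vecI)
  fix i assume "i < dim_vec (vlincomb k m c (\<lambda>j. A *\<^sub>v x j))"
  then have i: "i < k" by (simp add: vlincomb_def)
  have "(A *\<^sub>v vlincomb n m c x) $ i = (\<Sum>l<n. \<Sum>j<m. c $ j * (A $$ (i, l) * x j $ l))"
    by (subst mult_mat_vec_index[OF A vlincomb_carrier i])
      (auto simp: vlincomb_index sum_distrib_left mult_ac intro!: sum.cong)
  also have "\<dots> = (\<Sum>j<m. c $ j * (\<Sum>l<n. A $$ (i, l) * x j $ l))"
    unfolding sum_distrib_left by (rule sum.swap)
  also have "\<dots> = vlincomb k m c (\<lambda>j. A *\<^sub>v x j) $ i"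
    using i mult_mat_vec_index[OF A x i] by (simp add: vlincomb_index del: index_mult_mat_vec)
  finally show "(A *\<^sub>v vlincomb n m c x) $ i = vlincomb k m c (\<lambda>j. A *\<^sub>v x j) $ i" .
qed (use A in \<open>simp add: vlincomb_def\<close>)

lemma vlincomb_unit:
  assumes "c \<in> carrier_vec m"
  shows "vlincomb m m c (unit_vec m) = c"
proof (rule eq_vecI)
  fix i assume "i < dim_vec c"
  then have i: "i < m" using assms by simp
  have "(\<Sum>j<m. c $ j * unit_vec m j $ i) = (\<Sum>j<m. if j = i then c $ j else 0)"
    using i by (intro sum.cong) (auto simp: unit_vec_def)
  then show "vlincomb m m c (unit_vec m) $ i = c $ i" using i by (simp add: vlincomb_index)
qed (use assms in \<open>simp add: vlincomb_def\<close>)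

lemma nontrivial_vlincomb_zero:
  assumes "n < m"
  shows "\<exists>c. c \<in> carrier_vec m \<and> c \<noteq> 0\<^sub>v m \<and> vlincomb n m c x = 0\<^sub>v n"
proof -
  define W where "W = mat n m (\<lambda>(i, j). x j $ i)"
  have W: "W \<in> carrier_mat n m" unfolding W_def by simp
  obtain c where c: "c \<in> carrier_vec m" "c \<noteq> 0\<^sub>v m" "W *\<^sub>v c = 0\<^sub>v n"
    using wide_mat_kernel[OF W assms] by blast
  have "vlincomb n m c x = W *\<^sub>v c"
  proof (rule eq_vecI)
    fix i assume "i < dim_vec (W *\<^sub>v c)"
    then have i: "i < n" using W by simp
    show "vlincomb n m c x $ i = (W *\<^sub>v c) $ i"
      using i mult_mat_vec_index[OF W c(1) i]
      by (simp add: vlincomb_index W_def mult.commute del: index_mult_mat_vec)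
  qed (use W in \<open>simp add: vlincomb_def\<close>)
  then show ?thesis using c by auto
qed

lemma at_carriers [simp]:
  "A_at S p \<in> carrier_mat (nx S) (nx S)" "B_at S p \<in> carrier_mat (nx S) (nu S)"
  "C_at S p \<in> carrier_mat (ny S) (nx S)" "D_at S p \<in> carrier_mat (ny S) (nu S)"
  unfolding A_at_def B_at_def C_at_def D_at_def by simp_all

lemma rhs_carriers [simp]:
  "state_rhs S p x u \<in> carrier_vec (nx S)" "output_rhs S p x u \<in> carrier_vec (ny S)"
  unfolding state_rhs_def output_rhs_def
  using carrier_matD[OF at_carriers(2), of S p] carrier_matD[OF at_carriers(4), of S p]
  by (auto intro!: carrier_vecI)

lemma rhs_zero_input:
  assumes "x \<in> carrier_vec (nx S)"
  shows "state_rhs S p x (0\<^sub>v (nu S)) = A_at S p *\<^sub>v x" "output_rhs S p x (0\<^sub>v (nu S)) = C_at S p *\<^sub>v x"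
proof -
  have *: "A *\<^sub>v x + B *\<^sub>v 0\<^sub>v m = A *\<^sub>v x" if "A \<in> carrier_mat k n" "B \<in> carrier_mat k m"
    for A B :: "real mat" and k m n
    using that by (intro eq_vecI) auto
  show "state_rhs S p x (0\<^sub>v (nu S)) = A_at S p *\<^sub>v x"
    unfolding state_rhs_def by (rule *[OF at_carriers(1,2)])
  show "output_rhs S p x (0\<^sub>v (nu S)) = C_at S p *\<^sub>v x"
    unfolding output_rhs_def by (rule *[OF at_carriers(3,4)])
qed

lemma projection_intertwines:
  assumes S: "lpv_ssa S" and R: "lpv_ssa R" and pr: "state_projection S R L L'"
  shows "x \<in> carrier_vec (nx S) \<Longrightarrow> L *\<^sub>v (A_at S p *\<^sub>v x) = A_at R p *\<^sub>v (L *\<^sub>v x)"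
    and "u \<in> carrier_vec (nu S) \<Longrightarrow> L *\<^sub>v (B_at S p *\<^sub>v u) = B_at R p *\<^sub>v u"
    and "x \<in> carrier_vec (nx S) \<Longrightarrow> C_at S p *\<^sub>v x = C_at R p *\<^sub>v (L *\<^sub>v x)"
    and "D_at S p = D_at R p"
proof -
  have same: "np R = np S" "nu R = nu S" "ny R = ny S" and L: "L \<in> carrier_mat (nx R) (nx S)"
    and eqs: "\<And>i. i \<le> np S \<Longrightarrow> L * matA S i = matA R i * L" "\<And>i. i \<le> np S \<Longrightarrow> L * matB S i = matB R i"
      "\<And>i. i \<le> np S \<Longrightarrow> matC S i = matC R i * L" "\<And>i. i \<le> np S \<Longrightarrow> matD S i = matD R i"
    using pr unfolding state_projection_def by auto
  have Sc: "\<And>i. i \<le> np S \<Longrightarrow> matA S i \<in> carrier_mat (nx S) (nx S)"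
      "\<And>i. i \<le> np S \<Longrightarrow> matB S i \<in> carrier_mat (nx S) (nu S)"
    and Rc: "\<And>i. i \<le> np S \<Longrightarrow> matA R i \<in> carrier_mat (nx R) (nx R)"
      "\<And>i. i \<le> np S \<Longrightarrow> matC R i \<in> carrier_mat (ny S) (nx R)"
    using S R same unfolding lpv_ssa_def by auto
  show "L *\<^sub>v (A_at S p *\<^sub>v x) = A_at R p *\<^sub>v (L *\<^sub>v x)" if x: "x \<in> carrier_vec (nx S)"
    unfolding A_at_def same
    by (subst affine_mat_mult_left[OF L Sc(1) x], assumption,
        subst affine_mat_mult_right[OF L Rc(1) x], assumption)
      (simp add: eqs(1) cong: affine_mat_cong)
  show "L *\<^sub>v (B_at S p *\<^sub>v u) = B_at R p *\<^sub>v u" if u: "u \<in> carrier_vec (nu S)"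
    unfolding B_at_def same
    by (subst affine_mat_mult_left[OF L Sc(2) u], assumption) (simp add: eqs(2) cong: affine_mat_cong)
  show "C_at S p *\<^sub>v x = C_at R p *\<^sub>v (L *\<^sub>v x)" if x: "x \<in> carrier_vec (nx S)"
    unfolding C_at_def same
    by (subst affine_mat_mult_right[OF L Rc(2) x], assumption) (simp add: eqs(3) cong: affine_mat_cong)
  show "D_at S p = D_at R p"
    unfolding D_at_def same by (rule affine_mat_cong) (rule eqs(4))
qed

lemma projection_rhs:
  assumes S: "lpv_ssa S" and R: "lpv_ssa R" and pr: "state_projection S R L L'"
    and x: "x \<in> carrier_vec (nx S)" and u: "u \<in> carrier_vec (nu S)"
  shows "L *\<^sub>v state_rhs S p x u = state_rhs R p (L *\<^sub>v x) u"
    and "output_rhs S p x u = output_rhs R p (L *\<^sub>v x) u"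
proof -
  have L: "L \<in> carrier_mat (nx R) (nx S)" using pr unfolding state_projection_def by blast
  have "L *\<^sub>v state_rhs S p x u = L *\<^sub>v (A_at S p *\<^sub>v x) + L *\<^sub>v (B_at S p *\<^sub>v u)"
    unfolding state_rhs_def
    by (rule mult_add_distrib_mat_vec[OF L mult_mat_vec_carrier[OF at_carriers(1) x]
          mult_mat_vec_carrier[OF at_carriers(2) u]])
  then show "L *\<^sub>v state_rhs S p x u = state_rhs R p (L *\<^sub>v x) u"
    using projection_intertwines[OF S R pr] x u unfolding state_rhs_def by simp
  show "output_rhs S p x u = output_rhs R p (L *\<^sub>v x) u"
    using projection_intertwines[OF S R pr] x unfolding output_rhs_def by simp
qed

lemma projection_observable:
  assumes S: "lpv_ssa S" and R: "lpv_ssa R" and pr: "state_projection S R L L'"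
    and ker: "mat_kernel (obs_mat S k) \<subseteq> mat_kernel L"
  shows "observable_lpv R"
  unfolding observable_lpv_def
proof (intro allI impI subsetI)
  fix V v
  assume V: "vec_subspace (nx R) V \<and>
    (\<forall>i\<le>np R. \<forall>v\<in>V. matA R i *\<^sub>v v \<in> V \<and> matC R i *\<^sub>v v = 0\<^sub>v (ny R))" and v: "v \<in> V"
  have same: "np R = np S" "ny R = ny S" and L: "L \<in> carrier_mat (nx R) (nx S)"
    and L': "L' \<in> carrier_mat (nx S) (nx R)" and LL': "L * L' = 1\<^sub>m (nx R)"
    and eqs: "\<And>i. i \<le> np S \<Longrightarrow> L * matA S i = matA R i * L"
      "\<And>i. i \<le> np S \<Longrightarrow> matC S i = matC R i * L"
    using pr unfolding state_projection_def by auto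
  have Sc: "\<And>i. i \<le> np S \<Longrightarrow> matA S i \<in> carrier_mat (nx S) (nx S)"
    and Rc: "\<And>i. i \<le> np S \<Longrightarrow> matA R i \<in> carrier_mat (nx R) (nx R)"
      "\<And>i. i \<le> np S \<Longrightarrow> matC R i \<in> carrier_mat (ny S) (nx R)"
    using S R same unfolding lpv_ssa_def by auto
  define W where "W = {x \<in> carrier_vec (nx S). L *\<^sub>v x \<in> V}"
  have "W \<subseteq> mat_kernel (obs_mat S k)"
  proof (rule invariant_in_obs_kernel[OF S])
    fix i x assume i: "i \<le> np S" and "x \<in> W"
    then have x: "x \<in> carrier_vec (nx S)" "L *\<^sub>v x \<in> V" unfolding W_def by auto
    have "L *\<^sub>v (matA S i *\<^sub>v x) = matA R i *\<^sub>v (L *\<^sub>v x)"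
      using assoc_mult_mat_vec[OF L Sc[OF i] x(1)] assoc_mult_mat_vec[OF Rc(1)[OF i] L x(1)] eqs(1)[OF i]
      by simp
    then show "matA S i *\<^sub>v x \<in> W"
      unfolding W_def using V x i same mult_mat_vec_carrier[OF Sc[OF i] x(1)] by simp
    show "matC S i *\<^sub>v x = 0\<^sub>v (ny S)"
      using assoc_mult_mat_vec[OF Rc(2)[OF i] L x(1)] eqs(2)[OF i] V x(2) i same by simp
  qed (auto simp: W_def)
  then have "W \<subseteq> mat_kernel L" using ker by blast
  moreover have vc: "v \<in> carrier_vec (nx R)" using V v unfolding vec_subspace_def by blast
  \<comment> \<open>\<open>L' v\<close> is a preimage of \<open>v\<close>, hence in
    \<open>W\<close>; therefore \<open>L\<close> maps it both to \<open>v\<close> and to 0.\<close>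
  then have "L *\<^sub>v (L' *\<^sub>v v) = v"
    using assoc_mult_mat_vec[OF L L' vc] LL' by simp
  then have "L' *\<^sub>v v \<in> W" unfolding W_def using v vc mult_mat_vec_carrier[OF L' vc] by simp
  ultimately have "L *\<^sub>v (L' *\<^sub>v v) = 0\<^sub>v (nx R)" using mat_kernelD[OF L] by blast
  then show "v \<in> {0\<^sub>v (nx R)}" using \<open>L *\<^sub>v (L' *\<^sub>v v) = v\<close> by simp
qed

section \<open>Discrete time\<close>

lemma mult_mat_zero_vec:
  fixes A :: "real mat"
  assumes "A \<in> carrier_mat m n"
  shows "A *\<^sub>v 0\<^sub>v n = 0\<^sub>v m"
  using assms by (intro eq_vecI) auto

lemma eq_mat_if_eq_on_vec:
  fixes A B :: "real mat"
  assumes A: "A \<in> carrier_mat n m" and B: "B \<in> carrier_mat n m"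
    and eq: "\<And>v. v \<in> carrier_vec m \<Longrightarrow> A *\<^sub>v v = B *\<^sub>v v"
  shows "A = B"
proof (rule eq_matI)
  fix i j assume "i < dim_row B" "j < dim_col B"
  then have ij: "i < n" "j < m" using B by auto
  have *: "(X *\<^sub>v unit_vec m j) $ i = X $$ (i, j)" if X: "X \<in> carrier_mat n m" for X :: "real mat"
  proof -
    have "(X *\<^sub>v unit_vec m j) $ i = (\<Sum>l<m. X $$ (i, l) * unit_vec m j $ l)"
      using ij by (intro mult_mat_vec_index[OF X]) auto
    also have "\<dots> = (\<Sum>l<m. if l = j then X $$ (i, l) else 0)"
      using ij by (intro sum.cong) (auto simp: unit_vec_def)
    finally show ?thesis using ij by simp
  qed
  show "A $$ (i, j) = B $$ (i, j)"
    using *[OF A] *[OF B] eq[of "unit_vec m j"] by simp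
qed (use A B in auto)

lemma invertible_mat_inverse:
  fixes A :: "real mat"
  assumes A: "A \<in> carrier_mat n n" and inv: "invertible_mat A"
  shows "\<exists>B. B \<in> carrier_mat n n \<and> A * B = 1\<^sub>m n \<and> B * A = 1\<^sub>m n"
proof -
  obtain B where AB: "A * B = 1\<^sub>m (dim_row A)" and BA: "B * A = 1\<^sub>m (dim_row B)"
    using inv unfolding invertible_mat_def inverts_mat_def by blast
  have "dim_col B = n" using arg_cong[OF AB, of dim_col] A by simp
  moreover have "dim_row B = n" using arg_cong[OF BA, of dim_col] A by simp
  ultimately have "B \<in> carrier_mat n n" by (intro carrier_matI)
  then show ?thesis using AB BA A by (intro exI[of _ B]) auto
qed

lemma invertible_mat_kernel:
  fixes A :: "real mat"
  assumes A: "A \<in> carrier_mat n n" and inv: "invertible_mat A" and w: "w \<in> carrier_vec n"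
    and Aw: "A *\<^sub>v w = 0\<^sub>v n"
  shows "w = 0\<^sub>v n"
proof -
  obtain B where B: "B \<in> carrier_mat n n" "B * A = 1\<^sub>m n"
    using invertible_mat_inverse[OF A inv] by blast
  have "B * A *\<^sub>v w = B *\<^sub>v 0\<^sub>v n"
    using assoc_mult_mat_vec[OF B(1) A w] Aw by simp
  then show ?thesis using B w by auto
qed

text \<open>If \<open>B\<close> inverts \<open>A(p)\<close>, then \<open>L B L'\<close> inverts the
  reduced matrix: moving \<open>L\<close> to the left past the reduced matrix gives
  \<open>L A(p) B L' = L L' = 1\<close>. A right inverse of a square matrix is two-sided.\<close>

lemma projection_dt_regular:
  assumes S: "lpv_ssa S" and R: "lpv_ssa R" and pr: "state_projection S R L L'"
    and reg: "dt_regular S"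
  shows "dt_regular R"
proof -
  have same: "np R = np S" "par R = par S" and L: "L \<in> carrier_mat (nx R) (nx S)"
    and L': "L' \<in> carrier_mat (nx S) (nx R)" and LL': "L * L' = 1\<^sub>m (nx R)"
    using pr unfolding state_projection_def by auto
  have "invertible_mat (A_at R p)" if p: "p \<in> par S" for p
  proof -
    define A AR where "A = A_at S p" and "AR = A_at R p"
    have A: "A \<in> carrier_mat (nx S) (nx S)" and AR: "AR \<in> carrier_mat (nx R) (nx R)"
      unfolding A_def AR_def by simp_all
    have "invertible_mat A" using reg p unfolding dt_regular_def A_def by blast
    then obtain B where B: "B \<in> carrier_mat (nx S) (nx S)" and AB: "A * B = 1\<^sub>m (nx S)"
      using invertible_mat_inverse[OF A] by blast
    have "L * A = AR * L"
    proof (rule eq_mat_if_eq_on_vec)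
      fix v :: "real vec" assume v: "v \<in> carrier_vec (nx S)"
      show "L * A *\<^sub>v v = AR * L *\<^sub>v v"
        using assoc_mult_mat_vec[OF L A v] assoc_mult_mat_vec[OF AR L v]
          projection_intertwines(1)[OF S R pr v, of p] unfolding A_def AR_def by simp
    qed (use L A AR in auto)
    then have "AR * (L * (B * L')) = L * A * (B * L')"
      using assoc_mult_mat[OF AR L mult_carrier_mat[OF B L']] by simp
    also have "\<dots> = L * (A * (B * L'))" by (rule assoc_mult_mat[OF L A mult_carrier_mat[OF B L']])
    also have "A * (B * L') = A * B * L'" by (rule assoc_mult_mat[OF A B L', symmetric])
    also have "\<dots> = L'" using AB A L' by simp
    finally have right: "AR * (L * (B * L')) = 1\<^sub>m (nx R)" using LL' by simp
    have C: "L * (B * L') \<in> carrier_mat (nx R) (nx R)"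
      by (intro mult_carrier_mat[OF L] mult_carrier_mat[OF B L'])
    have "L * (B * L') * AR = 1\<^sub>m (nx R)"
      by (rule mat_mult_left_right_inverse[OF AR C right])
    then show ?thesis
      using right carrier_matD[OF AR] carrier_matD[OF C]
      unfolding invertible_mat_def inverts_mat_def AR_def[symmetric]
      by (intro conjI exI[of _ "L * (B * L')"]) simp_all
  qed
  then show ?thesis using reg same unfolding dt_regular_def by simp
qed

lemma dt_state_exists:
  fixes p u :: "nat \<Rightarrow> real vec"
  assumes "x0 \<in> carrier_vec (nx S)"
  shows "\<exists>x. x 0 = x0 \<and> (\<forall>t. x (t + 1) = state_rhs S (p t) (x t) (u t)) \<and> x \<in> UNIV \<rightarrow> carrier_vec (nx S)"
proof -
  define x where "x = rec_nat x0 (\<lambda>t y. state_rhs S (p t) y (u t))"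
  have "x 0 = x0" "\<And>t. x (t + 1) = state_rhs S (p t) (x t) (u t)" unfolding x_def by simp_all
  moreover have "x t \<in> carrier_vec (nx S)" for t
    unfolding x_def by (cases t) (simp_all add: assms)
  ultimately show ?thesis by blast
qed

lemma projection_dt_behavior:
  assumes S: "lpv_ssa S" and R: "lpv_ssa R" and pr: "state_projection S R L L'"
  shows "dt_behavior R = dt_behavior S"
proof -
  have same: "nu R = nu S" "ny R = ny S" "par R = par S" and L: "L \<in> carrier_mat (nx R) (nx S)"
    and L': "L' \<in> carrier_mat (nx S) (nx R)" and LL': "L * L' = 1\<^sub>m (nx R)"
    using pr unfolding state_projection_def by auto
  note rhs = projection_rhs[OF S R pr]
  have "\<exists>x. dt_solution S x y u p" if sol: "dt_solution R z y u p" for z y u p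
  proof -
    have z: "z t \<in> carrier_vec (nx R)" and u: "u t \<in> carrier_vec (nu S)" for t
      using sol same unfolding dt_solution_def by auto
    obtain x where x0: "x 0 = L' *\<^sub>v z 0" and x: "\<And>t. x (t + 1) = state_rhs S (p t) (x t) (u t)"
      and xc: "x \<in> UNIV \<rightarrow> carrier_vec (nx S)"
      using dt_state_exists[OF mult_mat_vec_carrier[OF L' z]] by blast
    have xc': "x t \<in> carrier_vec (nx S)" for t using xc by auto
    have "L *\<^sub>v x t = z t" for t
    proof (induction t)
      case 0
      then show ?case using x0 assoc_mult_mat_vec[OF L L' z[of 0]] LL' z[of 0] by simp
    next
      case (Suc t)
      have "L *\<^sub>v x (t + 1) = state_rhs R (p t) (L *\<^sub>v x t) (u t)"
        unfolding x by (rule rhs(1)[OF xc' u])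
      also have "\<dots> = z (t + 1)" using Suc sol unfolding dt_solution_def by simp
      finally show ?case by simp
    qed
    then have "output_rhs S (p t) (x t) (u t) = y t" for t
      using rhs(2)[OF xc' u] sol unfolding dt_solution_def by simp
    then show ?thesis using sol x xc same unfolding dt_solution_def by auto
  qed
  moreover have "dt_solution R (\<lambda>t. L *\<^sub>v x t) y u p" if sol: "dt_solution S x y u p" for x y u p
  proof -
    have x: "x t \<in> carrier_vec (nx S)" and u: "u t \<in> carrier_vec (nu S)" for t
      using sol unfolding dt_solution_def by auto
    show ?thesis
      using sol same rhs[OF x u] mult_mat_vec_carrier[OF L x] unfolding dt_solution_def
      by (simp del: add_Suc_right)
  qed
  ultimately show ?thesis unfolding dt_behavior_def by blast
qed

section \<open>Scheduling words as zero-input experiments\<close>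

fun dt_silent :: "lpv \<Rightarrow> real vec list \<Rightarrow> real vec \<Rightarrow> bool" where
  "dt_silent S [] w \<longleftrightarrow> True"
| "dt_silent S (q # qs) w \<longleftrightarrow> C_at S q *\<^sub>v w = 0\<^sub>v (ny S) \<and> dt_silent S qs (A_at S q *\<^sub>v w)"

definition dt_flow :: "lpv \<Rightarrow> real vec list \<Rightarrow> real vec \<Rightarrow> real vec" where
  "dt_flow S qs w = fold (\<lambda>q w. A_at S q *\<^sub>v w) qs w"

lemma dt_silent_append:
  "dt_silent S (qs @ rs) w \<longleftrightarrow> dt_silent S qs w \<and> dt_silent S rs (dt_flow S qs w)"
  by (induction qs arbitrary: w) (simp_all add: dt_flow_def)

lemma dt_silent_add:
  assumes "v \<in> carrier_vec (nx S)" "w \<in> carrier_vec (nx S)" "dt_silent S qs v" "dt_silent S qs w"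
  shows "dt_silent S qs (v + w)"
  using assms
proof (induction qs arbitrary: v w)
  case (Cons q qs)
  have "A_at S q *\<^sub>v v \<in> carrier_vec (nx S)" "A_at S q *\<^sub>v w \<in> carrier_vec (nx S)"
    using Cons.prems by (auto intro: mult_mat_vec_carrier[OF at_carriers(1)])
  then show ?case
    using Cons mult_add_distrib_mat_vec[OF at_carriers(1) Cons.prems(1,2), of q]
      mult_add_distrib_mat_vec[OF at_carriers(3) Cons.prems(1,2), of q] by simp
qed simp

lemma dt_silent_smult:
  assumes "v \<in> carrier_vec (nx S)" "dt_silent S qs v"
  shows "dt_silent S qs (c \<cdot>\<^sub>v v)"
  using assms
proof (induction qs arbitrary: v)
  case (Cons q qs)
  have "A_at S q *\<^sub>v v \<in> carrier_vec (nx S)"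
    using Cons.prems by (auto intro: mult_mat_vec_carrier[OF at_carriers(1)])
  moreover have "c \<cdot>\<^sub>v 0\<^sub>v (ny S) = (0\<^sub>v (ny S) :: real vec)" by (intro eq_vecI) auto
  ultimately show ?case
    using Cons mult_mat_vec[OF at_carriers(1) Cons.prems(1), of q c]
      mult_mat_vec[OF at_carriers(3) Cons.prems(1), of q c] by simp
qed simp

lemma dt_silent_zero: "dt_silent S qs (0\<^sub>v (nx S))"
proof (induction qs)
  case (Cons q qs)
  have "A_at S q *\<^sub>v 0\<^sub>v (nx S) = 0\<^sub>v (nx S)" "C_at S q *\<^sub>v 0\<^sub>v (nx S) = 0\<^sub>v (ny S)"
    by (rule mult_mat_zero_vec[OF at_carriers(1)] mult_mat_zero_vec[OF at_carriers(3)])+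
  then show ?case using Cons by simp
qed simp

lemma dt_silentI:
  assumes "\<And>t. t < length qs \<Longrightarrow> z (Suc t) = A_at S (qs ! t) *\<^sub>v z t"
    and "\<And>t. t < length qs \<Longrightarrow> C_at S (qs ! t) *\<^sub>v z t = 0\<^sub>v (ny S)"
  shows "dt_silent S qs (z 0)"
  using assms
proof (induction qs arbitrary: z)
  case (Cons q qs)
  have "dt_silent S qs (z (Suc 0))"
    using Cons.prems(1)[of "Suc _"] Cons.prems(2)[of "Suc _"]
    by (intro Cons.IH[of "\<lambda>t. z (Suc t)"]) auto
  then show ?case using Cons.prems(1)[of 0] Cons.prems(2)[of 0] by simp
qed simp

lemma dt_flow_carrier:
  "w \<in> carrier_vec (nx S) \<Longrightarrow> dt_flow S qs w \<in> carrier_vec (nx S)"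
  by (induction qs arbitrary: w)
    (simp_all add: dt_flow_def mult_mat_vec_carrier[OF at_carriers(1)])

lemma dt_flow_inj:
  assumes inv: "\<And>q. q \<in> set qs \<Longrightarrow> invertible_mat (A_at S q)"
    and "w \<in> carrier_vec (nx S)" "dt_flow S qs w = 0\<^sub>v (nx S)"
  shows "w = 0\<^sub>v (nx S)"
  using assms
proof (induction qs arbitrary: w)
  case (Cons q qs)
  have Aw: "A_at S q *\<^sub>v w \<in> carrier_vec (nx S)"
    by (rule mult_mat_vec_carrier[OF at_carriers(1) Cons.prems(2)])
  have "A_at S q *\<^sub>v w = 0\<^sub>v (nx S)"
    by (rule Cons.IH[OF _ Aw]) (use Cons.prems in \<open>auto simp: dt_flow_def\<close>)
  then show ?case
    by (rule invertible_mat_kernel[OF at_carriers(1) _ Cons.prems(2), rotated]) (use Cons.prems(1) in simp)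
qed (simp add: dt_flow_def)

lemma vec_interior_subset: "vec_interior n P \<subseteq> P"
  unfolding vec_interior_def by (auto simp: L2_set_def)

text \<open>Experiments are words over the scheduling set, concatenated by \<open>@\<close>; the
  transition along a word is injective as a product of invertible matrices.\<close>

lemma dt_separating_word:
  assumes R: "lpv_ssa R" and obs: "observable_lpv R" and reg: "dt_regular R"
  shows "\<exists>qs. set qs \<subseteq> par R \<and>
    (\<forall>w\<in>carrier_vec (nx R). dt_silent R qs w \<longrightarrow> w = 0\<^sub>v (nx R))"
proof -
  define N where "N qs = {w \<in> carrier_vec (nx R). dt_silent R qs w}" for qs
  have sub: "vec_subspace (nx R) (N qs)" for qs
    unfolding vec_subspace_def N_def using dt_silent_zero dt_silent_add dt_silent_smult by auto
  have "\<exists>qs\<in>{qs. set qs \<subseteq> par R}. N qs \<subseteq> {0\<^sub>v (nx R)}"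
  proof (rule separating_experiment[where F = "dt_flow R" and ?e0.0 = "[]"])
    fix qs rs assume "qs \<in> {qs. set qs \<subseteq> par R}" "rs \<in> {qs. set qs \<subseteq> par R}"
    then show "\<exists>d\<in>{qs. set qs \<subseteq> par R}. N d = {w \<in> N qs. dt_flow R qs w \<in> N rs}"
      by (intro bexI[of _ "qs @ rs"]) (auto simp: N_def dt_silent_append dt_flow_carrier)
  next
    fix qs w assume qs: "qs \<in> {qs. set qs \<subseteq> par R}" and w: "w \<in> carrier_vec (nx R)" "dt_flow R qs w
        = 0\<^sub>v (nx R)"
    show "w = 0\<^sub>v (nx R)"
      by (rule dt_flow_inj[OF _ w]) (use qs reg in \<open>auto simp: dt_regular_def\<close>)
  next
    fix w assume wc: "w \<in> carrier_vec (nx R)" and w: "\<And>qs. qs \<in> {qs. set qs \<subseteq> par R} \<Longrightarrow> w \<in> N qs"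
    \<comment> \<open>Prefixing a letter \<open>q\<close> to an arbitrary word shows that
      \<open>V\<close> is invariant under \<open>A(q)\<close>; the one-letter word shows that
      \<open>C(q)\<close> annihilates \<open>V\<close>.\<close>
    define V where "V = {w \<in> carrier_vec (nx R). \<forall>qs. set qs \<subseteq> par R \<longrightarrow> dt_silent R qs w}"
    have "V \<subseteq> {0\<^sub>v (nx R)}"
    proof (rule observable_lpv_par[OF R obs])
      show "vec_interior (np R) (par R) \<noteq> {}" using reg unfolding dt_regular_def by blast
      show "vec_subspace (nx R) V"
        unfolding vec_subspace_def V_def using dt_silent_zero dt_silent_add dt_silent_smult by auto
      fix q v assume q: "q \<in> par R" and v: "v \<in> V"
      have silent: "dt_silent R qs v" if "set qs \<subseteq> par R" for qs
        using v that unfolding V_def by blast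
      show "A_at R q *\<^sub>v v \<in> V"
        unfolding V_def
      proof (intro CollectI conjI allI impI)
        show "A_at R q *\<^sub>v v \<in> carrier_vec (nx R)"
          using v by (intro mult_mat_vec_carrier[OF at_carriers(1)]) (simp add: V_def)
        fix qs assume "set qs \<subseteq> par R"
        then have "dt_silent R (q # qs) v" using q by (intro silent) simp
        then show "dt_silent R qs (A_at R q *\<^sub>v v)" by simp
      qed
      have "dt_silent R [q] v" using q by (intro silent) simp
      then show "C_at R q *\<^sub>v v = 0\<^sub>v (ny R)" by simp
    qed
    then show "w = 0\<^sub>v (nx R)" using w wc unfolding V_def N_def by auto
  qed (use sub dt_flow_carrier in auto)
  then show ?thesis unfolding N_def by blast
qed

text \<open>The smaller system \<open>S\<close> must reproduce the output from each unit state of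
  \<open>R\<close> by some trajectory. More initial states than dimensions are linearly dependent,
  and the same combination of unit states of \<open>R\<close> is a nonzero state with zero output
  along the separating word.\<close>

lemma dt_observable_minimal:
  assumes R: "lpv_ssa R" and obs: "observable_lpv R" and reg: "dt_regular R"
  shows "dt_minimal R"
  unfolding dt_minimal_def
proof (intro conjI R allI impI)
  fix S assume S: "lpv_ssa S \<and> dt_behavior S = dt_behavior R"
  show "nx R \<le> nx S"
  proof (rule ccontr)
    assume "\<not> nx R \<le> nx S"
    then have less: "nx S < nx R" by simp
    obtain qs where qs: "set qs \<subseteq> par R"
      and sep: "\<And>w. w \<in> carrier_vec (nx R) \<Longrightarrow> dt_silent R qs w \<Longrightarrow> w = 0\<^sub>v (nx R)"
      using dt_separating_word[OF R obs reg] by blast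
    obtain q0 where q0: "q0 \<in> par R"
      using reg vec_interior_subset unfolding dt_regular_def by blast
    \<comment> \<open>Behaviors consist of infinite signals, so the separating word is continued by
      an arbitrary scheduling value.\<close>
    define p where "p t = (if t < length qs then qs ! t else q0)" for t
    have p: "p t \<in> par R" for t unfolding p_def using qs q0 by (auto dest: nth_mem)
    define u :: "nat \<Rightarrow> real vec" where "u = (\<lambda>_. 0\<^sub>v (nu R))"
    have "\<exists>z x. z 0 = unit_vec (nx R) j \<and> (\<forall>t. z t \<in> carrier_vec (nx R)) \<and>
        (\<forall>t. z (Suc t) = A_at R (p t) *\<^sub>v z t) \<and>
        (\<forall>t. x t \<in> carrier_vec (nx S)) \<and> (\<forall>t. x (Suc t) = A_at S (p t) *\<^sub>v x t) \<and>
        (\<forall>t. C_at R (p t) *\<^sub>v z t = C_at S (p t) *\<^sub>v x t)" for j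
    proof -
      obtain z where z0: "z 0 = unit_vec (nx R) j" and z: "\<And>t. z (t + 1) = state_rhs R (p t) (z t) (u t)"
        and zc: "z \<in> UNIV \<rightarrow> carrier_vec (nx R)"
        using dt_state_exists[OF unit_vec_carrier, of R j p u] by blast
      have zc': "z t \<in> carrier_vec (nx R)" for t using zc by auto
      define y where "y t = output_rhs R (p t) (z t) (u t)" for t
      have "dt_solution R z y u p"
        using z zc p unfolding dt_solution_def y_def u_def by auto
      then have "(y, u, p) \<in> dt_behavior S" using S unfolding dt_behavior_def by blast
      then obtain x where x: "dt_solution S x y u p" unfolding dt_behavior_def by blast
      have "u 0 \<in> carrier_vec (nu S)" using x unfolding dt_solution_def by blast
      \<comment> \<open>The common input signal reveals the input dimension of \<open>S\<close>; the
        zero vector carries its dimension.\<close>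
      then have nu: "nu S = nu R" unfolding u_def by (metis carrier_vecD index_zero_vec(2))
      have xc: "x t \<in> carrier_vec (nx S)" for t using x unfolding dt_solution_def by blast
      have zS: "z (Suc t) = A_at R (p t) *\<^sub>v z t" for t
        using z[of t] rhs_zero_input(1)[OF zc'] by (simp add: u_def)
      have xS: "x (Suc t) = A_at S (p t) *\<^sub>v x t" for t
        using x rhs_zero_input(1)[OF xc] unfolding dt_solution_def u_def nu[symmetric] by simp
      have yx: "y t = C_at S (p t) *\<^sub>v x t" for t
        using x rhs_zero_input(2)[OF xc] unfolding dt_solution_def u_def nu[symmetric] by simp
      have yz: "y t = C_at R (p t) *\<^sub>v z t" for t
        unfolding y_def u_def by (rule rhs_zero_input(2)[OF zc'])
      have "C_at R (p t) *\<^sub>v z t = C_at S (p t) *\<^sub>v x t" for t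
        using yx yz by metis
      then show ?thesis using z0 zc' zS xc xS by blast
    qed
    then obtain z x where z0: "\<And>j. z j 0 = unit_vec (nx R) j"
      and zc: "\<And>j t. z j t \<in> carrier_vec (nx R)"
      and z: "\<And>j t. z j (Suc t) = A_at R (p t) *\<^sub>v z j t"
      and xc: "\<And>j t. x j t \<in> carrier_vec (nx S)"
      and x: "\<And>j t. x j (Suc t) = A_at S (p t) *\<^sub>v x j t"
      and out: "\<And>j t. C_at R (p t) *\<^sub>v z j t = C_at S (p t) *\<^sub>v x j t"
      by metis
    obtain c where c: "c \<in> carrier_vec (nx R)" "c \<noteq> 0\<^sub>v (nx R)"
      and c0: "vlincomb (nx S) (nx R) c (\<lambda>j. x j 0) = 0\<^sub>v (nx S)"
      using nontrivial_vlincomb_zero[OF less] by blast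
    define Z X where "Z t = vlincomb (nx R) (nx R) c (\<lambda>j. z j t)"
      and "X t = vlincomb (nx S) (nx R) c (\<lambda>j. x j t)" for t
    \<comment> \<open>The same combination of the trajectories of \<open>S\<close> is a trajectory
      that starts at 0, so it stays at 0.\<close>
    have X: "X t = 0\<^sub>v (nx S)" for t
    proof (induction t)
      case (Suc t)
      have "X (Suc t) = A_at S (p t) *\<^sub>v X t"
        unfolding X_def x by (rule mult_mat_vlincomb[OF at_carriers(1) xc, symmetric])
      then show ?case using Suc mult_mat_zero_vec[OF at_carriers(1)] by simp
    qed (simp add: X_def c0)
    have Z: "Z (Suc t) = A_at R (p t) *\<^sub>v Z t" for t
      unfolding Z_def z by (rule mult_mat_vlincomb[OF at_carriers(1) zc, symmetric])
    have "C_at R (p t) *\<^sub>v Z t = vlincomb (ny R) (nx R) c (\<lambda>j. C_at S (p t) *\<^sub>v x j t)" for t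
      unfolding Z_def using mult_mat_vlincomb[OF at_carriers(3) zc] out by simp
    moreover have "ny S = ny R"
      using arg_cong[OF out[of 0 0], of dim_vec] carrier_matD(1)[OF at_carriers(3)] by simp
    moreover have "vlincomb (ny S) (nx R) c (\<lambda>j. C_at S (p t) *\<^sub>v x j t) = C_at S (p t) *\<^sub>v X t" for t
      unfolding X_def by (rule mult_mat_vlincomb[OF at_carriers(3) xc, symmetric])
    moreover have "C_at S (p t) *\<^sub>v 0\<^sub>v (nx S) = 0\<^sub>v (ny S)" for t
      by (rule mult_mat_zero_vec[OF at_carriers(3)])
    ultimately have "C_at R (p t) *\<^sub>v Z t = 0\<^sub>v (ny R)" for t
      using X by simp
    then have "dt_silent R qs (Z 0)"
      using Z by (intro dt_silentI) (simp_all add: p_def split: if_splits, metis+)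
    moreover have "Z 0 = c" unfolding Z_def z0 by (rule vlincomb_unit[OF c(1)])
    ultimately show False using sep[OF c(1)] c(2) by simp
  qed
qed

section \<open>Continuous time\<close>

lemma is_primitive_cong:
  assumes "\<And>t. t \<in> {0..b} \<Longrightarrow> g t = g' t" "\<And>t. t \<in> {0..b} \<Longrightarrow> f t = f' t"
  shows "is_primitive b g f \<longleftrightarrow> is_primitive b g' f'"
  unfolding is_primitive_def
proof (rule ball_cong[OF refl])
  fix t assume t: "t \<in> {0..b}"
  have "(g has_integral f t - f 0) {0..t} \<longleftrightarrow> (g' has_integral f t - f 0) {0..t}"
    by (rule has_integral_cong) (use assms t in auto)
  moreover have "f t - f 0 = f' t - f' 0" using assms(2)[OF t] assms(2)[of 0] t by simp
  ultimately show "(g has_integral f t - f 0) {0..t} = (g' has_integral f' t - f' 0) {0..t}" by simp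
qed

lemma is_primitive_transform:
  assumes "is_primitive b g f" "\<And>t. t \<in> {0..b} \<Longrightarrow> g' t = g t" "\<And>t. t \<in> {0..b} \<Longrightarrow> f' t = f t"
  shows "is_primitive b g' f'"
  using is_primitive_cong[of b g' g f' f] assms by simp

text \<open>One point does not change the integral. This matters at the junction of a concatenated
  signal, which agrees with its first piece only before the junction.\<close>

lemma is_primitive_spike:
  assumes "is_primitive b g f" "\<And>t. 0 \<le> t \<Longrightarrow> t < b \<Longrightarrow> g' t = g t"
  shows "is_primitive b g' f"
  unfolding is_primitive_def
proof
  fix t assume t: "t \<in> {0..b}"
  have "(g has_integral f t - f 0) {0..t}" using assms(1) t unfolding is_primitive_def by blast
  then show "(g' has_integral f t - f 0) {0..t}"
    by (rule has_integral_spike_finite[of "{b}", rotated 2]) (use assms(2) t in auto)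
qed

lemma is_primitive_sum:
  assumes "finite J" "\<And>j. j \<in> J \<Longrightarrow> is_primitive b (g j) (f j)"
  shows "is_primitive b (\<lambda>t. \<Sum>j\<in>J. c j * g j t) (\<lambda>t. \<Sum>j\<in>J. c j * f j t)"
  unfolding is_primitive_def
proof
  fix t assume t: "t \<in> {0..b}"
  have "((\<lambda>t. \<Sum>j\<in>J. c j * g j t) has_integral (\<Sum>j\<in>J. c j * (f j t - f j 0))) {0..t}"
    by (intro has_integral_sum has_integral_mult_right assms(1))
      (use assms(2) t in \<open>auto simp: is_primitive_def\<close>)
  then show "((\<lambda>t. \<Sum>j\<in>J. c j * g j t) has_integral (\<Sum>j\<in>J. c j * f j t) - (\<Sum>j\<in>J. c j * f j 0)) {0..t}"
    by (simp add: right_diff_distrib sum_subtractf)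
qed

lemma is_primitive_diff:
  assumes "is_primitive b g f" "is_primitive b g' f'"
  shows "is_primitive b (\<lambda>t. g t - g' t) (\<lambda>t. f t - f' t)"
  unfolding is_primitive_def
proof
  fix t assume t: "t \<in> {0..b}"
  have "((\<lambda>t. g t - g' t) has_integral (f t - f 0) - (f' t - f' 0)) {0..t}"
    by (intro has_integral_diff) (use assms t in \<open>auto simp: is_primitive_def\<close>)
  then show "((\<lambda>t. g t - g' t) has_integral (f t - f' t) - (f 0 - f' 0)) {0..t}"
    by (simp add: algebra_simps)
qed

lemma is_primitive_shift:
  assumes f: "is_primitive (T + b) g f" and T: "0 \<le> T"
  shows "is_primitive b (\<lambda>s. g (T + s)) (\<lambda>s. f (T + s))"
  unfolding is_primitive_def
proof
  fix t assume t: "t \<in> {0..b}"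
  have "(g has_integral f (T + t) - f T) {T..T + t}"
    by (rule is_primitive_interval[OF f]) (use T t in auto)
  then have "(g has_integral f (T + t) - f T) (cbox T (T + t))" by simp
  from has_integral_affinity[OF this, of 1 T]
  have "((\<lambda>s. g (s + T)) has_integral f (T + t) - f T) ((\<lambda>x. x - T) ` {T..T + t})" by simp
  also have "(\<lambda>x. x - T) ` {T..T + t} = {0..t}" by simp
  finally show "((\<lambda>s. g (T + s)) has_integral f (T + t) - f (T + 0)) {0..t}"
    by (simp add: add.commute)
qed

text \<open>The regularity of \<open>pc_signals\<close> without the convention on negative times, so
  that constant and concatenated signals on the whole line qualify.\<close>

definition pc_vec :: "nat \<Rightarrow> (real \<Rightarrow> real vec) \<Rightarrow> bool" where
  "pc_vec n v \<longleftrightarrow> (\<forall>t\<ge>0. v t \<in> carrier_vec n) \<and> (\<forall>i<n. piecewise_continuous (\<lambda>t. v t $ i))"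

lemma pc_signals_pc_vec: "v \<in> pc_signals n V \<Longrightarrow> V \<subseteq> carrier_vec n \<Longrightarrow> pc_vec n v"
  unfolding pc_signals_def pc_vec_def by (auto dest: PiE_mem)

lemma piecewise_continuous_affine_mat:
  assumes p: "pc_vec n p" and ij: "i < nr" "j < nc"
  shows "piecewise_continuous (\<lambda>t. affine_mat n nr nc M (p t) $$ (i, j))"
  unfolding affine_mat_index[OF ij]
  by (intro piecewise_continuous_add piecewise_continuous_sum piecewise_continuous_mult
      piecewise_continuous_const) (use p in \<open>auto simp: pc_vec_def\<close>)

lemma pc_vec_affine_mult:
  assumes p: "pc_vec n p" and v: "pc_vec nc v"
  shows "pc_vec nr (\<lambda>t. affine_mat n nr nc M (p t) *\<^sub>v v t)"
  unfolding pc_vec_def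
proof (intro conjI allI impI)
  fix t :: real assume "0 \<le> t"
  then show "affine_mat n nr nc M (p t) *\<^sub>v v t \<in> carrier_vec nr"
    using v by (intro mult_mat_vec_carrier[OF affine_mat_carrier]) (auto simp: pc_vec_def)
next
  fix i assume i: "i < nr"
  show "piecewise_continuous (\<lambda>t. (affine_mat n nr nc M (p t) *\<^sub>v v t) $ i)"
  proof (rule piecewise_continuous_cong)
    show "piecewise_continuous (\<lambda>t. \<Sum>j<nc. affine_mat n nr nc M (p t) $$ (i, j) * v t $ j)"
      by (intro piecewise_continuous_sum piecewise_continuous_mult piecewise_continuous_affine_mat[OF p i])
        (use v in \<open>auto simp: pc_vec_def\<close>)
    fix t :: real assume "0 \<le> t"
    then show "(affine_mat n nr nc M (p t) *\<^sub>v v t) $ i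
        = (\<Sum>j<nc. affine_mat n nr nc M (p t) $$ (i, j) * v t $ j)"
      using v i by (intro mult_mat_vec_index[OF affine_mat_carrier]) (auto simp: pc_vec_def)
  qed
qed

lemma pc_vec_add:
  assumes "pc_vec n v" "pc_vec n w"
  shows "pc_vec n (\<lambda>t. v t + w t)"
  unfolding pc_vec_def
proof (intro conjI allI impI)
  fix i assume i: "i < n"
  show "piecewise_continuous (\<lambda>t. (v t + w t) $ i)"
  proof (rule piecewise_continuous_cong)
    show "piecewise_continuous (\<lambda>t. v t $ i + w t $ i)"
      using assms i by (intro piecewise_continuous_add) (auto simp: pc_vec_def)
    fix t :: real assume "0 \<le> t"
    then have "w t \<in> carrier_vec n" using assms(2) unfolding pc_vec_def by blast
    then show "(v t + w t) $ i = v t $ i + w t $ i" using i by auto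
  qed
qed (use assms in \<open>auto simp: pc_vec_def\<close>)

lemma pc_vec_rhs:
  assumes "pc_vec (np S) p" "pc_vec (nx S) x" "pc_vec (nu S) u"
  shows "pc_vec (nx S) (\<lambda>t. state_rhs S (p t) (x t) (u t))"
    and "pc_vec (ny S) (\<lambda>t. output_rhs S (p t) (x t) (u t))"
  unfolding state_rhs_def output_rhs_def A_at_def B_at_def C_at_def D_at_def
  by (intro pc_vec_add pc_vec_affine_mult assms)+

text \<open>
  The state equation in integral form: unlike the almost-everywhere form it passes directly to
  linear images, restrictions and time shifts.
\<close>

definition ct_state :: "lpv \<Rightarrow> (real \<Rightarrow> real vec) \<Rightarrow> (real \<Rightarrow> real vec) \<Rightarrow> (real \<Rightarrow> real vec) \<Rightarrow> bool" where
  "ct_state S x u p \<longleftrightarrow> x \<in> {0..} \<rightarrow>\<^sub>E carrier_vec (nx S) \<and>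
     (\<forall>i<nx S. \<forall>b. is_primitive b (\<lambda>t. state_rhs S (p t) (x t) (u t) $ i) (\<lambda>t. x t $ i))"

lemma pc_vec_of_continuous:
  assumes "\<And>t. 0 \<le> t \<Longrightarrow> x t \<in> carrier_vec n" "\<And>i b. i < n \<Longrightarrow> 0 \<le> b \<Longrightarrow> continuous_on {0..b} (\<lambda>t. x t $ i)"
  shows "pc_vec n x"
  unfolding pc_vec_def using assms
  by (auto intro!: continuous_imp_piecewise_continuous continuous_on_atLeastI)

lemma ct_state_pc_vec: "ct_state S x u p \<Longrightarrow> pc_vec (nx S) x"
  unfolding ct_state_def
  by (intro pc_vec_of_continuous) (auto dest: PiE_mem intro: is_primitive_continuous)

text \<open>The right-hand side is piecewise continuous once the state is continuous. Its primitives
  are Lipschitz on compact intervals and differentiable at its continuity points; conversely an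
  absolutely continuous function with this derivative almost everywhere is a primitive.\<close>

lemma ct_state_iff:
  assumes u: "pc_vec (nu S) u" and p: "pc_vec (np S) p"
  shows "ct_state S x u p \<longleftrightarrow> x \<in> ac_signals (nx S) \<and>
    (AE t in lborel. 0 \<le> t \<longrightarrow> (\<forall>i<nx S. ((\<lambda>s. x s $ i) has_real_derivative
       state_rhs S (p t) (x t) (u t) $ i) (at t within {0..})))" (is "_ \<longleftrightarrow> _ \<and> ?AE")
proof
  assume st: "ct_state S x u p"
  have pc: "pc_vec (nx S) (\<lambda>t. state_rhs S (p t) (x t) (u t))"
    by (rule pc_vec_rhs(1)[OF p ct_state_pc_vec[OF st] u])
  have "AE t in lborel. 0 \<le> t \<longrightarrow> ((\<lambda>s. x s $ i) has_real_derivative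
       state_rhs S (p t) (x t) (u t) $ i) (at t within {0..})" if "i < nx S" for i
    using pc st that unfolding pc_vec_def ct_state_def
    by (intro is_primitive_imp_AE_derivative) auto
  then have "AE t in lborel. \<forall>i\<in>{..<nx S}. 0 \<le> t \<longrightarrow> ((\<lambda>s. x s $ i) has_real_derivative
       state_rhs S (p t) (x t) (u t) $ i) (at t within {0..})"
    by (intro AE_finite_allI) auto
  then have "?AE"
    by eventually_elim auto
  moreover have "x \<in> ac_signals (nx S)"
    using pc st unfolding ac_signals_def ct_state_def pc_vec_def
    by (auto intro!: is_primitive_imp_abs_continuous)
  ultimately show "x \<in> ac_signals (nx S) \<and> ?AE" by blast
next
  assume *: "x \<in> ac_signals (nx S) \<and> ?AE"
  then have ac: "\<And>i b. i < nx S \<Longrightarrow> 0 \<le> b \<Longrightarrow> abs_continuous_on_interval 0 b (\<lambda>t. x t $ i)"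
    and xP: "x \<in> {0..} \<rightarrow>\<^sub>E carrier_vec (nx S)"
    unfolding ac_signals_def by auto
  have "pc_vec (nx S) x"
    using xP ac by (intro pc_vec_of_continuous abs_continuous_imp_continuous_on) (auto dest: PiE_mem)
  then have pc: "pc_vec (nx S) (\<lambda>t. state_rhs S (p t) (x t) (u t))"
    by (intro pc_vec_rhs(1) p u)
  have "is_primitive b (\<lambda>t. state_rhs S (p t) (x t) (u t) $ i) (\<lambda>t. x t $ i)" if i: "i < nx S" for i b
  proof (rule AE_derivative_imp_is_primitive)
    show "piecewise_continuous (\<lambda>t. state_rhs S (p t) (x t) (u t) $ i)"
      using pc i unfolding pc_vec_def by blast
    have "?AE" using * by blast
    then show "AE t in lborel. 0 \<le> t \<longrightarrow> ((\<lambda>s. x s $ i) has_real_derivative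
       state_rhs S (p t) (x t) (u t) $ i) (at t within {0..})"
      by eventually_elim (use i in auto)
  qed (rule ac[OF i])
  then show "ct_state S x u p" unfolding ct_state_def using xP by blast
qed

lemma ct_solution_iff:
  assumes S: "lpv_ssa S"
  shows "ct_solution S x y u p \<longleftrightarrow>
     y \<in> pc_signals (ny S) (carrier_vec (ny S)) \<and> u \<in> pc_signals (nu S) (carrier_vec (nu S)) \<and>
     p \<in> pc_signals (np S) (par S) \<and> ct_state S x u p \<and>
     (AE t in lborel. 0 \<le> t \<longrightarrow> y t = output_rhs S (p t) (x t) (u t))"
proof (cases "u \<in> pc_signals (nu S) (carrier_vec (nu S)) \<and> p \<in> pc_signals (np S) (par S)")
  case True
  then have "pc_vec (nu S) u" "pc_vec (np S) p"
    using S pc_signals_pc_vec unfolding lpv_ssa_def by blast+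
  from ct_state_iff[OF this, of x] True show ?thesis
    unfolding ct_solution_def by (simp add: imp_conjR conj_ac)
qed (auto simp: ct_solution_def)

text \<open>The integral state equation with zero input on a finite horizon and without the
  convention on negative times; the pieces of a concatenated trajectory are of this kind.\<close>

definition ct_free :: "lpv \<Rightarrow> real \<Rightarrow> (real \<Rightarrow> real vec) \<Rightarrow> (real \<Rightarrow> real vec) \<Rightarrow> bool" where
  "ct_free S b p z \<longleftrightarrow> (\<forall>t\<in>{0..b}. z t \<in> carrier_vec (nx S)) \<and>
     (\<forall>i<nx S. is_primitive b (\<lambda>t. (A_at S (p t) *\<^sub>v z t) $ i) (\<lambda>t. z t $ i))"

lemma ct_freeD:
  assumes "ct_free S b p z"
  shows "t \<in> {0..b} \<Longrightarrow> z t \<in> carrier_vec (nx S)"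
    and "i < nx S \<Longrightarrow> is_primitive b (\<lambda>t. (A_at S (p t) *\<^sub>v z t) $ i) (\<lambda>t. z t $ i)"
  using assms unfolding ct_free_def by auto

text \<open>The time \<open>a\<close> may lie before or after \<open>t\<close>: the forward
  direction gives uniqueness from the initial state, the backward direction injectivity of the
  transition.\<close>

lemma ct_free_zero:
  assumes p: "pc_vec (np S) p" and z: "ct_free S b p z"
    and a: "a \<in> {0..b}" "z a = 0\<^sub>v (nx S)" and t: "t \<in> {0..b}"
  shows "z t = 0\<^sub>v (nx S)"
proof -
  have "lin_ode b (nx S) (\<lambda>t i j. A_at S (p t) $$ (i, j)) (\<lambda>_ _. 0) (\<lambda>t i. z t $ i)"
    unfolding lin_ode_def
  proof (intro allI impI)
    fix i assume i: "i < nx S"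
    have "(A_at S (p t) *\<^sub>v z t) $ i = (\<Sum>j<nx S. A_at S (p t) $$ (i, j) * z t $ j) + 0"
      if "t \<in> {0..b}" for t
      using mult_mat_vec_index[OF at_carriers(1) ct_freeD(1)[OF z that] i] by simp
    then show "is_primitive b (\<lambda>t. (\<Sum>j<nx S. A_at S (p t) $$ (i, j) * z t $ j) + 0) (\<lambda>t. z t $ i)"
      using ct_freeD(2)[OF z i] by (subst is_primitive_cong[symmetric]) auto
  qed
  then have "z t $ i = 0" if "i < nx S" for i
    by (rule lin_ode_zero_unique[rotated, OF _ a(1) _ t that])
      (use a(2) in \<open>auto simp: A_at_def intro!: piecewise_continuous_affine_mat p\<close>)
  then show ?thesis using ct_freeD(1)[OF z t] by (intro eq_vecI) auto
qed

lemma ct_free_vlincomb: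
  assumes z: "\<And>j. j < m \<Longrightarrow> ct_free S b p (z j)"
  shows "ct_free S b p (\<lambda>t. vlincomb (nx S) m c (\<lambda>j. z j t))"
  unfolding ct_free_def
proof (intro conjI ballI allI impI)
  fix i assume i: "i < nx S"
  have "is_primitive b (\<lambda>t. \<Sum>j\<in>{..<m}. c $ j * (A_at S (p t) *\<^sub>v z j t) $ i) (\<lambda>t. \<Sum>j\<in>{..<m}. c $ j * z j t $
      i)"
    by (rule is_primitive_sum) (use ct_freeD(2)[OF z i] in auto)
  moreover have "(A_at S (p t) *\<^sub>v vlincomb (nx S) m c (\<lambda>j. z j t)) $ i
      = (\<Sum>j<m. c $ j * (A_at S (p t) *\<^sub>v z j t) $ i)" if "t \<in> {0..b}" for t
    using mult_mat_vlincomb[OF at_carriers(1) ct_freeD(1)[OF z that]] i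
    by (simp add: vlincomb_index del: index_mult_mat_vec)
  ultimately show "is_primitive b (\<lambda>t. (A_at S (p t) *\<^sub>v vlincomb (nx S) m c (\<lambda>j. z j t)) $ i)
      (\<lambda>t. vlincomb (nx S) m c (\<lambda>j. z j t) $ i)"
    using i by (subst is_primitive_cong) (auto simp: vlincomb_index simp del: index_mult_mat_vec)
qed simp

lemma ct_free_diff:
  assumes z: "ct_free S b p z" and z': "ct_free S b p z'"
  shows "ct_free S b p (\<lambda>t. z t - z' t)"
  unfolding ct_free_def
proof (intro conjI ballI allI impI)
  fix t assume "t \<in> {0..b}"
  then show "z t - z' t \<in> carrier_vec (nx S)" using ct_freeD(1)[OF z] ct_freeD(1)[OF z'] by auto
next
  fix i assume i: "i < nx S"
  have "is_primitive b (\<lambda>t. (A_at S (p t) *\<^sub>v z t) $ i - (A_at S (p t) *\<^sub>v z' t) $ i) (\<lambda>t. z t $ i - z' t $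
      i)"
    by (intro is_primitive_diff ct_freeD(2)[OF z i] ct_freeD(2)[OF z' i])
  moreover have "(A_at S (p t) *\<^sub>v (z t - z' t)) $ i
      = (A_at S (p t) *\<^sub>v z t) $ i - (A_at S (p t) *\<^sub>v z' t) $ i"
    "(z t - z' t) $ i = z t $ i - z' t $ i" if t: "t \<in> {0..b}" for t
    using mult_minus_distrib_mat_vec[OF at_carriers(1) ct_freeD(1)[OF z t] ct_freeD(1)[OF z' t]]
      carrier_matD(1)[OF at_carriers(1), of S "p t"] carrier_vecD[OF ct_freeD(1)[OF z' t]] i
    by (auto simp del: index_mult_mat_vec)
  ultimately show "is_primitive b (\<lambda>t. (A_at S (p t) *\<^sub>v (z t - z' t)) $ i) (\<lambda>t. (z t - z' t) $ i)"
    by (subst is_primitive_cong) auto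
qed

lemma vec_minus_eq_zeroD:
  fixes v w :: "real vec"
  assumes "v \<in> carrier_vec n" "w \<in> carrier_vec n" "v - w = 0\<^sub>v n"
  shows "v = w"
proof (rule eq_vecI)
  fix i assume "i < dim_vec w"
  then have "(v - w) $ i = v $ i - w $ i" "i < n" using assms(2) by auto
  then show "v $ i = w $ i" using assms(3) by simp
qed (use assms in simp)

lemma ct_free_unique:
  assumes p: "pc_vec (np S) p" and z: "ct_free S b p z" and z': "ct_free S b p z'"
    and "z 0 = z' 0" and t: "t \<in> {0..b}"
  shows "z t = z' t"
proof -
  have 0: "0 \<in> {0..b}" using t by auto
  have "z 0 - z' 0 = 0\<^sub>v (nx S)"
    using ct_freeD(1)[OF z' 0] \<open>z 0 = z' 0\<close> by auto
  then have "z t - z' t = 0\<^sub>v (nx S)"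
    by (rule ct_free_zero[OF p ct_free_diff[OF z z'] 0 _ t])
  then show ?thesis by (rule vec_minus_eq_zeroD[OF ct_freeD(1)[OF z t] ct_freeD(1)[OF z' t]])
qed

lemma ct_state_carrier: "ct_state S x u p \<Longrightarrow> 0 \<le> t \<Longrightarrow> x t \<in> carrier_vec (nx S)"
  unfolding ct_state_def by (auto dest: PiE_mem)

text \<open>The input cancels in the difference of two solutions, which is therefore a free
  trajectory starting at 0.\<close>

lemma ct_state_unique:
  assumes u: "pc_vec (nu S) u" and p: "pc_vec (np S) p"
    and x: "ct_state S x u p" and x': "ct_state S x' u p" and "x 0 = x' 0" and t: "0 \<le> t"
  shows "x t = x' t"
proof -
  note xc = ct_state_carrier[OF x] and xc' = ct_state_carrier[OF x']
  have free: "ct_free S t p (\<lambda>s. x s - x' s)"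
    unfolding ct_free_def
  proof (intro conjI ballI allI impI)
    fix s assume "s \<in> {0..t}"
    then show "x s - x' s \<in> carrier_vec (nx S)" using xc[of s] xc'[of s] by auto
  next
    fix i assume i: "i < nx S"
    have "is_primitive t (\<lambda>s. state_rhs S (p s) (x s) (u s) $ i - state_rhs S (p s) (x' s) (u s) $ i)
        (\<lambda>s. x s $ i - x' s $ i)"
      using x x' i by (intro is_primitive_diff) (auto simp: ct_state_def)
    moreover have "(A_at S (p s) *\<^sub>v (x s - x' s)) $ i
        = state_rhs S (p s) (x s) (u s) $ i - state_rhs S (p s) (x' s) (u s) $ i"
      "(x s - x' s) $ i = x s $ i - x' s $ i" if s: "s \<in> {0..t}" for s
    proof -
      have c: "x s \<in> carrier_vec (nx S)" "x' s \<in> carrier_vec (nx S)" using xc[of s] xc'[of s] s by auto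
      have d: "dim_row (B_at S (p s)) = nx S" by (rule carrier_matD(1)[OF at_carriers(2)])
      have d': "dim_row (A_at S (p s)) = nx S" by (rule carrier_matD(1)[OF at_carriers(1)])
      show "(x s - x' s) $ i = x s $ i - x' s $ i" using c i by auto
      have "(A_at S (p s) *\<^sub>v (x s - x' s)) $ i = (A_at S (p s) *\<^sub>v x s) $ i - (A_at S (p s) *\<^sub>v x' s) $ i"
        using mult_minus_distrib_mat_vec[OF at_carriers(1) c] i d' by (simp del: index_mult_mat_vec)
      then show "(A_at S (p s) *\<^sub>v (x s - x' s)) $ i
        = state_rhs S (p s) (x s) (u s) $ i - state_rhs S (p s) (x' s) (u s) $ i"
        unfolding state_rhs_def using i d by (simp del: index_mult_mat_vec)
    qed
    ultimately show "is_primitive t (\<lambda>s. (A_at S (p s) *\<^sub>v (x s - x' s)) $ i) (\<lambda>s. (x s - x' s) $ i)"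
      by (subst is_primitive_cong) auto
  qed
  have "x 0 - x' 0 = 0\<^sub>v (nx S)" using xc'[of 0] \<open>x 0 = x' 0\<close> by auto
  then have "x t - x' t = 0\<^sub>v (nx S)"
    by (rule ct_free_zero[OF p free, rotated]) (use t in auto)
  then show ?thesis by (rule vec_minus_eq_zeroD[OF xc[OF t] xc'[OF t]])
qed

lemma ct_state_exists:
  assumes u: "pc_vec (nu S) u" and p: "pc_vec (np S) p" and x0: "x0 \<in> carrier_vec (nx S)"
  shows "\<exists>x. ct_state S x u p \<and> x 0 = x0"
proof -
  define M f where "M t i j = A_at S (p t) $$ (i, j)" and "f t i = (B_at S (p t) *\<^sub>v u t) $ i" for t i j
  have "piecewise_continuous (\<lambda>t. M t i j)" if "i < nx S" "j < nx S" for i j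
    unfolding M_def A_at_def by (rule piecewise_continuous_affine_mat[OF p that])
  moreover have "piecewise_continuous (\<lambda>t. f t i)" if "i < nx S" for i
    using pc_vec_affine_mult[OF p u] that unfolding f_def B_at_def pc_vec_def by blast
  ultimately obtain y where y: "\<And>b. lin_ode b (nx S) M f y" and y0: "\<And>i. i < nx S \<Longrightarrow> y 0 i = x0 $ i"
    using lin_ode_exists[of "nx S" M f "\<lambda>i. x0 $ i"] by blast
  define x where "x = restrict (\<lambda>t. vec (nx S) (y t)) {0..}"
  have x: "x t = vec (nx S) (y t)" if "0 \<le> t" for t unfolding x_def using that by simp
  have "ct_state S x u p"
    unfolding ct_state_def
  proof (intro conjI allI impI)
    show "x \<in> {0..} \<rightarrow>\<^sub>E carrier_vec (nx S)" unfolding x_def by (intro restrict_PiE_iff[THEN iffD2]) auto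
    fix i b assume i: "i < nx S"
    have "is_primitive b (\<lambda>t. (\<Sum>j<nx S. M t i j * y t j) + f t i) (\<lambda>t. y t i)"
      using y i unfolding lin_ode_def by blast
    moreover have "state_rhs S (p t) (x t) (u t) $ i = (\<Sum>j<nx S. M t i j * y t j) + f t i"
      if "t \<in> {0..b}" for t
    proof -
      have xt: "x t = vec (nx S) (y t)" using x that by auto
      have "(A_at S (p t) *\<^sub>v x t) $ i = (\<Sum>j<nx S. M t i j * y t j)"
        using mult_mat_vec_index[OF at_carriers(1) _ i, of "x t" "p t"] by (simp add: xt M_def)
      then show ?thesis
        using i carrier_matD(1)[OF at_carriers(2), of S "p t"]
        unfolding state_rhs_def f_def by (simp del: index_mult_mat_vec)
    qed
    moreover have "x t $ i = y t i" if "t \<in> {0..b}" for t using x that i by auto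
    ultimately show "is_primitive b (\<lambda>t. state_rhs S (p t) (x t) (u t) $ i) (\<lambda>t. x t $ i)"
      by (subst is_primitive_cong) auto
  qed
  moreover have "x 0 = x0" using x[of 0] y0 x0 by auto
  ultimately show ?thesis by blast
qed

section \<open>Zero-input trajectories and the transition matrix\<close>

lemma ct_state_zero_input:
  assumes x: "ct_state S x u p" and u: "\<And>t. 0 \<le> t \<Longrightarrow> u t = 0\<^sub>v (nu S)"
  shows "ct_free S b p x"
  unfolding ct_free_def
proof (intro conjI ballI allI impI)
  fix i assume i: "i < nx S"
  have "is_primitive b (\<lambda>t. state_rhs S (p t) (x t) (u t) $ i) (\<lambda>t. x t $ i)"
    using x i unfolding ct_state_def by blast
  then show "is_primitive b (\<lambda>t. (A_at S (p t) *\<^sub>v x t) $ i) (\<lambda>t. x t $ i)"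
  proof (rule is_primitive_transform)
    fix t assume "t \<in> {0..b}"
    then show "(A_at S (p t) *\<^sub>v x t) $ i = state_rhs S (p t) (x t) (u t) $ i"
      using rhs_zero_input(1)[OF ct_state_carrier[OF x, of t]] u[of t] by simp
  qed simp
qed (use ct_state_carrier[OF x] in auto)

lemma ct_free_imp_ct_state:
  assumes z: "\<And>b. ct_free S b p z" and u: "\<And>t. 0 \<le> t \<Longrightarrow> u t = 0\<^sub>v (nu S)"
  shows "ct_state S (restrict z {0..}) u p"
  unfolding ct_state_def
proof (intro conjI allI impI)
  have zc: "z t \<in> carrier_vec (nx S)" if "0 \<le> t" for t using ct_freeD(1)[OF z[of t]] that by auto
  then show "restrict z {0..} \<in> {0..} \<rightarrow>\<^sub>E carrier_vec (nx S)"
    by (intro restrict_PiE_iff[THEN iffD2]) auto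
  fix i b assume i: "i < nx S"
  have "state_rhs S (p t) (restrict z {0..} t) (u t) $ i = (A_at S (p t) *\<^sub>v z t) $ i" if "t \<in> {0..b}" for t
    using rhs_zero_input(1)[OF zc] u[of t] that by simp
  then show "is_primitive b (\<lambda>t. state_rhs S (p t) (restrict z {0..} t) (u t) $ i) (\<lambda>t. restrict z {0..} t $
      i)"
    using ct_freeD(2)[OF z i] by (subst is_primitive_cong) auto
qed

text \<open>The columns are the zero-input solutions starting from the unit vectors; by linearity
  the matrix then moves every initial state.\<close>

lemma ct_flow_exists:
  assumes p: "pc_vec (np S) p"
  shows "\<exists>\<Phi>. (\<forall>t\<ge>0. \<Phi> t \<in> carrier_mat (nx S) (nx S)) \<and> \<Phi> 0 = 1\<^sub>m (nx S) \<and>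
    (\<forall>w\<in>carrier_vec (nx S). \<forall>b. ct_free S b p (\<lambda>t. \<Phi> t *\<^sub>v w))"
proof -
  define u :: "real \<Rightarrow> real vec" where "u = (\<lambda>_. 0\<^sub>v (nu S))"
  have u: "pc_vec (nu S) u"
    unfolding u_def pc_vec_def by (auto intro: piecewise_continuous_const)
  have "\<exists>z. ct_state S z u p \<and> z 0 = unit_vec (nx S) j" for j
    by (rule ct_state_exists[OF u p]) simp
  then obtain z where z: "\<And>j. ct_state S (z j) u p" and z0: "\<And>j. z j 0 = unit_vec (nx S) j" by metis
  have free: "ct_free S b p (z j)" for b j by (rule ct_state_zero_input[OF z]) (simp add: u_def)
  define \<Phi> where "\<Phi> t = mat (nx S) (nx S) (\<lambda>(i, j). z j t $ i)" for t
  have \<Phi>c: "\<Phi> t \<in> carrier_mat (nx S) (nx S)" for t unfolding \<Phi>_def by simp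
  have "\<Phi> t *\<^sub>v w = vlincomb (nx S) (nx S) w (\<lambda>j. z j t)" if w: "w \<in> carrier_vec (nx S)" for w t
  proof (rule eq_vecI)
    fix i assume "i < dim_vec (vlincomb (nx S) (nx S) w (\<lambda>j. z j t))"
    then have i: "i < nx S" by (simp add: vlincomb_def)
    show "(\<Phi> t *\<^sub>v w) $ i = vlincomb (nx S) (nx S) w (\<lambda>j. z j t) $ i"
      using mult_mat_vec_index[OF \<Phi>c w i, of t] i
      by (simp add: vlincomb_index \<Phi>_def mult.commute del: index_mult_mat_vec)
  qed (simp add: \<Phi>_def vlincomb_def)
  then have "ct_free S b p (\<lambda>t. \<Phi> t *\<^sub>v w)" if "w \<in> carrier_vec (nx S)" for w b
    using ct_free_vlincomb[of "nx S" S b p z w] free that by simp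
  moreover have "\<Phi> 0 = 1\<^sub>m (nx S)"
    unfolding \<Phi>_def z0 by (intro eq_matI) auto
  ultimately show ?thesis using \<Phi>c by blast
qed

text \<open>The state transition matrix from time 0 to \<open>t\<close>. For piecewise continuous
  scheduling its values at nonnegative times do not depend on the choice, by
  \<open>ct_flow_unique\<close>.\<close>

definition ct_flow :: "lpv \<Rightarrow> (real \<Rightarrow> real vec) \<Rightarrow> real \<Rightarrow> real mat" where
  "ct_flow S p = (SOME \<Phi>. (\<forall>t\<ge>0. \<Phi> t \<in> carrier_mat (nx S) (nx S)) \<and> \<Phi> 0 = 1\<^sub>m (nx S) \<and>
    (\<forall>w\<in>carrier_vec (nx S). \<forall>b. ct_free S b p (\<lambda>t. \<Phi> t *\<^sub>v w)))"

lemma ct_flow: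
  assumes p: "pc_vec (np S) p"
  shows "0 \<le> t \<Longrightarrow> ct_flow S p t \<in> carrier_mat (nx S) (nx S)" "ct_flow S p 0 = 1\<^sub>m (nx S)"
    "w \<in> carrier_vec (nx S) \<Longrightarrow> ct_free S b p (\<lambda>t. ct_flow S p t *\<^sub>v w)"
  using someI_ex[OF ct_flow_exists[OF p], folded ct_flow_def] by blast+

lemma ct_flow_unique:
  assumes p: "pc_vec (np S) p" and z: "ct_free S b p z" and t: "t \<in> {0..b}"
  shows "z t = ct_flow S p t *\<^sub>v z 0"
proof -
  have z0: "z 0 \<in> carrier_vec (nx S)" using t by (intro ct_freeD(1)[OF z]) auto
  show ?thesis
    by (rule ct_free_unique[OF p z ct_flow(3)[OF p z0] _ t]) (use z0 in \<open>simp add: ct_flow(2)[OF p]\<close>)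
qed

text \<open>A free trajectory that vanishes at time \<open>T\<close> vanishes at time 0 by backward
  uniqueness; this takes the place of the invertibility of \<open>A(p)\<close> in discrete
  time.\<close>

lemma ct_flow_inj:
  assumes p: "pc_vec (np S) p" and w: "w \<in> carrier_vec (nx S)" and T: "0 \<le> T"
    and "ct_flow S p T *\<^sub>v w = 0\<^sub>v (nx S)"
  shows "w = 0\<^sub>v (nx S)"
proof -
  have "ct_flow S p 0 *\<^sub>v w = 0\<^sub>v (nx S)"
    by (rule ct_free_zero[OF p ct_flow(3)[OF p w], where a = T]) (use assms in auto)
  then show ?thesis using w by (simp add: ct_flow(2)[OF p])
qed

text \<open>At the junction \<open>T\<close> the second signal is already in force, which makes
  concatenation preserve right continuity.\<close>

definition append_signal :: "(real \<Rightarrow> 'a) \<Rightarrow> real \<Rightarrow> (real \<Rightarrow> 'a) \<Rightarrow> real \<Rightarrow> 'a" where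
  "append_signal p T q t = (if t < T then p t else q (t - T))"

text \<open>Up to \<open>T\<close> the trajectory is free for \<open>p\<close>; shifted by
  \<open>T\<close> it is free for \<open>q\<close>. Uniqueness identifies each piece with the
  corresponding flow.\<close>

lemma ct_flow_append:
  assumes p: "pc_vec (np S) p" and q: "pc_vec (np S) q" and pq: "pc_vec (np S) (append_signal p T q)"
    and T: "0 \<le> T" and w: "w \<in> carrier_vec (nx S)"
  shows "0 \<le> t \<Longrightarrow> t \<le> T \<Longrightarrow> ct_flow S (append_signal p T q) t *\<^sub>v w = ct_flow S p t *\<^sub>v w"
    and "0 \<le> t \<Longrightarrow> ct_flow S (append_signal p T q) (T + t) *\<^sub>v w = ct_flow S q t *\<^sub>v (ct_flow S p T *\<^sub>v w)"
proof -
  define z where "z t = ct_flow S (append_signal p T q) t *\<^sub>v w" for t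
  have z: "ct_free S b (append_signal p T q) z" for b
    unfolding z_def by (rule ct_flow(3)[OF pq w])
  have z0: "z 0 = w" unfolding z_def using w by (simp add: ct_flow(2)[OF pq])
  have "ct_free S T p z"
    unfolding ct_free_def
  proof (intro conjI ballI allI impI)
    fix i assume i: "i < nx S"
    show "is_primitive T (\<lambda>t. (A_at S (p t) *\<^sub>v z t) $ i) (\<lambda>t. z t $ i)"
      by (rule is_primitive_spike[OF ct_freeD(2)[OF z i]]) (simp add: append_signal_def)
  qed (use ct_freeD(1)[OF z] in auto)
  from ct_flow_unique[OF p this] have zp: "z t = ct_flow S p t *\<^sub>v w" if "0 \<le> t" "t \<le> T" for t
    using that by (simp add: z0)
  then show "0 \<le> t \<Longrightarrow> t \<le> T \<Longrightarrow> ct_flow S (append_signal p T q) t *\<^sub>v w = ct_flow S p t *\<^sub>v w"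
    unfolding z_def by blast
  assume t: "0 \<le> t"
  have "ct_free S t q (\<lambda>s. z (T + s))"
    unfolding ct_free_def
  proof (intro conjI ballI allI impI)
    fix s assume "s \<in> {0..t}"
    then show "z (T + s) \<in> carrier_vec (nx S)" using T by (intro ct_freeD(1)[OF z[of "T + t"]]) auto
  next
    fix i assume i: "i < nx S"
    have "is_primitive t (\<lambda>s. (A_at S (append_signal p T q (T + s)) *\<^sub>v z (T + s)) $ i) (\<lambda>s. z (T + s) $ i)"
      by (rule is_primitive_shift[OF ct_freeD(2)[OF z i] T])
    then show "is_primitive t (\<lambda>s. (A_at S (q s) *\<^sub>v z (T + s)) $ i) (\<lambda>s. z (T + s) $ i)"
      by (subst is_primitive_cong[symmetric]) (auto simp: append_signal_def)
  qed
  from ct_flow_unique[OF q this, of t] have "z (T + t) = ct_flow S q t *\<^sub>v z T" using t by simp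
  then show "ct_flow S (append_signal p T q) (T + t) *\<^sub>v w = ct_flow S q t *\<^sub>v (ct_flow S p T *\<^sub>v w)"
    using zp[of T] T unfolding z_def by simp
qed

lemma piecewise_continuous_append:
  assumes f: "piecewise_continuous f" and g: "piecewise_continuous g" and T: "0 \<le> T"
  shows "piecewise_continuous (append_signal f T g)"
proof -
  let ?h = "append_signal f T g"
  have left: "\<forall>\<^sub>F s in at t within A. f s = ?h s" if "t < T" for t A
    using order_tendstoD(2)[OF tendsto_ident_at that]
    by eventually_elim (simp add: append_signal_def)
  have right: "\<forall>\<^sub>F s in at t within A. g (s - T) = ?h s" if "T < t" for t A
    using order_tendstoD(1)[OF tendsto_ident_at that]
    by eventually_elim (simp add: append_signal_def)
  have cont_left: "continuous (at t within {0..}) ?h"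
    if t: "t < T" and c: "continuous (at t within {0..}) f" for t
  proof -
    have "?h t = f t" using t by (simp add: append_signal_def)
    with Lim_transform_eventually[OF c[unfolded continuous_within] left[OF t]] show ?thesis
      unfolding continuous_within by (simp only:)
  qed
  have cont_right: "continuous (at t within {0..}) ?h"
    if t: "T < t" and c: "continuous (at (t - T) within {0..}) g" for t
  proof -
    \<comment> \<open>Strictly after the junction the shifted time is positive, so continuity of
      \<open>g\<close> there is two-sided and survives the shift.\<close>
    have "at (t - T) within {0..} = at (t - T)"
      by (rule at_within_nhd[of _ "{0<..}"]) (use t in auto)
    then have "isCont g (t - T)" using c by simp
    then have "isCont (\<lambda>s. g (s - T)) t"
      by (intro isCont_o2[of t "\<lambda>s. s - T" g]) auto
    then have "((\<lambda>s. g (s - T)) \<longlongrightarrow> g (t - T)) (at t within {0..})"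
      unfolding isCont_def by (rule tendsto_within_subset) simp
    moreover have "?h t = g (t - T)" using t by (simp add: append_signal_def)
    ultimately show ?thesis
      using Lim_transform_eventually[OF _ right[OF t]] unfolding continuous_within by (simp only:)
  qed
  show ?thesis
    unfolding piecewise_continuous_def
  proof (intro conjI allI impI)
    fix b
    \<comment> \<open>New discontinuities can arise only at the junction; the others come from
      \<open>f\<close> or, shifted by \<open>T\<close>, from \<open>g\<close>.\<close>
    have "{t \<in> {0..b}. \<not> continuous (at t within {0..}) ?h}
        \<subseteq> {T} \<union> {t \<in> {0..b}. \<not> continuous (at t within {0..}) f}
          \<union> (\<lambda>t. t + T) ` {t \<in> {0..b}. \<not> continuous (at t within {0..}) g}"
    proof
      fix t assume t: "t \<in> {t \<in> {0..b}. \<not> continuous (at t within {0..}) ?h}"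
      consider "t < T" | "t = T" | "T < t" by linarith
      then show "t \<in> {T} \<union> {t \<in> {0..b}. \<not> continuous (at t within {0..}) f}
          \<union> (\<lambda>t. t + T) ` {t \<in> {0..b}. \<not> continuous (at t within {0..}) g}"
      proof cases
        case 1
        then show ?thesis using t cont_left by blast
      next
        case 3
        then have "t - T \<in> {t \<in> {0..b}. \<not> continuous (at t within {0..}) g}"
          using t cont_right T by auto
        then show ?thesis by (intro UnI2 image_eqI[of _ _ "t - T"]) auto
      qed simp
    qed
    then show "finite {t \<in> {0..b}. \<not> continuous (at t within {0..}) ?h}"
      using f g unfolding piecewise_continuous_def
      by (meson finite.emptyI finite.insertI finite_UnI finite_imageI finite_subset)
  next
    fix t :: real assume "0 \<le> t"
    show "\<exists>l. (?h \<longlongrightarrow> l) (at_right t)"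
    proof (cases "t < T")
      case True
      obtain l where "(f \<longlongrightarrow> l) (at_right t)"
        using f \<open>0 \<le> t\<close> unfolding piecewise_continuous_def by blast
      from Lim_transform_eventually[OF this left[OF True]] show ?thesis by blast
    next
      case False
      then obtain l where "(g \<longlongrightarrow> l) (at_right (t - T))"
        using g unfolding piecewise_continuous_def by force
      then have "((\<lambda>s. g (s - T)) \<longlongrightarrow> l) (at_right t)"
        unfolding filtermap_at_right_shift[symmetric] filterlim_filtermap .
      moreover have "\<forall>\<^sub>F s in at_right t. g (s - T) = ?h s"
        using False by (auto simp: eventually_at_filter append_signal_def)
      ultimately show ?thesis using Lim_transform_eventually by blast
    qed
  next
    fix t :: real assume "0 < t"
    show "\<exists>l. (?h \<longlongrightarrow> l) (at_left t)"
    proof (cases "t \<le> T")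
      case True
      obtain l where l: "(f \<longlongrightarrow> l) (at_left t)"
        using f \<open>0 < t\<close> unfolding piecewise_continuous_def by blast
      have "\<forall>\<^sub>F s in at_left t. f s = ?h s"
        using True by (auto simp: eventually_at_filter append_signal_def)
      from Lim_transform_eventually[OF l this] show ?thesis by blast
    next
      case False
      then obtain l where "(g \<longlongrightarrow> l) (at_left (t - T))"
        using g unfolding piecewise_continuous_def by force
      moreover have "filterlim (\<lambda>s. s - T) (at_left (t - T)) (at_left t)"
        unfolding filterlim_at by (auto intro!: tendsto_intros simp: eventually_at_filter)
      ultimately have "((\<lambda>s. g (s - T)) \<longlongrightarrow> l) (at_left t)"
        by (rule filterlim_compose)
      from Lim_transform_eventually[OF this right] False show ?thesis by (metis not_le)
    qed
  qed
qed

text \<open>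
  Right continuity makes a zero-input output that vanishes almost everywhere vanish everywhere.
\<close>

definition rc_signal :: "nat \<Rightarrow> real vec set \<Rightarrow> (real \<Rightarrow> real vec) \<Rightarrow> bool" where
  "rc_signal n P p \<longleftrightarrow> pc_vec n p \<and> (\<forall>t\<ge>0. p t \<in> P) \<and>
     (\<forall>i<n. \<forall>t\<ge>0. ((\<lambda>s. p s $ i) \<longlongrightarrow> p t $ i) (at_right t))"

lemma rc_signal_const: "q \<in> P \<Longrightarrow> q \<in> carrier_vec n \<Longrightarrow> rc_signal n P (\<lambda>_. q)"
  unfolding rc_signal_def pc_vec_def by (auto intro: piecewise_continuous_const)

text \<open>At the junction both the value and the limit from the right come from
  \<open>q\<close>.\<close>

lemma rc_signal_append:
  assumes p: "rc_signal n P p" and q: "rc_signal n P q" and T: "0 \<le> T"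
  shows "rc_signal n P (append_signal p T q)"
proof -
  have comp: "(\<lambda>t. append_signal p T q t $ i) = append_signal (\<lambda>t. p t $ i) T (\<lambda>t. q t $ i)" for i
    by (auto simp: append_signal_def)
  have "((\<lambda>s. append_signal p T q s $ i) \<longlongrightarrow> append_signal p T q t $ i) (at_right t)"
    if i: "i < n" and t: "0 \<le> t" for i t
  proof (cases "t < T")
    case True
    have "\<forall>\<^sub>F s in at_right t. p s $ i = append_signal p T q s $ i"
      using order_tendstoD(2)[OF tendsto_ident_at True]
      by eventually_elim (simp add: append_signal_def)
    moreover have "((\<lambda>s. p s $ i) \<longlongrightarrow> p t $ i) (at_right t)"
      using p i t unfolding rc_signal_def by blast
    ultimately show ?thesis
      using True Lim_transform_eventually by (fastforce simp: append_signal_def)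
  next
    case False
    have "((\<lambda>s. q s $ i) \<longlongrightarrow> q (t - T) $ i) (at_right (t - T))"
      using q i False unfolding rc_signal_def by simp
    then have "((\<lambda>s. q (s - T) $ i) \<longlongrightarrow> q (t - T) $ i) (at_right t)"
      unfolding filtermap_at_right_shift[symmetric] filterlim_filtermap .
    moreover have "\<forall>\<^sub>F s in at_right t. q (s - T) $ i = append_signal p T q s $ i"
      using False by (auto simp: eventually_at_filter append_signal_def)
    ultimately show ?thesis
      using False Lim_transform_eventually by (fastforce simp: append_signal_def)
  qed
  then show ?thesis
    using p q T unfolding rc_signal_def pc_vec_def comp
    by (auto intro!: piecewise_continuous_append simp: append_signal_def)
qed

text \<open>The half-open interval matches \<open>append_signal\<close>: the observation times of a
  concatenation split exactly into those of its two parts.\<close>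

definition ct_silent :: "lpv \<Rightarrow> (real \<Rightarrow> real vec) \<Rightarrow> real \<Rightarrow> real vec \<Rightarrow> bool" where
  "ct_silent S p T w \<longleftrightarrow>
     (\<forall>t. 0 \<le> t \<and> t < T \<longrightarrow> C_at S (p t) *\<^sub>v (ct_flow S p t *\<^sub>v w) = 0\<^sub>v (ny S))"

lemma ct_silent_append:
  assumes p: "pc_vec (np S) p" and q: "pc_vec (np S) q" and pq: "pc_vec (np S) (append_signal p T q)"
    and T: "0 \<le> T" "0 \<le> T'" and w: "w \<in> carrier_vec (nx S)"
  shows "ct_silent S (append_signal p T q) (T + T') w
    \<longleftrightarrow> ct_silent S p T w \<and> ct_silent S q T' (ct_flow S p T *\<^sub>v w)"
proof -
  define out where "out t = C_at S (append_signal p T q t) *\<^sub>v (ct_flow S (append_signal p T q) t *\<^sub>v w)"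
      for t
  note fl = ct_flow_append[OF p q pq T(1) w]
  have l: "out t = C_at S (p t) *\<^sub>v (ct_flow S p t *\<^sub>v w)" if "0 \<le> t" "t < T" for t
    using fl(1)[of t] that by (simp add: append_signal_def out_def)
  have r: "out (T + t) = C_at S (q t) *\<^sub>v (ct_flow S q t *\<^sub>v (ct_flow S p T *\<^sub>v w))" if "0 \<le> t" for t
    using fl(2)[of t] that by (simp add: append_signal_def out_def)
  have "(\<forall>t. 0 \<le> t \<and> t < T + T' \<longrightarrow> out t = 0\<^sub>v (ny S)) \<longleftrightarrow>
      (\<forall>t. 0 \<le> t \<and> t < T \<longrightarrow> out t = 0\<^sub>v (ny S)) \<and> (\<forall>t. 0 \<le> t \<and> t < T' \<longrightarrow> out (T + t) = 0\<^sub>v (ny S))"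
  proof (intro iffI conjI allI impI)
    fix t assume "(\<forall>t. 0 \<le> t \<and> t < T \<longrightarrow> out t = 0\<^sub>v (ny S)) \<and> (\<forall>t. 0 \<le> t \<and> t < T' \<longrightarrow> out (T + t) = 0\<^sub>v (ny S))"
      "0 \<le> t \<and> t < T + T'"
    then show "out t = 0\<^sub>v (ny S)"
      by (cases "t < T") (auto dest: spec[of _ "t - T"])
  qed (use T in auto)
  then show ?thesis
    unfolding ct_silent_def out_def[symmetric] using l r by auto
qed

lemma ct_silent_linear:
  assumes p: "pc_vec (np S) p"
  shows "ct_silent S p T (0\<^sub>v (nx S))"
    and "v \<in> carrier_vec (nx S) \<Longrightarrow> w \<in> carrier_vec (nx S) \<Longrightarrow> ct_silent S p T v \<Longrightarrow> ct_silent S p T w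
      \<Longrightarrow> ct_silent S p T (v + w)"
    and "v \<in> carrier_vec (nx S) \<Longrightarrow> ct_silent S p T v \<Longrightarrow> ct_silent S p T (c \<cdot>\<^sub>v v)"
proof -
  define Q where "Q t = C_at S (p t) * ct_flow S p t" for t
  have Qc: "Q t \<in> carrier_mat (ny S) (nx S)" if "0 \<le> t" for t
    unfolding Q_def by (rule mult_carrier_mat[OF at_carriers(3) ct_flow(1)[OF p that]])
  have silent: "ct_silent S p T v \<longleftrightarrow> (\<forall>t. 0 \<le> t \<and> t < T \<longrightarrow> Q t *\<^sub>v v = 0\<^sub>v (ny S))"
    if "v \<in> carrier_vec (nx S)" for v
    unfolding ct_silent_def Q_def
    using assoc_mult_mat_vec[OF at_carriers(3) ct_flow(1)[OF p] that] by auto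
  show "ct_silent S p T (0\<^sub>v (nx S))"
    using silent mult_mat_zero_vec[OF Qc] by simp
  show "ct_silent S p T (v + w)"
    if "v \<in> carrier_vec (nx S)" "w \<in> carrier_vec (nx S)" "ct_silent S p T v" "ct_silent S p T w"
    using that silent mult_add_distrib_mat_vec[OF Qc that(1,2)] by simp
  show "ct_silent S p T (c \<cdot>\<^sub>v v)" if "v \<in> carrier_vec (nx S)" "ct_silent S p T v"
  proof -
    have "c \<cdot>\<^sub>v 0\<^sub>v (ny S) = (0\<^sub>v (ny S) :: real vec)" by (intro eq_vecI) auto
    then show ?thesis using that silent mult_mat_vec[OF Qc that(1)] by simp
  qed
qed

text \<open>Under constant scheduling the functional \<open>m\<close> along the trajectory has right
  derivative \<open>m (A(q) w)\<close> at time 0, which is 0 if the functional vanishes along the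
  whole trajectory.\<close>

lemma ct_flow_const_derivative:
  fixes m :: "nat \<Rightarrow> real"
  assumes q: "q \<in> carrier_vec (np S)" and w: "w \<in> carrier_vec (nx S)"
    and zero: "\<And>t. 0 \<le> t \<Longrightarrow> (\<Sum>j<nx S. m j * (ct_flow S (\<lambda>_. q) t *\<^sub>v w) $ j) = 0"
  shows "(\<Sum>j<nx S. m j * (A_at S q *\<^sub>v w) $ j) = 0"
proof -
  define z where "z t = ct_flow S (\<lambda>_. q) t *\<^sub>v w" for t
  have pq: "pc_vec (np S) (\<lambda>_. q)"
    using q unfolding pc_vec_def by (auto intro: piecewise_continuous_const)
  have z: "ct_free S b (\<lambda>_. q) z" for b unfolding z_def by (rule ct_flow(3)[OF pq w])
  have z0: "z 0 = w" unfolding z_def using w by (simp add: ct_flow(2)[OF pq])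
  define g where "g t = (\<Sum>j<nx S. m j * (\<Sum>l<nx S. A_at S q $$ (j, l) * z t $ l))" for t
  have "continuous_on {0..} (\<lambda>t. z t $ l)" if "l < nx S" for l
    by (intro continuous_on_atLeastI is_primitive_continuous[OF ct_freeD(2)[OF z that]])
  then have gc: "continuous_on {0..} g"
    unfolding g_def by (intro continuous_intros) auto
  have Az: "(A_at S q *\<^sub>v z t) $ j = (\<Sum>l<nx S. A_at S q $$ (j, l) * z t $ l)" if "0 \<le> t" "j < nx S" for t j
    using that by (intro mult_mat_vec_index[OF at_carriers(1)] ct_freeD(1)[OF z[of t]]) auto
  have "is_primitive 1 (\<lambda>t. \<Sum>j<nx S. m j * (A_at S q *\<^sub>v z t) $ j) (\<lambda>t. \<Sum>j<nx S. m j * z t $ j)"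
    by (rule is_primitive_sum) (use ct_freeD(2)[OF z] in auto)
  then have "is_primitive 1 g (\<lambda>_. 0)"
    by (rule is_primitive_transform) (use Az zero in \<open>auto simp: g_def z_def intro!: sum.cong\<close>)
  \<comment> \<open>The shape \<open>t + 1\<close> at \<open>t = 0\<close> that
    \<open>is_primitive_derivative\<close> expects.\<close>
  then have "is_primitive (0 + 1) g (\<lambda>_. 0)" by simp
  moreover have "continuous (at 0 within {0..}) g"
    using gc by (simp add: continuous_on_eq_continuous_within)
  ultimately have "((\<lambda>_. 0) has_real_derivative g 0) (at (0::real) within {0..})"
    by (intro is_primitive_derivative continuous_imp_piecewise_continuous gc) auto
  then have "((\<lambda>_. 0) \<longlongrightarrow> g 0) (at (0::real) within {0..})"
    by (simp add: has_field_derivative_iff)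
  then have "((\<lambda>_. 0) \<longlongrightarrow> g 0) (at_right (0::real))"
    by (rule tendsto_within_subset) auto
  then have "g 0 = 0" using tendsto_const_iff[of "at_right (0::real)" "0::real" "g 0"] by simp
  then show ?thesis using Az[of 0] by (simp add: g_def z0)
qed

text \<open>Experiments are pairs of a right continuous signal and a duration. The states silent in
  all of them are invariant under \<open>A(q)\<close>: hold \<open>q\<close> for a time
  \<open>s\<close>, then run any other experiment; the output is 0 for all \<open>s\<close>, and
  differentiating at \<open>s = 0\<close> brings out \<open>A(q)\<close>.\<close>

lemma ct_separating_signal:
  assumes R: "lpv_ssa R" and obs: "observable_lpv R" and reg: "ct_regular R"
  shows "\<exists>p T. rc_signal (np R) (par R) p \<and> 0 \<le> T \<and>
    (\<forall>w\<in>carrier_vec (nx R). ct_silent R p T w \<longrightarrow> w = 0\<^sub>v (nx R))"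
proof -
  have par: "par R \<subseteq> carrier_vec (np R)" using R unfolding lpv_ssa_def by blast
  define E where "E = {(p, T :: real). rc_signal (np R) (par R) p \<and> 0 \<le> T}"
  define N where "N = (\<lambda>(p, T). {w \<in> carrier_vec (nx R). ct_silent R p T w})"
  define F where "F = (\<lambda>(p, T) w. ct_flow R p T *\<^sub>v w)"
  have pc: "pc_vec (np R) p" if "rc_signal (np R) (par R) p" for p
    using that unfolding rc_signal_def by blast
  have const: "rc_signal (np R) (par R) (\<lambda>_. q)" if "q \<in> par R" for q
    using that par by (intro rc_signal_const) auto
  have app: "rc_signal (np R) (par R) (append_signal p T q)"
    and app_silent: "\<And>w T'. w \<in> carrier_vec (nx R) \<Longrightarrow> 0 \<le> T' \<Longrightarrow>
      ct_silent R (append_signal p T q) (T + T') w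
      \<longleftrightarrow> ct_silent R p T w \<and> ct_silent R q T' (ct_flow R p T *\<^sub>v w)"
    if "rc_signal (np R) (par R) p" "rc_signal (np R) (par R) q" "0 \<le> T" for p q T
    using rc_signal_append[OF that] ct_silent_append[OF pc[OF that(1)] pc[OF that(2)]] that pc by auto
  obtain q0 where q0: "q0 \<in> par R"
    using reg vec_interior_subset unfolding ct_regular_def by blast
  have sub: "vec_subspace (nx R) (N e)" if "e \<in> E" for e
    using that ct_silent_linear[OF pc] unfolding vec_subspace_def N_def E_def by auto
  have "\<exists>e\<in>E. N e \<subseteq> {0\<^sub>v (nx R)}"
  proof (rule separating_experiment[where F = F and ?e0.0 = "(\<lambda>_. q0, 0)"])
    show "(\<lambda>_. q0, 0) \<in> E" unfolding E_def using const[OF q0] by simp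
    show "vec_subspace (nx R) (N e)" if "e \<in> E" for e by (rule sub[OF that])
    fix e e' assume e: "e \<in> E" and e': "e' \<in> E"
    obtain p T q T' where "e = (p, T)" "e' = (q, T')"
      and rc: "rc_signal (np R) (par R) p" "rc_signal (np R) (par R) q" "0 \<le> T" "0 \<le> T'"
      using e e' unfolding E_def by auto
    then show "\<exists>d\<in>E. N d = {w \<in> N e. F e w \<in> N e'}"
      using app[OF rc(1-3)] app_silent[OF rc(1-3) _ rc(4)]
        mult_mat_vec_carrier[OF ct_flow(1)[OF pc[OF rc(1)] rc(3)]]
      by (intro bexI[of _ "(append_signal p T q, T + T')"]) (auto simp: N_def F_def E_def)
  next
    fix e and w :: "real vec" assume e: "e \<in> E" and w: "w \<in> carrier_vec (nx R)"
    obtain p T where pT: "e = (p, T)" "rc_signal (np R) (par R) p" "0 \<le> T"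
      using e unfolding E_def by auto
    show "F e w \<in> carrier_vec (nx R)"
      using mult_mat_vec_carrier[OF ct_flow(1)[OF pc[OF pT(2)] pT(3)] w] by (simp add: F_def pT)
    show "w = 0\<^sub>v (nx R)" if "F e w = 0\<^sub>v (nx R)"
      using ct_flow_inj[OF pc[OF pT(2)] w pT(3)] that by (simp add: F_def pT)
  next
    fix w assume wc: "w \<in> carrier_vec (nx R)" and w: "\<And>e. e \<in> E \<Longrightarrow> w \<in> N e"
    define V where "V = {w \<in> carrier_vec (nx R). \<forall>p T. rc_signal (np R) (par R) p \<and> 0 \<le> T
        \<longrightarrow> ct_silent R p T w}"
    have "V \<subseteq> {0\<^sub>v (nx R)}"
    proof (rule observable_lpv_par[OF R obs])
      show "vec_interior (np R) (par R) \<noteq> {}" using reg unfolding ct_regular_def by blast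
      show "vec_subspace (nx R) V"
        using ct_silent_linear[OF pc] unfolding vec_subspace_def V_def by auto
      fix q v assume q: "q \<in> par R" and v: "v \<in> V"
      have vc: "v \<in> carrier_vec (nx R)" using v unfolding V_def by blast
      have silent: "ct_silent R p T v" if "rc_signal (np R) (par R) p" "0 \<le> T" for p T
        using v that unfolding V_def by blast
      note cq = const[OF q]
      \<comment> \<open>Any positive duration serves: only the output at time 0 is read off, where
        the transition is the identity.\<close>
      have "ct_silent R (\<lambda>_. q) 1 v" by (rule silent[OF cq]) simp
      then have "C_at R q *\<^sub>v (ct_flow R (\<lambda>_. q) 0 *\<^sub>v v) = 0\<^sub>v (ny R)" unfolding ct_silent_def by simp
      then show "C_at R q *\<^sub>v v = 0\<^sub>v (ny R)" using vc by (simp add: ct_flow(2)[OF pc[OF cq]])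
      have Av: "A_at R q *\<^sub>v v \<in> carrier_vec (nx R)" by (rule mult_mat_vec_carrier[OF at_carriers(1) vc])
      have "ct_silent R p T (A_at R q *\<^sub>v v)" if p: "rc_signal (np R) (par R) p" and T: "0 \<le> T" for p T
        unfolding ct_silent_def
      proof (intro allI impI)
        fix t assume t: "0 \<le> t \<and> t < T"
        \<comment> \<open>The output of the experiment \<open>p\<close> at its time \<open>t\<close>
          as a linear map of the state in which it starts; it stays fixed while the duration
          \<open>s\<close> of the preceding constant phase varies.\<close>
        define Q where "Q = C_at R (p t) * ct_flow R p t"
        have fl: "ct_flow R p t \<in> carrier_mat (nx R) (nx R)" using ct_flow(1)[OF pc[OF p]] t by blast
        have Q: "Q \<in> carrier_mat (ny R) (nx R)"
          unfolding Q_def by (rule mult_carrier_mat[OF at_carriers(3) fl])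
        have Qv: "C_at R (p t) *\<^sub>v (ct_flow R p t *\<^sub>v x) = Q *\<^sub>v x" if "x \<in> carrier_vec (nx R)" for x
          unfolding Q_def by (rule assoc_mult_mat_vec[OF at_carriers(3) fl that, symmetric])
        have Qflow: "Q *\<^sub>v (ct_flow R (\<lambda>_. q) s *\<^sub>v v) = 0\<^sub>v (ny R)" if s: "0 \<le> s" for s
        proof -
          have "ct_silent R (append_signal (\<lambda>_. q) s p) (s + T) v"
            by (rule silent[OF app[OF cq p s]]) (use s T in simp)
          then have "ct_silent R p T (ct_flow R (\<lambda>_. q) s *\<^sub>v v)"
            using app_silent[OF cq p s vc T] by blast
          then have "C_at R (p t) *\<^sub>v (ct_flow R p t *\<^sub>v (ct_flow R (\<lambda>_. q) s *\<^sub>v v)) = 0\<^sub>v (ny R)"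
            using t unfolding ct_silent_def by blast
          then show ?thesis
            using Qv[OF mult_mat_vec_carrier[OF ct_flow(1)[OF pc[OF cq] s] vc]] by simp
        qed
        have "Q *\<^sub>v (A_at R q *\<^sub>v v) = 0\<^sub>v (ny R)"
        proof (rule eq_vecI)
          fix k assume "k < dim_vec (0\<^sub>v (ny R) :: real vec)"
          then have k: "k < ny R" by simp
          have "(\<Sum>j<nx R. Q $$ (k, j) * (A_at R q *\<^sub>v v) $ j) = 0"
          proof (rule ct_flow_const_derivative[OF _ vc])
            show "q \<in> carrier_vec (np R)" using q par by blast
            fix s :: real assume s: "0 \<le> s"
            show "(\<Sum>j<nx R. Q $$ (k, j) * (ct_flow R (\<lambda>_. q) s *\<^sub>v v) $ j) = 0"
              using mult_mat_vec_index[OF Q mult_mat_vec_carrier[OF ct_flow(1)[OF pc[OF cq] s] vc] k]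
                Qflow[OF s] k by simp
          qed
          then show "(Q *\<^sub>v (A_at R q *\<^sub>v v)) $ k = 0\<^sub>v (ny R) $ k"
            using mult_mat_vec_index[OF Q Av k] k by simp
        qed (use Q in simp)
        then show "C_at R (p t) *\<^sub>v (ct_flow R p t *\<^sub>v (A_at R q *\<^sub>v v)) = 0\<^sub>v (ny R)"
          using Qv[OF Av] by simp
      qed
      then show "A_at R q *\<^sub>v v \<in> V" unfolding V_def using Av by blast
    qed
    then show "w = 0\<^sub>v (nx R)" using w wc unfolding V_def N_def E_def by auto
  qed
  then show ?thesis unfolding N_def E_def by auto
qed

text \<open>A nonzero value would by right continuity force nonzero values on a whole interval
  \<open>(t, b)\<close>, which is not a null set.\<close>

lemma AE_zero_right_continuous:
  fixes h :: "real \<Rightarrow> real"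
  assumes ae: "AE t in lborel. 0 \<le> t \<longrightarrow> h t = 0" and h: "(h \<longlongrightarrow> h t) (at_right t)" and t: "0 \<le> t"
  shows "h t = 0"
proof (rule ccontr)
  assume "h t \<noteq> 0"
  then have "\<forall>\<^sub>F s in at_right t. dist (h s) (h t) < \<bar>h t\<bar>"
    using h by (intro tendstoD) auto
  then obtain b where b: "b > t" "\<And>s. t < s \<Longrightarrow> s < b \<Longrightarrow> dist (h s) (h t) < \<bar>h t\<bar>"
    unfolding eventually_at_right_field by blast
  obtain N where N: "{s \<in> space lborel. \<not> (0 \<le> s \<longrightarrow> h s = 0)} \<subseteq> N" "emeasure lborel N = 0" "N \<in> sets lborel"
    using ae by (rule AE_E)
  have "{t<..<b} \<subseteq> N"
    using N(1) b(2) t by (force simp: dist_real_def)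
  then have "emeasure lborel {t<..<b} \<le> emeasure lborel N" by (rule emeasure_mono[OF _ N(3)])
  then show False using N(2) b(1) by simp
qed

section \<open>Behaviors and minimality in continuous time\<close>

lemma restrict_pc_signals:
  assumes v: "pc_vec n v" and V: "\<And>t. 0 \<le> t \<Longrightarrow> v t \<in> V"
  shows "restrict v {0..} \<in> pc_signals n V"
  unfolding pc_signals_def
proof (intro CollectI conjI allI impI)
  show "restrict v {0..} \<in> {0..} \<rightarrow>\<^sub>E V"
    using V by (intro restrict_PiE_iff[THEN iffD2]) auto
  fix i assume "i < n"
  then have "piecewise_continuous (\<lambda>t. v t $ i)" using v unfolding pc_vec_def by blast
  then show "piecewise_continuous (\<lambda>t. restrict v {0..} t $ i)"
    by (rule piecewise_continuous_cong) simp
qed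

lemma ct_solution_pc_vec:
  assumes "lpv_ssa S" "ct_solution S x y u p"
  shows "pc_vec (nu S) u" "pc_vec (np S) p"
  using assms pc_signals_pc_vec[of u] pc_signals_pc_vec[of p] unfolding ct_solution_def lpv_ssa_def by auto

text \<open>A behavior contains classes of outputs, so only some representative \<open>y'\<close> is
  matched; \<open>y\<close> lies in its own class, hence in that of \<open>y'\<close>.\<close>

lemma ct_behavior_transfer:
  assumes eq: "ct_behavior S = ct_behavior R" and sol: "ct_solution R z y u p"
  shows "\<exists>x y'. ct_solution S x y' u p \<and> (AE t in lborel. 0 \<le> t \<longrightarrow> y t = y' t)"
proof -
  have "(output_class (ny R) y, u, p) \<in> ct_behavior R"
    unfolding ct_behavior_def using sol by blast
  then have "(output_class (ny R) y, u, p) \<in> ct_behavior S" unfolding eq .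
  then obtain x y' where x: "ct_solution S x y' u p" and cl: "output_class (ny R) y = output_class (ny S) y'"
    unfolding ct_behavior_def by blast
  have "y \<in> output_class (ny R) y"
    using sol unfolding output_class_def ct_solution_def by simp
  then have "y \<in> output_class (ny S) y'" using cl by simp
  then have "AE t in lborel. 0 \<le> t \<longrightarrow> y t = y' t"
    unfolding output_class_def by simp
  then show ?thesis using x by blast
qed

lemma projection_ct_state:
  assumes S: "lpv_ssa S" and R: "lpv_ssa R" and pr: "state_projection S R L L'"
    and x: "ct_state S x u p" and u: "\<And>t. 0 \<le> t \<Longrightarrow> u t \<in> carrier_vec (nu S)"
  shows "ct_state R (restrict (\<lambda>t. L *\<^sub>v x t) {0..}) u p"
  unfolding ct_state_def
proof (intro conjI allI impI)
  have L: "L \<in> carrier_mat (nx R) (nx S)" using pr unfolding state_projection_def by blast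
  note xc = ct_state_carrier[OF x]
  show "restrict (\<lambda>t. L *\<^sub>v x t) {0..} \<in> {0..} \<rightarrow>\<^sub>E carrier_vec (nx R)"
    using mult_mat_vec_carrier[OF L xc] by (intro restrict_PiE_iff[THEN iffD2]) auto
  fix i b assume i: "i < nx R"
  have "is_primitive b (\<lambda>t. \<Sum>k<nx S. L $$ (i, k) * state_rhs S (p t) (x t) (u t) $ k) (\<lambda>t. \<Sum>k<nx S. L $$ (i,
      k) * x t $ k)"
    by (rule is_primitive_sum) (use x in \<open>auto simp: ct_state_def\<close>)
  then show "is_primitive b (\<lambda>t. state_rhs R (p t) (restrict (\<lambda>t. L *\<^sub>v x t) {0..} t) (u t) $ i)
      (\<lambda>t. restrict (\<lambda>t. L *\<^sub>v x t) {0..} t $ i)"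
  proof (rule is_primitive_transform)
    fix t assume "t \<in> {0..b}"
    then have t: "0 \<le> t" by simp
    show "restrict (\<lambda>t. L *\<^sub>v x t) {0..} t $ i = (\<Sum>k<nx S. L $$ (i, k) * x t $ k)"
      using t mult_mat_vec_index[OF L xc[OF t] i] by simp
    show "state_rhs R (p t) (restrict (\<lambda>t. L *\<^sub>v x t) {0..} t) (u t) $ i
        = (\<Sum>k<nx S. L $$ (i, k) * state_rhs S (p t) (x t) (u t) $ k)"
      using t projection_rhs(1)[OF S R pr xc[OF t] u[OF t], of "p t"]
        mult_mat_vec_index[OF L rhs_carriers(1) i, of "p t" "x t" "u t"] by simp
  qed
qed

lemma projection_ct_behavior:
  assumes S: "lpv_ssa S" and R: "lpv_ssa R" and pr: "state_projection S R L L'"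
  shows "ct_behavior R = ct_behavior S"
proof -
  have same: "np R = np S" "nu R = nu S" "ny R = ny S" "par R = par S" and L: "L \<in> carrier_mat (nx R) (nx S)"
    and L': "L' \<in> carrier_mat (nx S) (nx R)" and LL': "L * L' = 1\<^sub>m (nx R)"
    using pr unfolding state_projection_def by auto
  note rhs = projection_rhs[OF S R pr]
  have lift: "ct_solution R (restrict (\<lambda>t. L *\<^sub>v x t) {0..}) y u p"
    if u: "\<And>t. 0 \<le> t \<Longrightarrow> u t \<in> carrier_vec (nu S)" and sol: "ct_solution S x y u p" for x y u p
  proof -
    have x: "ct_state S x u p" using sol ct_solution_iff[OF S] by blast
    have "AE t in lborel. 0 \<le> t \<longrightarrow> y t = output_rhs S (p t) (x t) (u t)"
      using sol ct_solution_iff[OF S] by blast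
    then have "AE t in lborel. 0 \<le> t \<longrightarrow> y t = output_rhs R (p t) (restrict (\<lambda>t. L *\<^sub>v x t) {0..} t) (u t)"
      by eventually_elim (use rhs(2)[OF ct_state_carrier[OF x] u] in auto)
    then show ?thesis
      using sol projection_ct_state[OF S R pr x u] same
      unfolding ct_solution_iff[OF S] ct_solution_iff[OF R] by simp
  qed
  have unlift: "\<exists>x. ct_solution S x y u p" if sol: "ct_solution R z y u p" for z y u p
  proof -
    have up: "pc_vec (nu S) u" "pc_vec (np S) p" using ct_solution_pc_vec[OF R sol] same by simp_all
    have u: "u t \<in> carrier_vec (nu S)" if "0 \<le> t" for t using up(1) that unfolding pc_vec_def by blast
    have z: "ct_state R z u p" using sol ct_solution_iff[OF R] by blast
    note z0 = ct_state_carrier[OF z order_refl]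
    obtain x where x: "ct_state S x u p" and x0: "x 0 = L' *\<^sub>v z 0"
      using ct_state_exists[OF up mult_mat_vec_carrier[OF L' z0]] by blast
    have Lx: "L *\<^sub>v x t = z t" if t: "0 \<le> t" for t
    proof -
      have "restrict (\<lambda>t. L *\<^sub>v x t) {0..} t = z t"
      proof (rule ct_state_unique[OF _ _ projection_ct_state[OF S R pr x u] z _ t])
        show "restrict (\<lambda>t. L *\<^sub>v x t) {0..} 0 = z 0"
          using assoc_mult_mat_vec[OF L L' z0] LL' z0 x0 by simp
      qed (use up same in auto)
      then show ?thesis using t by simp
    qed
    have "AE t in lborel. 0 \<le> t \<longrightarrow> y t = output_rhs R (p t) (z t) (u t)"
      using sol ct_solution_iff[OF R] by blast
    then have "AE t in lborel. 0 \<le> t \<longrightarrow> y t = output_rhs S (p t) (x t) (u t)"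
      by eventually_elim (use rhs(2)[OF ct_state_carrier[OF x] u] Lx in auto)
    then have "ct_solution S x y u p"
      using sol x same unfolding ct_solution_iff[OF S] ct_solution_iff[OF R] by simp
    then show ?thesis by blast
  qed
  have "(\<exists>x. ct_solution R x y u p) \<longleftrightarrow> (\<exists>x. ct_solution S x y u p)" for y u p
  proof
    assume "\<exists>x. ct_solution S x y u p"
    then obtain x where sol: "ct_solution S x y u p" by blast
    have "\<And>t. 0 \<le> t \<Longrightarrow> u t \<in> carrier_vec (nu S)"
      using ct_solution_pc_vec(1)[OF S sol] unfolding pc_vec_def by blast
    from lift[OF this sol] show "\<exists>x. ct_solution R x y u p" by blast
  qed (use unlift in blast)
  then show ?thesis unfolding ct_behavior_def same by simp
qed

text \<open>The dimension count of the discrete-time case, with the outputs of the two systems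
  compared only almost everywhere; right continuity removes the null set before the separating
  property is applied.\<close>

lemma ct_observable_minimal:
  assumes R: "lpv_ssa R" and obs: "observable_lpv R" and reg: "ct_regular R"
  shows "ct_minimal R"
  unfolding ct_minimal_def
proof (intro conjI R allI impI)
  fix S assume "lpv_ssa S \<and> ct_behavior S = ct_behavior R"
  then have S: "lpv_ssa S" and eq: "ct_behavior S = ct_behavior R" by auto
  show "nx R \<le> nx S"
  proof (rule ccontr)
    assume "\<not> nx R \<le> nx S"
    then have less: "nx S < nx R" by simp
    obtain p0 T where p0: "rc_signal (np R) (par R) p0" and "0 \<le> T"
      and sep: "\<And>w. w \<in> carrier_vec (nx R) \<Longrightarrow> ct_silent R p0 T w \<Longrightarrow> w = 0\<^sub>v (nx R)"
      using ct_separating_signal[OF R obs reg] by blast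
    have pc0: "pc_vec (np R) p0" using p0 unfolding rc_signal_def by blast
    \<comment> \<open>The separating signal is a total function, whereas behaviors contain signals
      that are \<open>undefined\<close> at negative times; the two agree from time 0 on.\<close>
    define p where "p = restrict p0 {0..}"
    have p: "p \<in> pc_signals (np R) (par R)"
      unfolding p_def using p0 by (intro restrict_pc_signals pc0) (auto simp: rc_signal_def)
    have pcp: "pc_vec (np R) p"
      using p R unfolding lpv_ssa_def by (intro pc_signals_pc_vec) auto
    define \<Phi> where "\<Phi> = ct_flow R p0"
    note \<Phi> = ct_flow[OF pc0, folded \<Phi>_def]
    have pflow: "ct_free R b p (\<lambda>t. \<Phi> t *\<^sub>v w)" if w: "w \<in> carrier_vec (nx R)" for w b
      unfolding ct_free_def
    proof (intro conjI ballI allI impI)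
      fix i assume i: "i < nx R"
      show "is_primitive b (\<lambda>t. (A_at R (p t) *\<^sub>v (\<Phi> t *\<^sub>v w)) $ i) (\<lambda>t. (\<Phi> t *\<^sub>v w) $ i)"
        by (rule is_primitive_transform[OF ct_freeD(2)[OF \<Phi>(3)[OF w] i]]) (auto simp: p_def)
    qed (use ct_freeD(1)[OF \<Phi>(3)[OF w]] in auto)
    define u :: "real \<Rightarrow> real vec" where "u = restrict (\<lambda>_. 0\<^sub>v (nu R)) {0..}"
    have u0: "u t = 0\<^sub>v (nu R)" if "0 \<le> t" for t unfolding u_def using that by simp
    have u: "u \<in> pc_signals (nu R) (carrier_vec (nu R))"
      unfolding u_def by (intro restrict_pc_signals) (auto simp: pc_vec_def intro: piecewise_continuous_const)
    have pcu: "pc_vec (nu R) u" by (rule pc_signals_pc_vec[OF u]) simp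
    define same_out where "same_out j x \<longleftrightarrow> (\<forall>b. ct_free S b p x) \<and>
        (AE t in lborel. 0 \<le> t \<longrightarrow>
          C_at R (p0 t) *\<^sub>v (\<Phi> t *\<^sub>v unit_vec (nx R) j) = C_at S (p0 t) *\<^sub>v x t)" for j x
    \<comment> \<open>The second conjunct records that \<open>p\<close> is also a scheduling signal
      of \<open>S\<close>, whose parameter dimension is known only through its solutions.\<close>
    have ex: "\<exists>x. same_out j x \<and> pc_vec (np S) p" for j
    proof -
      define z where "z = restrict (\<lambda>t. \<Phi> t *\<^sub>v unit_vec (nx R) j) {0..}"
      have z: "ct_state R z u p"
        unfolding z_def by (rule ct_free_imp_ct_state[OF pflow u0]) simp_all
      define y where "y = restrict (\<lambda>t. output_rhs R (p t) (z t) (u t)) {0..}"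
      have "y \<in> pc_signals (ny R) (carrier_vec (ny R))"
        unfolding y_def by (intro restrict_pc_signals pc_vec_rhs(2) pcp pcu ct_state_pc_vec[OF z]) simp
      then have "ct_solution R z y u p"
        unfolding ct_solution_iff[OF R] using u p z by (simp add: y_def)
      then obtain x y' where x: "ct_solution S x y' u p" and ae: "AE t in lborel. 0 \<le> t \<longrightarrow> y t = y' t"
        using ct_behavior_transfer[OF eq] by blast
      note pcS = ct_solution_pc_vec[OF S x]
      have "u 0 \<in> carrier_vec (nu S)" using pcS(1) unfolding pc_vec_def by simp
      then have nu: "nu S = nu R" using u0[of 0] by (metis carrier_vecD index_zero_vec(2) order_refl)
      have u0': "u t = 0\<^sub>v (nu S)" if "0 \<le> t" for t using u0[OF that] nu by simp
      have xs: "ct_state S x u p" and ae': "AE t in lborel. 0 \<le> t \<longrightarrow> y' t = output_rhs S (p t) (x t) (u t)"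
        using x unfolding ct_solution_iff[OF S] by auto
      have "AE t in lborel. 0 \<le> t \<longrightarrow>
          C_at R (p0 t) *\<^sub>v (\<Phi> t *\<^sub>v unit_vec (nx R) j) = C_at S (p0 t) *\<^sub>v x t"
        using ae ae'
      proof eventually_elim
        case (elim t)
        show ?case
        proof
          assume t: "0 \<le> t"
          have "C_at R (p0 t) *\<^sub>v (\<Phi> t *\<^sub>v unit_vec (nx R) j) = y t"
            using t rhs_zero_input(2)[OF ct_state_carrier[OF z t], of "p t"] u0[OF t]
            by (simp add: y_def z_def p_def)
          also have "\<dots> = C_at S (p t) *\<^sub>v x t"
            using elim t rhs_zero_input(2)[OF ct_state_carrier[OF xs t], of "p t"] u0'[OF t] by simp
          finally show "C_at R (p0 t) *\<^sub>v (\<Phi> t *\<^sub>v unit_vec (nx R) j) = C_at S (p0 t) *\<^sub>v x t"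
            using t by (simp add: p_def)
        qed
      qed
      then have "same_out j x"
        unfolding same_out_def using ct_state_zero_input[OF xs u0'] by simp
      then show ?thesis using pcS(2) by blast
    qed
    have pS: "pc_vec (np S) p" using ex[of 0] by blast
    have "\<forall>j. \<exists>x. same_out j x" using ex by blast
    from choice[OF this] obtain x where "\<And>j. same_out j (x j)" by blast
    then have x: "\<And>j b. ct_free S b p (x j)"
      and out: "\<And>j. AE t in lborel. 0 \<le> t \<longrightarrow>
          C_at R (p0 t) *\<^sub>v (\<Phi> t *\<^sub>v unit_vec (nx R) j) = C_at S (p0 t) *\<^sub>v x j t"
      unfolding same_out_def by blast+
    obtain c where c: "c \<in> carrier_vec (nx R)" "c \<noteq> 0\<^sub>v (nx R)"
      and c0: "vlincomb (nx S) (nx R) c (\<lambda>j. x j 0) = 0\<^sub>v (nx S)"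
      using nontrivial_vlincomb_zero[OF less] by blast
    \<comment> \<open>The combination is itself a free trajectory of \<open>S\<close> and starts at
      0.\<close>
    have X: "vlincomb (nx S) (nx R) c (\<lambda>j. x j t) = 0\<^sub>v (nx S)" if "0 \<le> t" for t
      by (rule ct_free_zero[OF pS ct_free_vlincomb[OF x], where a = 0 and b = t]) (use c0 that in auto)
    \<comment> \<open>Finitely many null sets have a null union, so one exceptional set serves all
      unit states.\<close>
    have "AE t in lborel. \<forall>j\<in>{..<nx R}. 0 \<le> t \<longrightarrow>
          C_at R (p0 t) *\<^sub>v (\<Phi> t *\<^sub>v unit_vec (nx R) j) = C_at S (p0 t) *\<^sub>v x j t"
      by (intro AE_finite_allI out) simp
    then have ae: "AE t in lborel. 0 \<le> t \<longrightarrow> C_at R (p0 t) *\<^sub>v (\<Phi> t *\<^sub>v c) = 0\<^sub>v (ny R)"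
    proof eventually_elim
      case (elim t)
      show ?case
      proof
        assume t: "0 \<le> t"
        have xc: "x j t \<in> carrier_vec (nx S)" for j using ct_freeD(1)[OF x[of t j]] t by auto
        have uc: "\<Phi> t *\<^sub>v unit_vec (nx R) j \<in> carrier_vec (nx R)" for j
          by (rule mult_mat_vec_carrier[OF \<Phi>(1)[OF t] unit_vec_carrier])
        have "\<Phi> t *\<^sub>v c = vlincomb (nx R) (nx R) c (\<lambda>j. \<Phi> t *\<^sub>v unit_vec (nx R) j)"
          using mult_mat_vlincomb[OF \<Phi>(1)[OF t], of "nx R" "unit_vec (nx R)" c] vlincomb_unit[OF c(1)] by simp
        then have "C_at R (p0 t) *\<^sub>v (\<Phi> t *\<^sub>v c)
            = vlincomb (ny R) (nx R) c (\<lambda>j. C_at R (p0 t) *\<^sub>v (\<Phi> t *\<^sub>v unit_vec (nx R) j))"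
          using mult_mat_vlincomb[OF at_carriers(3) uc] by simp
        also have "\<dots> = vlincomb (ny R) (nx R) c (\<lambda>j. C_at S (p0 t) *\<^sub>v x j t)"
          unfolding vlincomb_def using elim t by (intro eq_vecI) auto
        \<comment> \<open>Equal vectors have equal dimension. The unit state 0 is available because
          \<open>nx S < nx R\<close> makes \<open>nx R\<close> positive.\<close>
        also have "ny R = ny S"
        proof -
          have "C_at R (p0 t) *\<^sub>v (\<Phi> t *\<^sub>v unit_vec (nx R) 0) = C_at S (p0 t) *\<^sub>v x 0 t"
            using elim t less by auto
          from arg_cong[OF this, of dim_vec] show ?thesis
            using carrier_matD(1)[OF at_carriers(3)] by simp
        qed
        also have "vlincomb (ny S) (nx R) c (\<lambda>j. C_at S (p0 t) *\<^sub>v x j t)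
            = C_at S (p0 t) *\<^sub>v vlincomb (nx S) (nx R) c (\<lambda>j. x j t)"
          by (rule mult_mat_vlincomb[OF at_carriers(3) xc, symmetric])
        also have "\<dots> = 0\<^sub>v (ny S)" unfolding X[OF t] by (rule mult_mat_zero_vec[OF at_carriers(3)])
        finally show "C_at R (p0 t) *\<^sub>v (\<Phi> t *\<^sub>v c) = 0\<^sub>v (ny R)" using \<open>ny R = ny S\<close> by simp
      qed
    qed
    have zc: "\<Phi> t *\<^sub>v c \<in> carrier_vec (nx R)" if "0 \<le> t" for t
      by (rule mult_mat_vec_carrier[OF \<Phi>(1)[OF that] c(1)])
    have "ct_silent R p0 T c"
      unfolding ct_silent_def \<Phi>_def[symmetric]
    proof (intro allI impI)
      fix t assume "0 \<le> t \<and> t < T"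
      then have t: "0 \<le> t" by simp
      show "C_at R (p0 t) *\<^sub>v (\<Phi> t *\<^sub>v c) = 0\<^sub>v (ny R)"
      proof (rule eq_vecI)
        fix k assume "k < dim_vec (0\<^sub>v (ny R) :: real vec)"
        then have k: "k < ny R" by simp
        \<comment> \<open>Component \<open>k\<close> of the zero-input output from \<open>c\<close>.
          It is right continuous, since \<open>p0\<close> is right continuous and the state
          trajectory is continuous, and it vanishes almost everywhere.\<close>
        define h where "h s = (\<Sum>j<nx R. C_at R (p0 s) $$ (k, j) * (\<Phi> s *\<^sub>v c) $ j)" for s
        have hC: "(C_at R (p0 s) *\<^sub>v (\<Phi> s *\<^sub>v c)) $ k = h s" if "0 \<le> s" for s
          unfolding h_def by (rule mult_mat_vec_index[OF at_carriers(3) zc[OF that] k])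
        have "AE s in lborel. 0 \<le> s \<longrightarrow> h s = 0"
          using ae
        proof eventually_elim
          case (elim s)
          then show ?case using hC[of s] k by simp
        qed
        moreover have "(h \<longlongrightarrow> h t) (at_right t)"
          unfolding h_def
        proof (intro tendsto_sum tendsto_mult)
          fix j assume "j \<in> {..<nx R}"
          then have j: "j < nx R" by simp
          have "((\<lambda>s. p0 s $ i) \<longlongrightarrow> p0 t $ i) (at_right t)" if "i < np R" for i
            using p0 that t unfolding rc_signal_def by blast
          then show "((\<lambda>s. C_at R (p0 s) $$ (k, j)) \<longlongrightarrow> C_at R (p0 t) $$ (k, j)) (at_right t)"
            unfolding C_at_def affine_mat_index[OF k j]
            by (intro tendsto_add tendsto_sum tendsto_mult tendsto_const) auto
          have "continuous_on {0..} (\<lambda>s. (\<Phi> s *\<^sub>v c) $ j)"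
            by (intro continuous_on_atLeastI is_primitive_continuous[OF ct_freeD(2)[OF \<Phi>(3)[OF c(1)] j]])
          then have "((\<lambda>s. (\<Phi> s *\<^sub>v c) $ j) \<longlongrightarrow> (\<Phi> t *\<^sub>v c) $ j) (at t within {0..})"
            using t unfolding continuous_on_def by blast
          then show "((\<lambda>s. (\<Phi> s *\<^sub>v c) $ j) \<longlongrightarrow> (\<Phi> t *\<^sub>v c) $ j) (at_right t)"
            by (rule tendsto_within_subset) (use t in auto)
        qed
        ultimately have "h t = 0" using t by (rule AE_zero_right_continuous)
        then show "(C_at R (p0 t) *\<^sub>v (\<Phi> t *\<^sub>v c)) $ k = 0\<^sub>v (ny R) $ k" using hC[OF t] k by simp
      qed (simp add: carrier_matD(1)[OF at_carriers(3)])
    qed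
    then show False using sep[OF c(1)] c(2) by blast
  qed
qed

theorem corollary1:
  fixes \<Sigma> \<Sigma>O :: lpv
  assumes "lpv_ssa \<Sigma>"
    and "nx \<Sigma> \<ge> 1"
    and "obs_reduction \<Sigma> \<Sigma>O"
  shows "(ct_regular \<Sigma> \<longrightarrow>
            ct_regular \<Sigma>O \<and> ct_minimal \<Sigma>O \<and> ct_behavior \<Sigma>O = ct_behavior \<Sigma>) \<and>
         (dt_regular \<Sigma> \<longrightarrow>
            dt_regular \<Sigma>O \<and> dt_minimal \<Sigma>O \<and> dt_behavior \<Sigma>O = dt_behavior \<Sigma>)"
proof -
  obtain L L' where R: "lpv_ssa \<Sigma>O" and pr: "state_projection \<Sigma> \<Sigma>O L L'"
    and ker: "mat_kernel (obs_mat \<Sigma> (nx \<Sigma> - 1)) \<subseteq> mat_kernel L"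
    using obs_reduction_projection[OF assms(1,3)] by blast
  note obs = projection_observable[OF assms(1) R pr ker]
  \<comment> \<open>In continuous time RC concerns only the scheduling set, which the reduction
    leaves unchanged.\<close>
  have "ct_regular \<Sigma>O" if "ct_regular \<Sigma>"
    using that pr unfolding ct_regular_def state_projection_def by simp
  moreover have "dt_regular \<Sigma>O" if "dt_regular \<Sigma>"
    by (rule projection_dt_regular[OF assms(1) R pr that])
  ultimately show ?thesis
    using ct_observable_minimal[OF R obs] dt_observable_minimal[OF R obs]
      projection_ct_behavior[OF assms(1) R pr] projection_dt_behavior[OF assms(1) R pr] by blast
qed

end
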